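(* Let $s,t>0$ and let $S=(S_d)_{d\in\mathbb{N}}$ be a linear tensor product problem generated by a compact linear operator $S_1\colon H_1\to G_1$ between Hilbert spaces. Let $\lambda_1\ge\lambda_2\ge\dots\ge0$ be the ordered eigenvalues of $S_1^*\circ S_1$, assume $\lambda_2>0$, and let $m\in\mathbb{N}$ be the multiplicity of the largest eigenvalue, i.e. $\lambda_1=\dots=\lambda_m>\lambda_{m+1}$. Consider the worst case setting for the absolute error criterion and the class $\Lambda^{\mathrm{all}}$. (i) Let $\lambda_1<1$. Then $S$ is $(s,t)$-weakly tractable if and only if $\displaystyle\lim_{n\to\infty}\frac{\lambda_n}{\ln^{-2/s} n}=0$. (ii) Let $\lambda_1=1$. 1.) If $m=1$, then $S$ is $(s,t)$-weakly tractable if and only if $\displaystyle\lim_{n\to\infty}\frac{\lambda_n}{\ln^{-2/s} n}=0$. 2.) If $m>1$, then $S$ is $(s,t)$-weakly tractable if and only if $t>1$ and $\displaystyle\lim_{n\to\infty}\frac{\lambda_n}{\ln^{-2/s} n}=0$. (iii) Let $\lambda_1>1$ and define $S_1':=\frac{1}{\sqrt{\lambda_1}}S_1$. Then $(s,t)$-weak tractability of $S$ implies $$t>1\quad\text{and}\quad \lim_{\epsilon^{-1}+d\to\infty}\frac{\max_{\ell=1,\dots,d}\left[\ell\cdot\ln n^{\mathrm{abs}}\!\left((\epsilon/\lambda_1^{d/2})^{1/\ell},S_1'\right)\right]}{\epsilon^{-s}+d^{t}}=0.$$ Moreover, the conditions $$t>1\quad\text{and}\quad \lim_{\epsilon^{-1}+d\to\infty}\frac{\ln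 d\cdot\max_{\ell=1,\dots,d}\left[\ell\cdot\ln n^{\mathrm{abs}}\!\left((\epsilon/\lambda_1^{d/2})^{1/\ell},S_1'\right)\right]}{\epsilon^{-s}+d^{t}}=0$$ are sufficient for $S$ to be $(s,t)$-weakly tractable.
   Context: Linear tensor product problem. $S_1\colon H_1\to G_1$ is a compact linear operator between Hilbert spaces, $H_1$ infinite dimensional and separable; for $d\in\mathbb{N}=\{1,2,\dots\}$, $H_d:=\bigotimes_{\ell=1}^d H_1$, $G_d:=\bigotimes_{\ell=1}^d G_1$ (Hilbert space tensor products) and $S_d:=\bigotimes_{\ell=1}^d S_1\colon H_d\to G_d$. The eigenvalues $\lambda_1\ge\lambda_2\ge\dots\ge 0$ of $W_1:=S_1^*\circ S_1$ are counted with multiplicity. The eigenvalues of $W_d:=S_d^*\circ S_d$ are the products $\prod_{\ell=1}^d\lambda_{j_\ell}$, $(j_1,\dots,j_d)\in\mathbb{N}^d$. Worst case setting for $\Lambda^{\mathrm{all}}$, absolute criterion. For a compact linear operator $T\colon H\to G$ between Hilbert spaces and $\epsilon>0$, $n^{\mathrm{abs}}(\epsilon,T)$ is the smallest $n\in\mathbb{N}_0$ such that $\inf_{A}\sup_{\|f\|_{H}\le 1}\|T f-A f\|_{G}\le\epsilon$, where the infimum is over all (deterministic, linear, non-adaptive) algorithms $A\colon H\to G$ using at most $n$ continuous linear functionals of $f$. It is well known that $n^{\mathrm{abs}}(\epsilon,T)$ is the number of eigenvalues of $T^*T$ (with multiplicity) that are larger than $\epsilon^2$; e.g. $n^{\mathrm{abs}}(\epsilon,S_1')=\#\{j\in\mathbb{N}:\lambda_j/\lambda_1>\epsilon^2\}$.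 The initial error of $S_d$ is $\epsilon_d^{\mathrm{init}}:=\|S_d\|=\lambda_1^{d/2}$. $(s,t)$-weak tractability (absolute criterion) means $$\lim_{\epsilon^{-1}+d\to\infty}\frac{\ln n^{\mathrm{abs}}(\epsilon,S_d)}{\epsilon^{-s}+d^{t}}=0.$$ All limits $\lim_{\epsilon^{-1}+d\to\infty}$ are taken along all sequences $((\epsilon_k,d_k))_{k\in\mathbb{N}}\subset(0,1]\times\mathbb{N}$ with $\epsilon_k^{-1}+d_k\to\infty$ and $\epsilon_k<\epsilon_{d_k}^{\mathrm{init}}$ for all $k$. Notation. $\ln^{p} n$ means $[\ln(n)]^{p}$. *)

theory Defs
  imports "HOL-Analysis.Analysis"
begin

section \<open>Hilbert spaces over the real or complex numbers\<close>

text \<open>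
  The class axiom forces every element \<open>z\<close> to be a root of a real quadratic polynomial, so
  the instances are, up to isomorphism, exactly the real and the complex numbers, and \<open>scnj\<close> is
  the complex conjugation.
\<close>

class real_or_complex = real_normed_field +
  fixes scnj :: "'a \<Rightarrow> 'a"
  assumes mult_scnj: "z * scnj z = (norm z)\<^sup>2 *\<^sub>R 1"
    and scnj_0: "scnj 0 = 0"

instantiation real :: real_or_complex
begin
definition scnj_real :: "real \<Rightarrow> real" where "scnj_real z = z"
instance by standard (simp_all add: scnj_real_def power2_eq_square)
end

instantiation complex :: real_or_complex
begin
definition scnj_complex :: "complex \<Rightarrow> complex" where "scnj_complex = cnj"
instance
proof
  fix z :: complex
  show "z * scnj z = (norm z)\<^sup>2 *\<^sub>R 1"
    using complex_norm_square[of z] by (simp add: scnj_complex_def scaleR_conv_of_real)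
qed (simp add: scnj_complex_def)
end

text \<open>
  The addition, norm and topology of a Hilbert space come from its type, which is required to be
  complete; the scalar multiplication and the inner product (linear in the first argument) over
  the scalar field \<open>'k\<close> are parameters.
\<close>

locale hilbert_space = vector_space sc
  for sc :: "'k::real_or_complex \<Rightarrow> 'a::banach \<Rightarrow> 'a" +
  fixes ip :: "'a \<Rightarrow> 'a \<Rightarrow> 'k"
  assumes scale_of_real: "sc (of_real r) x = r *\<^sub>R x"
    and ip_add: "ip (x + y) z = ip x z + ip y z"
    and ip_scale: "ip (sc a x) y = a * ip x y"
    and ip_scnj: "ip y x = scnj (ip x y)"
    and ip_norm: "ip x x = of_real ((norm x)\<^sup>2)"

lemma hilbert_space_real:
  "hilbert_space (*\<^sub>R) (inner :: 'a::{real_inner,banach} \<Rightarrow> 'a \<Rightarrow> real)"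
proof unfold_locales
  fix x y z :: 'a and a r :: real
  show "of_real r *\<^sub>R x = r *\<^sub>R x" by simp
  show "inner (x + y) z = inner x z + inner y z" by (rule inner_add_left)
  show "inner (a *\<^sub>R x) y = a * inner x y" by (rule inner_scaleR_left)
  show "inner y x = scnj (inner x y)" unfolding scnj_real_def by (rule inner_commute)
  show "inner x x = of_real ((norm x)\<^sup>2)" by (simp add: power2_norm_eq_inner)
qed

lemma hilbert_space_complex: "hilbert_space (*) (\<lambda>x y :: complex. x * cnj y)"
proof unfold_locales
  fix x y z a :: complex and r :: real
  show "of_real r * x = r *\<^sub>R x" by (simp add: scaleR_conv_of_real)
  show "(x + y) * cnj z = x * cnj z + y * cnj z" "a * x * cnj y = a * (x * cnj y)"
    by (simp_all add: algebra_simps)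
  show "y * cnj x = scnj (x * cnj y)" by (simp add: scnj_complex_def)
  show "x * cnj x = of_real ((norm x)\<^sup>2)" using complex_norm_square[of x] by simp
qed


section \<open>Operators\<close>

text \<open>
  Bounded linear operators whose domain is a linear subspace \<open>X\<close> of the ambient type. With
  \<open>sc2 = (*)\<close> these are the continuous linear functionals on \<open>X\<close>.
\<close>

definition bounded_linear_on ::
  "('k::real_or_complex \<Rightarrow> 'a::banach \<Rightarrow> 'a) \<Rightarrow> ('k \<Rightarrow> 'b::real_normed_vector \<Rightarrow> 'b) \<Rightarrow>
   'a set \<Rightarrow> ('a \<Rightarrow> 'b) \<Rightarrow> bool" where
  "bounded_linear_on sc1 sc2 X T \<longleftrightarrow>
     (\<forall>x\<in>X. \<forall>y\<in>X. T (x + y) = T x + T y) \<and>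
     (\<forall>a. \<forall>x\<in>X. T (sc1 a x) = sc2 a (T x)) \<and>
     (\<exists>C. \<forall>x\<in>X. norm (T x) \<le> C * norm x)"

definition compact_operator ::
  "('k::real_or_complex \<Rightarrow> 'a::banach \<Rightarrow> 'a) \<Rightarrow> ('k \<Rightarrow> 'b::banach \<Rightarrow> 'b) \<Rightarrow> ('a \<Rightarrow> 'b) \<Rightarrow> bool" where
  "compact_operator sc1 sc2 T \<longleftrightarrow>
     bounded_linear_on sc1 sc2 UNIV T \<and> compact (closure (T ` cball 0 1))"

definition operator_norm :: "'a::real_normed_vector set \<Rightarrow> ('a \<Rightarrow> 'b::real_normed_vector) \<Rightarrow> real" where
  "operator_norm X T = (SUP f\<in>X \<inter> cball 0 1. norm (T f))"

definition hilbert_adjoint ::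
  "('a \<Rightarrow> 'a \<Rightarrow> 'k) \<Rightarrow> ('b \<Rightarrow> 'b \<Rightarrow> 'k) \<Rightarrow> ('a \<Rightarrow> 'b) \<Rightarrow> 'b \<Rightarrow> 'a" where
  "hilbert_adjoint ip1 ip2 T = (THE T'. \<forall>x y. ip2 (T x) y = ip1 x (T' y))"

definition eigenspace :: "('k::real_or_complex \<Rightarrow> 'a \<Rightarrow> 'a) \<Rightarrow> ('a \<Rightarrow> 'a) \<Rightarrow> real \<Rightarrow> 'a set" where
  "eigenspace sc W \<mu> = {x. W x = sc (of_real \<mu>) x}"

text \<open>
  \<open>lam 1 \<ge> lam 2 \<ge> \<dots> \<ge> 0\<close> lists the eigenvalues of the positive semidefinite compact
  operator \<open>W\<close> on an infinite-dimensional space with multiplicities; \<open>lam 0\<close> is unused. Every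
  positive number occurs as often as the dimension of its eigenspace says, which is finite by
  compactness. If there are only finitely many positive eigenvalues, the list continues with
  zeros; if there are infinitely many, a possible eigenvalue 0 is never reached by the list.
\<close>

definition ordered_eigenvalues ::
  "('k::real_or_complex \<Rightarrow> 'a::banach \<Rightarrow> 'a) \<Rightarrow> ('a \<Rightarrow> 'a) \<Rightarrow> (nat \<Rightarrow> real) \<Rightarrow> bool" where
  "ordered_eigenvalues sc W lam \<longleftrightarrow>
     (\<forall>i\<ge>1. \<forall>j\<ge>i. lam j \<le> lam i) \<and>
     (\<forall>j\<ge>1. 0 \<le> lam j) \<and>
     (\<forall>\<mu>>0. finite {j. 1 \<le> j \<and> lam j = \<mu>} \<and>
        card {j. 1 \<le> j \<and> lam j = \<mu>} = vector_space.dim sc (eigenspace sc W \<mu>))"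


section \<open>Hilbert space tensor powers\<close>

text \<open>
  Here \<open>tens [x\<^sub>1, \<dots>, x\<^sub>d]\<close> is the elementary tensor of \<open>x\<^sub>1, \<dots>, x\<^sub>d\<close>. For every
  \<open>d \<ge> 1\<close> it is multilinear with the usual inner product of elementary tensors, and the
  tensor power is the closed span of these. This determines each tensor power up to isometric
  isomorphism. All tensor powers live in one ambient Hilbert space \<open>'p\<close> (one may take the
  Hilbert direct sum of all of them); nothing is assumed on the relative position of tensor
  powers with distinct \<open>d\<close>.
\<close>

definition elementary_tensors ::
  "('k::real_or_complex \<Rightarrow> 'a::banach \<Rightarrow> 'a) \<Rightarrow> ('a \<Rightarrow> 'a \<Rightarrow> 'k) \<Rightarrow>
   ('k \<Rightarrow> 'p::banach \<Rightarrow> 'p) \<Rightarrow> ('p \<Rightarrow> 'p \<Rightarrow> 'k) \<Rightarrow> ('a list \<Rightarrow> 'p) \<Rightarrow> bool" where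
  "elementary_tensors sc ip scP ipP tens \<longleftrightarrow>
     (\<forall>xs i a b x y. i < length xs \<longrightarrow>
        tens (xs[i := sc a x + sc b y]) =
          scP a (tens (xs[i := x])) + scP b (tens (xs[i := y]))) \<and>
     (\<forall>xs ys. xs \<noteq> [] \<and> length xs = length ys \<longrightarrow>
        ipP (tens xs) (tens ys) = (\<Prod>i<length xs. ip (xs ! i) (ys ! i)))"

definition tensor_power ::
  "('k::real_or_complex \<Rightarrow> 'p::banach \<Rightarrow> 'p) \<Rightarrow> ('a list \<Rightarrow> 'p) \<Rightarrow> nat \<Rightarrow> 'p set" where
  "tensor_power scP tens d = closure (module.span scP (tens ` {xs. length xs = d}))"

definition is_tensor_power_operator ::
  "('k::real_or_complex \<Rightarrow> 'p::banach \<Rightarrow> 'p) \<Rightarrow> ('k \<Rightarrow> 'q::banach \<Rightarrow> 'q) \<Rightarrow>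
   ('a list \<Rightarrow> 'p) \<Rightarrow> ('b list \<Rightarrow> 'q) \<Rightarrow> ('a \<Rightarrow> 'b) \<Rightarrow> nat \<Rightarrow> ('p \<Rightarrow> 'q) \<Rightarrow> bool" where
  "is_tensor_power_operator scP scQ tensH tensG S1 d T \<longleftrightarrow>
     bounded_linear_on scP scQ (tensor_power scP tensH d) T \<and>
     (\<forall>xs. length xs = d \<longrightarrow> T (tensH xs) = tensG (map S1 xs))"


section \<open>Information complexity and tractability\<close>

text \<open>
  Linear non-adaptive algorithms \<open>X \<rightarrow> Y\<close> that use at most \<open>n\<close> continuous linear functionals
  (fewer than \<open>n\<close> are covered by taking some \<open>g i = 0\<close>).
\<close>

definition algorithms ::
  "('k::real_or_complex \<Rightarrow> 'a::banach \<Rightarrow> 'a) \<Rightarrow> ('k \<Rightarrow> 'b::banach \<Rightarrow> 'b) \<Rightarrow>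
   'a set \<Rightarrow> 'b set \<Rightarrow> nat \<Rightarrow> ('a \<Rightarrow> 'b) set" where
  "algorithms sc1 sc2 X Y n =
     {A. \<exists>L g. (\<forall>i<n. bounded_linear_on sc1 (*) X (L i) \<and> g i \<in> Y) \<and>
               A = (\<lambda>f. \<Sum>i<n. sc2 (L i f) (g i))}"

definition n_abs ::
  "('k::real_or_complex \<Rightarrow> 'a::banach \<Rightarrow> 'a) \<Rightarrow> ('k \<Rightarrow> 'b::banach \<Rightarrow> 'b) \<Rightarrow>
   'a set \<Rightarrow> 'b set \<Rightarrow> real \<Rightarrow> ('a \<Rightarrow> 'b) \<Rightarrow> nat" where
  "n_abs sc1 sc2 X Y \<epsilon> T =
     (LEAST n. (INF A\<in>algorithms sc1 sc2 X Y n. operator_norm X (\<lambda>f. T f - A f)) \<le> \<epsilon>)"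

text \<open>
  Convergence to 0 as \<open>1/\<epsilon> + d \<rightarrow> \<infinity>\<close>, along all admissible sequences, i.e. those
  in \<open>(0,1] \<times> {1,2,\<dots>}\<close> with \<open>\<epsilon>\<close> below the initial error \<open>init d\<close>.
\<close>

definition vanishes_in_limit :: "(nat \<Rightarrow> real) \<Rightarrow> (real \<Rightarrow> nat \<Rightarrow> real) \<Rightarrow> bool" where
  "vanishes_in_limit init F \<longleftrightarrow>
     (\<forall>(\<epsilon> :: nat \<Rightarrow> real) (d :: nat \<Rightarrow> nat).
        (\<forall>k. 0 < \<epsilon> k \<and> \<epsilon> k \<le> 1 \<and> 1 \<le> d k \<and> \<epsilon> k < init (d k)) \<and>
        filterlim (\<lambda>k. 1 / \<epsilon> k + real (d k)) at_top sequentially \<longrightarrow>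
        (\<lambda>k. F (\<epsilon> k) (d k)) \<longlonglongrightarrow> 0)"

definition weakly_tractable ::
  "real \<Rightarrow> real \<Rightarrow> ('k::real_or_complex \<Rightarrow> 'p::banach \<Rightarrow> 'p) \<Rightarrow> ('k \<Rightarrow> 'q::banach \<Rightarrow> 'q) \<Rightarrow>
   (nat \<Rightarrow> 'p set) \<Rightarrow> (nat \<Rightarrow> 'q set) \<Rightarrow> (nat \<Rightarrow> 'p \<Rightarrow> 'q) \<Rightarrow> bool" where
  "weakly_tractable s t scP scQ H G S \<longleftrightarrow>
     vanishes_in_limit (\<lambda>d. operator_norm (H d) (S d))
       (\<lambda>\<epsilon> d. ln (real (n_abs scP scQ (H d) (G d) \<epsilon> (S d))) / (\<epsilon> powr (- s) + real d powr t))"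

end

theory Submission
  imports Defs "HOL-Combinatorics.Multiset_Permutations" "HOL-Real_Asymp.Real_Asymp"
begin

text \<open>
  The first half of the proof turns the complexity into a number: \<open>n_abs\<close> of \<open>S\<^sub>d\<close> is the number of
  index tuples \<open>(j\<^sub>1, \<dots>, j\<^sub>d)\<close> whose product of eigenvalues exceeds \<open>\<epsilon>\<^sup>2\<close>. Compactness
  of \<open>S\<^sub>1\<close> yields orthonormal eigenvectors \<open>e\<^sub>j\<close> of \<open>S\<^sub>1\<^sup>* S\<^sub>1\<close> that span, together with the
  kernel, a dense subspace (\<open>singular_system\<close>); the existence of the adjoint rests on the Riesz
  representation. The tensors of eigenvectors are orthonormal and have orthogonal images, and the
  tensors with a factor in the kernel are mapped to zero, so that \<open>S\<^sub>d\<close> is diagonal without a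
  spectral theorem in the tensor power (\<open>tensor_power_diagonalized\<close>). For a diagonal operator,
  truncation is an optimal algorithm, because \<open>n\<close> functionals have a common zero in every space of
  dimension \<open>n + 1\<close> (\<open>n_abs_eq\<close>).

  The second half counts tuples. Normalize the eigenvalues, and \<open>\<epsilon>\<close> with
  them, such that all factors are at most \<open>1\<close>.
  The \<open>l\<close> smallest factors of a tuple then have a product above \<open>\<epsilon>\<^sup>2\<close>, so the largest of these \<open>l\<close>
  factors exceeds \<open>\<epsilon>\<close> to the power \<open>2/l\<close>. Hence in descending order the \<open>l\<close>-th
  entry of a tuple takes at most as many values as the one-dimensional complexity for \<open>\<epsilon>\<close> to the
  power \<open>1/l\<close>, the \<open>l\<close>-th level. If at most \<open>K\<close> entries differ from \<open>1\<close>, there are at most \<open>d ^ K\<close>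
  arrangements, and the logarithm of the complexity is at most \<open>K ln d\<close> plus the sum of the
  logarithms of the first \<open>K\<close> levels (\<open>ln_card_tuples_le\<close>). The
  cases differ in the size of \<open>K\<close>.

  \<^item> For \<open>\<lambda>\<^sub>1 \<le> 1\<close> the decay condition on the eigenvalues says that the one-dimensional complexity
  is \<open>exp (o (\<epsilon> powr -s))\<close>; it is necessary by \<open>d = 1\<close>. The sum over the levels
  is dominated by \<open>l = 1\<close> (\<open>sum_powr_inverse_le\<close>). The number \<open>K\<close> is at most logarithmic in \<open>1/\<epsilon>\<close>
  if \<open>\<lambda>\<^sub>1 < 1\<close>, because then \<open>d\<close> is, and if \<open>\<lambda>\<^sub>2 < \<lambda>\<^sub>1 = 1\<close>, because entries different from \<open>1\<close>
  shrink the product. If \<open>\<lambda>\<^sub>2 = \<lambda>\<^sub>1 = 1\<close>, then \<open>K = d\<close>, and \<open>t > 1\<close> makes \<open>d ln d\<close> negligible.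

  \<^item> For \<open>\<lambda>\<^sub>1 > 1\<close> the levels belong to the normalized operator and to \<open>\<epsilon> / \<lambda>\<^sub>1 powr (d/2)\<close>. With \<open>M\<close>
  denoting the maximum in the criterion, \<open>l\<close> free coordinates below the \<open>l\<close>-th level give the lower
  bound \<open>M\<close> for the logarithm of the complexity, and the logarithm of the \<open>l\<close>-th level is at most
  \<open>M / l\<close>, which gives the upper bound \<open>d ln d + (1 + ln d) M\<close>.

  \<^item> Whenever \<open>\<lambda>\<^sub>1 > 1\<close> or \<open>\<lambda>\<^sub>2 = \<lambda>\<^sub>1 = 1\<close>, two blocks of indices of the same length have products of at
  least \<open>1\<close>. Concatenations of them are exponentially many tuples already for \<open>\<epsilon> = 1/2\<close>, which
  forces \<open>t > 1\<close> (\<open>t_gt_1_necessary\<close>).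
\<close>

section \<open>Scalars and inner products\<close>

lemma scnj_eq_divide: "scnj z = of_real ((norm z)\<^sup>2) / z" for z :: "'k::real_or_complex"
  using mult_scnj[of z] by (cases "z = 0") (auto simp: field_simps scaleR_conv_of_real scnj_0)

lemma mult_scnj_of_real: "z * scnj z = of_real ((norm z)\<^sup>2)" for z :: "'k::real_or_complex"
  by (simp add: mult_scnj scaleR_conv_of_real)

lemma scnj_mult: "scnj (a * b) = scnj a * scnj b" for a b :: "'k::real_or_complex"
  by (simp add: scnj_eq_divide norm_mult power_mult_distrib)

lemma norm_scnj: "norm (scnj a) = norm a" for a :: "'k::real_or_complex"
proof (cases "a = 0")
  case False
  have "norm (scnj a) = (norm a)\<^sup>2 / norm a"
    unfolding scnj_eq_divide norm_divide norm_of_real by simp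
  with False show ?thesis by (simp add: power2_eq_square)
qed (simp add: scnj_0)

lemma scnj_scnj: "scnj (scnj a) = a" for a :: "'k::real_or_complex"
proof (cases "a = 0")
  case False
  have "scnj (scnj a) = of_real ((norm a)\<^sup>2) / scnj a"
    using scnj_eq_divide[of "scnj a"] by (simp add: norm_scnj)
  also have "\<dots> = a"
    using False by (simp add: scnj_eq_divide)
  finally show ?thesis .
qed (simp add: scnj_0)

lemma scnj_of_real: "scnj (of_real r) = (of_real r :: 'k::real_or_complex)"
proof (cases "r = 0")
  case False
  have "scnj (of_real r :: 'k) = of_real (r\<^sup>2) / of_real r"
    using scnj_eq_divide[of "of_real r :: 'k"] by simp
  also have "\<dots> = of_real r"
    using False by (simp add: power2_eq_square)
  finally show ?thesis .
qed (simp add: scnj_0)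

lemma tendsto_if_norm_diff_le:
  fixes F :: "nat \<Rightarrow> 'a::real_normed_vector" and f :: "nat \<Rightarrow> 'b::real_normed_vector"
  assumes "f \<longlonglongrightarrow> x" "\<And>n. norm (F n - l) \<le> C * norm (f n - x)"
  shows "F \<longlonglongrightarrow> l"
proof (rule Lim_null_comparison[where g = "\<lambda>n. C * norm (f n - x)", THEN LIM_zero_cancel])
  show "(\<lambda>n. C * norm (f n - x)) \<longlonglongrightarrow> 0"
    using assms(1) by (intro tendsto_mult_right_zero tendsto_norm_zero) (simp add: LIM_zero)
qed (simp add: assms(2))

context hilbert_space
begin

lemma ip_zero_left: "ip 0 y = 0"
  using ip_scale[of 0 0 y] by simp

lemma ip_scale_right: "ip x (sc a y) = scnj a * ip x y"
  by (metis ip_scale ip_scnj scnj_mult)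

lemma ip_diff_left: "ip (x - y) z = ip x z - ip y z"
  using ip_add[of "x - y" y z] by (simp add: algebra_simps)

lemma ip_eq_zero_sym: "ip x y = 0 \<Longrightarrow> ip y x = 0"
  by (metis ip_scnj scnj_0)

lemma ip_zero_right: "ip x 0 = 0"
  using ip_zero_left ip_eq_zero_sym by blast

lemma norm_sc: "norm (sc a x) = norm a * norm x"
proof -
  have "of_real ((norm (sc a x))\<^sup>2) = a * scnj a * ip x x"
    by (simp only: ip_norm[symmetric] ip_scale ip_scale_right mult.assoc mult.left_commute)
  also have "\<dots> = of_real ((norm a * norm x)\<^sup>2)"
    by (simp add: mult_scnj_of_real ip_norm power_mult_distrib)
  finally have "(norm (sc a x))\<^sup>2 = (norm a * norm x)\<^sup>2"
    by (simp only: of_real_eq_iff)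
  then show ?thesis
    by (simp add: power2_eq_iff_nonneg)
qed

lemma ip_self_eq_zero: "ip x x = 0 \<longleftrightarrow> x = 0"
  by (simp add: ip_norm)

lemma eq_zero_if_ip_self: "ip x x = 0 \<Longrightarrow> x = 0"
  by (simp add: ip_self_eq_zero)

text \<open>
  The class of scalars does not contain the additivity of the conjugation as an axiom. In two
  dimensions it follows from the symmetry of the inner product: for orthonormal \<open>u\<close>, \<open>w\<close> compare
  the inner product of \<open>a u + b w\<close> and \<open>u + w\<close> with the one in reversed order.
\<close>

lemma scnj_add_if_infinite_dimensional:
  assumes "\<nexists>B. finite B \<and> span B = UNIV"
  shows "scnj (a + b) = scnj a + scnj (b :: 'k)"
proof -
  have "\<exists>u::'a. u \<noteq> 0"
  proof (rule ccontr)
    assume "\<nexists>u::'a. u \<noteq> 0"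
    then have "span {} = (UNIV :: 'a set)" by auto
    then show False using assms by blast
  qed
  then obtain u :: 'a where u: "u \<noteq> 0" by blast
  have "span {u} \<noteq> UNIV" using assms by blast
  then obtain v where v: "v \<notin> span {u}" by blast
  define w where "w = v - sc (ip v u / ip u u) u"
  have "sc (ip v u / ip u u) u \<in> span {u}"
    by (intro span_scale span_base) simp
  with v have w: "w \<noteq> 0" by (auto simp: w_def)
  have uu: "ip u u \<noteq> 0" using u by (simp add: ip_self_eq_zero)
  have wu: "ip w u = 0" using uu by (simp add: w_def ip_diff_left ip_scale)
  define u' where "u' = sc (of_real (1 / norm u)) u"
  define w' where "w' = sc (of_real (1 / norm w)) w"
  have o: "ip w' u' = 0" "ip u' w' = 0"
    using wu ip_eq_zero_sym[OF wu] by (simp_all add: u'_def w'_def ip_scale ip_scale_right)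
  have n: "ip u' u' = 1" "ip w' w' = 1"
    using u w by (simp_all add: ip_norm u'_def w'_def norm_sc norm_divide)
  define x y where "x = sc a u' + sc b w'" and "y = u' + w'"
  have s1: "scnj (1::'k) = 1" using scnj_of_real[of 1] by simp
  have "ip u' y = scnj (ip y u')" "ip w' y = scnj (ip y w')" by (rule ip_scnj)+
  then have "ip x y = a + b"
    by (simp add: x_def ip_add ip_scale y_def o n s1)
  moreover have "ip u' x = scnj (ip x u')" "ip w' x = scnj (ip x w')" by (rule ip_scnj)+
  then have "ip y x = scnj a + scnj b"
    by (simp add: y_def ip_add x_def ip_scale o n)
  ultimately show ?thesis
    by (metis ip_scnj)
qed

end

locale additive_hilbert_space = hilbert_space sc ip
  for sc :: "'k::real_or_complex \<Rightarrow> 'a::banach \<Rightarrow> 'a" and ip +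
  assumes scnj_add: "scnj (a + b) = scnj a + scnj (b :: 'k)"
begin

lemma ip_add_right: "ip x (y + z) = ip x y + ip x z"
  by (metis ip_add ip_scnj scnj_add)

lemma ip_diff_right: "ip x (y - z) = ip x y - ip x z"
  using ip_add_right[of x "y - z" z] by (simp add: algebra_simps)

lemma ip_sum_left: "ip (\<Sum>i\<in>I. f i) y = (\<Sum>i\<in>I. ip (f i) y)"
  by (induction I rule: infinite_finite_induct) (auto simp: ip_zero_left ip_add)

lemma ip_sum_right: "ip x (\<Sum>i\<in>I. f i) = (\<Sum>i\<in>I. ip x (f i))"
  by (induction I rule: infinite_finite_induct) (auto simp: ip_zero_right ip_add_right)

lemma pythagoras:
  assumes "ip x y = 0"
  shows "(norm (x + y))\<^sup>2 = (norm x)\<^sup>2 + (norm y)\<^sup>2"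
proof -
  have "of_real ((norm (x + y))\<^sup>2) = (of_real ((norm x)\<^sup>2 + (norm y)\<^sup>2) :: 'k)"
    using assms ip_eq_zero_sym[OF assms]
    by (simp only: ip_norm[symmetric] ip_add ip_add_right of_real_add) simp
  then show ?thesis by (simp only: of_real_eq_iff)
qed

lemma parallelogram:
  "(norm (x + y))\<^sup>2 + (norm (x - y))\<^sup>2 = 2 * (norm x)\<^sup>2 + 2 * (norm (y :: 'a))\<^sup>2"
proof -
  have "of_real ((norm (x + y))\<^sup>2 + (norm (x - y))\<^sup>2)
      = (of_real ((norm x)\<^sup>2 + (norm x)\<^sup>2 + ((norm y)\<^sup>2 + (norm y)\<^sup>2)) :: 'k)"
    by (simp only: of_real_add ip_norm[symmetric] ip_add ip_add_right ip_diff_left ip_diff_right)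
      (simp only: algebra_simps)
  then show ?thesis by (simp only: of_real_eq_iff)
qed

text \<open>
  The subtracted vector is the projection of \<open>x\<close> to the line through \<open>v\<close>.
\<close>

lemma norm_residual:
  assumes "v \<noteq> 0"
  shows "(norm (x - sc (ip x v / of_real ((norm v)\<^sup>2)) v))\<^sup>2
    = (norm x)\<^sup>2 - (norm (ip x v))\<^sup>2 / (norm v)\<^sup>2"
proof -
  define c where "c = ip x v / of_real ((norm v)\<^sup>2)"
  define r where "r = x - sc c v"
  have "ip r v = 0"
    using assms by (simp add: r_def ip_diff_left ip_scale c_def ip_norm)
  then have "ip r (sc c v) = 0"
    by (simp add: ip_scale_right)
  from pythagoras[OF this] have "(norm x)\<^sup>2 = (norm r)\<^sup>2 + (norm (sc c v))\<^sup>2"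
    by (simp add: r_def)
  moreover have "norm (sc c v) = norm (ip x v) / norm v"
    unfolding norm_sc c_def norm_divide norm_of_real using assms by (simp add: power2_eq_square)
  ultimately show ?thesis
    by (simp add: r_def c_def power_divide)
qed

lemma cauchy_schwarz: "norm (ip x y) \<le> norm x * norm y"
proof (cases "y = 0")
  case False
  have "(norm (ip x y))\<^sup>2 / (norm y)\<^sup>2 \<le> (norm x)\<^sup>2"
    using norm_residual[OF False, of x]
      zero_le_power2[of "norm (x - sc (ip x y / of_real ((norm y)\<^sup>2)) y)"] by linarith
  then have "(norm (ip x y))\<^sup>2 \<le> (norm x * norm y)\<^sup>2"
    using False by (simp add: divide_simps power_mult_distrib)
  then show ?thesis
    by (rule power2_le_imp_le) simp
qed (simp add: ip_zero_right)

lemma tendsto_ip_left: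
  assumes "f \<longlonglongrightarrow> x"
  shows "(\<lambda>n. ip (f n) y) \<longlonglongrightarrow> ip x y"
proof (rule tendsto_if_norm_diff_le[OF assms])
  show "norm (ip (f n) y - ip x y) \<le> norm y * norm (f n - x)" for n
    using cauchy_schwarz[of "f n - x" y] by (simp add: ip_diff_left mult.commute)
qed

lemma tendsto_sc:
  assumes "f \<longlonglongrightarrow> x"
  shows "(\<lambda>n. sc a (f n)) \<longlonglongrightarrow> sc a x"
proof (rule tendsto_if_norm_diff_le[OF assms])
  show "norm (sc a (f n) - sc a x) \<le> norm a * norm (f n - x)" for n
    by (simp add: scale_right_diff_distrib[symmetric] norm_sc)
qed

lemma subspace_closure:
  assumes "subspace V"
  shows "subspace (closure V)"
proof (rule subspaceI)
  show "0 \<in> closure V"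
    using assms closure_subset subspace_0 by blast
  fix x assume "x \<in> closure V"
  then obtain f where f: "\<And>n. f n \<in> V" "f \<longlonglongrightarrow> x"
    by (meson closure_sequential)
  show "sc a x \<in> closure V" for a
    unfolding closure_sequential
    using tendsto_sc[OF f(2), of a] subspace_scale[OF assms f(1), of a] by (intro exI conjI allI)
  fix y assume "y \<in> closure V"
  then obtain g where g: "\<And>n. g n \<in> V" "g \<longlonglongrightarrow> y"
    by (meson closure_sequential)
  show "x + y \<in> closure V"
    unfolding closure_sequential
    using tendsto_add[OF f(2) g(2)] subspace_add[OF assms f(1) g(1)] by (intro exI conjI allI)
qed

lemma norm_sum_orthogonal:
  assumes "finite I"
    and "\<And>i j. i \<in> I \<Longrightarrow> j \<in> I \<Longrightarrow> ip (E i) (E j) = (if i = j then of_real (\<sigma> i) else 0)"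
  shows "(norm (\<Sum>i\<in>I. sc (c i) (E i)))\<^sup>2 = (\<Sum>i\<in>I. (norm (c i))\<^sup>2 * \<sigma> i)"
proof -
  have "ip (\<Sum>i\<in>I. sc (c i) (E i)) (\<Sum>j\<in>I. sc (c j) (E j))
      = (\<Sum>i\<in>I. \<Sum>j\<in>I. c i * (scnj (c j) * ip (E i) (E j)))"
    unfolding ip_sum_left by (simp only: ip_sum_right ip_scale ip_scale_right sum_distrib_left mult.left_commute)
  also have "\<dots> = (\<Sum>i\<in>I. \<Sum>j\<in>I. if j = i then of_real ((norm (c i))\<^sup>2 * \<sigma> i) else 0)"
    by (intro sum.cong refl) (auto simp: assms(2) mult_scnj_of_real mult.assoc[symmetric])
  also have "\<dots> = of_real (\<Sum>i\<in>I. (norm (c i))\<^sup>2 * \<sigma> i)"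
    using assms(1) by simp
  finally show ?thesis
    unfolding ip_norm by (simp only: of_real_eq_iff)
qed

section \<open>Orthogonal projection, Riesz representation and adjoints\<close>

text \<open>
  A minimizing sequence for the distance to a closed subspace is Cauchy by the parallelogram law,
  and its limit is the foot of the perpendicular, as moving it along any \<open>v\<close> in the subspace would
  otherwise decrease the distance.
\<close>

lemma orthogonal_projection_exists:
  assumes V: "subspace V" "closed V"
  shows "\<exists>p\<in>V. \<forall>v\<in>V. ip (x - p) v = 0"
proof -
  define d where "d = (INF v\<in>V. norm (x - v))"
  have ne: "V \<noteq> {}" using V subspace_0 by blast
  have bdd: "bdd_below ((\<lambda>v. norm (x - v)) ` V)" by (rule bdd_belowI2[where m = 0]) simp
  have d_le: "d \<le> norm (x - v)" if "v \<in> V" for v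
    unfolding d_def using bdd that by (rule cINF_lower)
  have d0: "0 \<le> d" unfolding d_def using ne by (rule cINF_greatest) simp
  have "\<exists>v\<in>V. norm (x - v) < d + 1 / Suc n" for n
    using cINF_less_iff[OF ne bdd, of "d + 1 / Suc n"] unfolding d_def by simp
  then obtain v where v: "\<And>n. v n \<in> V" "\<And>n. norm (x - v n) < d + 1 / Suc n"
    by metis
  have "(\<lambda>n. norm (x - v n)) \<longlonglongrightarrow> d"
  proof (rule tendsto_sandwich[where f = "\<lambda>n. d" and h = "\<lambda>n. d + 1 / Suc n"])
    show "(\<lambda>n. d + 1 / real (Suc n)) \<longlonglongrightarrow> d"
      using tendsto_add[OF tendsto_const LIMSEQ_Suc[OF lim_1_over_n], of d] by simp
    show "\<forall>\<^sub>F n in sequentially. d \<le> norm (x - v n)"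
      by (simp add: d_le v(1))
    show "\<forall>\<^sub>F n in sequentially. norm (x - v n) \<le> d + 1 / real (Suc n)"
      using v(2) by (intro always_eventually allI less_imp_le)
  qed simp
  then have lim: "(\<lambda>n. (norm (x - v n))\<^sup>2) \<longlonglongrightarrow> d\<^sup>2" by (intro tendsto_power)
  have par: "(norm (v n - v k))\<^sup>2 \<le> 2 * ((norm (x - v n))\<^sup>2 - d\<^sup>2) + 2 * ((norm (x - v k))\<^sup>2 - d\<^sup>2)"
    for n k
  proof -
    have "(1/2) *\<^sub>R (v n + v k) \<in> V"
      using V v(1) subspace_add subspace_scale scale_of_real by metis
    then have "d \<le> norm (x - (1/2) *\<^sub>R (v n + v k))" by (rule d_le)
    moreover have "(x - v n) + (x - v k) = 2 *\<^sub>R (x - (1/2) *\<^sub>R (v n + v k))"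
      by (simp add: algebra_simps scaleR_2)
    ultimately have "2 * d \<le> norm ((x - v n) + (x - v k))" by simp
    then have "(2 * d)\<^sup>2 \<le> (norm ((x - v n) + (x - v k)))\<^sup>2"
      using d0 by (intro power_mono) auto
    moreover have "(norm (v n - v k))\<^sup>2 = (norm ((x - v n) - (x - v k)))\<^sup>2"
      by (simp add: norm_minus_commute)
    ultimately show ?thesis
      using parallelogram[of "x - v n" "x - v k"] by (simp add: power_mult_distrib algebra_simps)
  qed
  have "Cauchy v"
  proof (rule metric_CauchyI)
    fix e :: real assume e: "0 < e"
    then have "\<forall>\<^sub>F n in sequentially. (norm (x - v n))\<^sup>2 < d\<^sup>2 + e\<^sup>2 / 4"
      using lim by (intro order_tendstoD) auto
    then obtain N where N: "\<And>n. n \<ge> N \<Longrightarrow> (norm (x - v n))\<^sup>2 < d\<^sup>2 + e\<^sup>2 / 4"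
      by (auto simp: eventually_sequentially)
    show "\<exists>N. \<forall>n\<ge>N. \<forall>k\<ge>N. dist (v n) (v k) < e"
    proof (intro exI allI impI)
      fix n k assume "n \<ge> N" "k \<ge> N"
      then have "(norm (v n - v k))\<^sup>2 < e\<^sup>2"
        using par[of n k] N[of n] N[of k] by argo
      then show "dist (v n) (v k) < e"
        using e by (simp add: dist_norm power_less_imp_less_base)
    qed
  qed
  then obtain p where p: "v \<longlonglongrightarrow> p"
    using Cauchy_convergent convergent_def by blast
  have pV: "p \<in> V" using V(2) v(1) p by (meson closed_sequentially)
  have "(\<lambda>n. (norm (x - v n))\<^sup>2) \<longlonglongrightarrow> (norm (x - p))\<^sup>2"
    by (intro tendsto_intros p)
  with lim have np: "(norm (x - p))\<^sup>2 = d\<^sup>2"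
    using LIMSEQ_unique by blast
  have "ip (x - p) u = 0" if u: "u \<in> V" for u
  proof (cases "u = 0")
    case False
    define c where "c = ip (x - p) u / of_real ((norm u)\<^sup>2)"
    have "p + sc c u \<in> V" using V pV u by (simp add: subspace_add subspace_scale)
    then have "d \<le> norm (x - p - sc c u)" using d_le by (metis diff_diff_eq)
    then have "d\<^sup>2 \<le> (norm (x - p - sc c u))\<^sup>2" using d0 by (intro power_mono) auto
    then have "(norm (ip (x - p) u))\<^sup>2 / (norm u)\<^sup>2 \<le> 0"
      using norm_residual[OF False, of "x - p"] np unfolding c_def by linarith
    then show ?thesis using False by (simp add: divide_le_0_iff)
  qed (simp add: ip_zero_right)
  with pV show ?thesis by blast
qed

text \<open>
  A functional that does not vanish is determined, up to a factor, by its kernel, and the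
  representing vector spans the orthogonal complement of the kernel.
\<close>

lemma riesz_representation:
  assumes "bounded_linear_on sc (*) UNIV f"
  shows "\<exists>y. \<forall>x. f x = ip x y"
proof (cases "\<forall>x. f x = 0")
  case True
  then show ?thesis using ip_zero_right by metis
next
  case False
  have fa: "f (x + y) = f x + f y" and fs: "f (sc a x) = a * f x" for a x y
    using assms by (auto simp: bounded_linear_on_def)
  obtain C where C: "\<And>x. norm (f x) \<le> C * norm x"
    using assms by (auto simp: bounded_linear_on_def)
  have f0: "f 0 = 0" using fs[of 0 0] by simp
  have fd: "f (x - y) = f x - f y" for x y
    using fa[of "x - y" y] by simp
  define V where "V = {x. f x = 0}"
  have sub: "subspace V" by (rule subspaceI) (auto simp: V_def f0 fa fs)
  have clo: "closed V"
    unfolding closed_sequential_limits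
  proof (intro allI impI, elim conjE)
    fix g x assume g: "\<forall>n. g n \<in> V" "g \<longlonglongrightarrow> x"
    have "norm (f x) \<le> C * norm (x - g n)" for n
      using C[of "x - g n"] g(1) by (simp add: V_def fd)
    moreover have "(\<lambda>n. C * norm (x - g n)) \<longlonglongrightarrow> C * norm (x - x)"
      by (intro tendsto_intros g)
    ultimately have "norm (f x) \<le> C * norm (x - x)"
      by (intro LIMSEQ_le_const) auto
    then show "x \<in> V" by (simp add: V_def)
  qed
  from False obtain x0 where x0: "f x0 \<noteq> 0" by blast
  obtain p where p: "p \<in> V" "\<And>v. v \<in> V \<Longrightarrow> ip (x0 - p) v = 0"
    using orthogonal_projection_exists[OF sub clo] by blast
  define w where "w = x0 - p"
  have fw: "f w \<noteq> 0" using p(1) x0 by (simp add: w_def fd V_def)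
  then have w0: "ip w w \<noteq> 0" using f0 by (auto simp: ip_self_eq_zero)
  have "f x = ip x (sc (scnj (f w / ip w w)) w)" for x
  proof -
    have "x - sc (f x / f w) w \<in> V" using fw by (simp add: V_def fd fs)
    then have "ip (x - sc (f x / f w) w) w = 0" using p(2) ip_eq_zero_sym w_def by blast
    then have "ip x w = f x / f w * ip w w" by (simp add: ip_diff_left ip_scale)
    then show ?thesis using fw w0 by (simp add: ip_scale_right scnj_scnj)
  qed
  then show ?thesis by blast
qed

end

lemma hilbert_adjoint_eq:
  assumes "additive_hilbert_space sc1 ip1" "additive_hilbert_space sc2 ip2"
    and "bounded_linear_on sc1 sc2 UNIV T"
  shows "ip2 (T x) y = ip1 x (hilbert_adjoint ip1 ip2 T y)"
proof -
  interpret A: additive_hilbert_space sc1 ip1 by fact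
  interpret B: additive_hilbert_space sc2 ip2 by fact
  obtain C where C: "\<And>x. norm (T x) \<le> C * norm x"
    using assms(3) by (auto simp: bounded_linear_on_def)
  have ex: "\<exists>z. \<forall>x. ip2 (T x) y = ip1 x z" for y
  proof (rule A.riesz_representation)
    have "norm (ip2 (T x) y) \<le> C * norm y * norm x" for x
    proof -
      have "norm (ip2 (T x) y) \<le> norm (T x) * norm y" by (rule B.cauchy_schwarz)
      also have "\<dots> \<le> C * norm x * norm y" by (intro mult_right_mono C) simp
      finally show ?thesis by (simp add: mult_ac)
    qed
    then show "bounded_linear_on sc1 (*) UNIV (\<lambda>x. ip2 (T x) y)"
      using assms(3) by (auto simp: bounded_linear_on_def B.ip_add B.ip_scale)
  qed
  have "\<exists>!T'. \<forall>x y. ip2 (T x) y = ip1 x (T' y)"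
  proof (rule ex_ex1I)
    show "\<exists>T'. \<forall>x y. ip2 (T x) y = ip1 x (T' y)" using ex by metis
  next
    fix T' T'' assume a: "\<forall>x y. ip2 (T x) y = ip1 x (T' y)" "\<forall>x y. ip2 (T x) y = ip1 x (T'' y)"
    show "T' = T''"
    proof
      fix y
      have "ip1 x (T' y - T'' y) = 0" for x
        using a by (metis A.ip_diff_right diff_self)
      then have "T' y - T'' y = 0" using A.eq_zero_if_ip_self by blast
      then show "T' y = T'' y" by simp
    qed
  qed
  from theI'[OF this] show ?thesis
    unfolding hilbert_adjoint_def by blast
qed

section \<open>The singular system of a compact operator\<close>

locale compact_hilbert_operator =
  H: additive_hilbert_space sc1 ip1 + G: additive_hilbert_space sc2 ip2
  for sc1 :: "'k::real_or_complex \<Rightarrow> 'a::banach \<Rightarrow> 'a" and ip1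
    and sc2 :: "'k \<Rightarrow> 'b::banach \<Rightarrow> 'b" and ip2 +
  fixes T :: "'a \<Rightarrow> 'b"
  assumes compact_T: "compact_operator sc1 sc2 T"
begin

definition adj :: "'b \<Rightarrow> 'a" where "adj = hilbert_adjoint ip1 ip2 T"

lemma bounded_linear_T: "bounded_linear_on sc1 sc2 UNIV T"
  using compact_T by (simp add: compact_operator_def)

lemma T_add: "T (x + y) = T x + T y" and T_scale: "T (sc1 a x) = sc2 a (T x)"
  using bounded_linear_T by (auto simp: bounded_linear_on_def)

lemma T_zero: "T 0 = 0"
  using T_scale[of 0 0] by simp

lemma T_diff: "T (x - y) = T x - T y"
  using T_add[of "x - y" y] by (simp add: algebra_simps)

lemma T_bounded: obtains C where "0 \<le> C" "\<And>x. norm (T x) \<le> C * norm x"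
proof -
  obtain C where C: "\<And>x. norm (T x) \<le> C * norm x"
    using bounded_linear_T by (auto simp: bounded_linear_on_def)
  have "norm (T x) \<le> max 0 C * norm x" for x
    using C[of x] mult_right_mono[of C "max 0 C" "norm x"] by simp
  then show thesis by (intro that[of "max 0 C"]) auto
qed

lemma tendsto_T: assumes "f \<longlonglongrightarrow> x" shows "(\<lambda>n. T (f n)) \<longlonglongrightarrow> T x"
proof -
  obtain C where C: "0 \<le> C" "\<And>x. norm (T x) \<le> C * norm x"
    using T_bounded by blast
  have "norm (T (f n) - T x) \<le> C * norm (f n - x)" for n
    by (simp add: T_diff[symmetric] C)
  then show ?thesis by (rule tendsto_if_norm_diff_le[OF assms])
qed

lemma ip_adj: "ip1 x (adj y) = ip2 (T x) y"
  unfolding adj_def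
  by (rule hilbert_adjoint_eq[symmetric])
    (unfold_locales, rule bounded_linear_T)

lemma norm_adj_le: assumes "0 \<le> C" "\<And>x. norm (T x) \<le> C * norm x"
  shows "norm (adj y) \<le> C * norm y"
proof (cases "adj y = 0")
  case False
  have "(norm (adj y))\<^sup>2 = norm (ip1 (adj y) (adj y))"
    unfolding H.ip_norm norm_of_real by simp
  also have "\<dots> \<le> norm (T (adj y)) * norm y"
    unfolding ip_adj by (rule G.cauchy_schwarz)
  also have "\<dots> \<le> C * norm (adj y) * norm y"
    by (intro mult_right_mono assms) simp
  finally show ?thesis using False by (simp add: power2_eq_square)
qed (simp add: assms)

lemma adj_diff: "adj (x - y) = adj x - adj y"
proof -
  have "ip1 z (adj (x - y) - (adj x - adj y)) = 0" for z
    by (simp add: H.ip_diff_right ip_adj G.ip_diff_right)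
  then show ?thesis using H.eq_zero_if_ip_self by (metis eq_iff_diff_eq_0)
qed

lemma tendsto_adj: assumes "f \<longlonglongrightarrow> x" shows "(\<lambda>n. adj (f n)) \<longlonglongrightarrow> adj x"
proof -
  obtain C where C: "0 \<le> C" "\<And>x. norm (T x) \<le> C * norm x"
    using T_bounded by blast
  have "norm (adj (f n) - adj x) \<le> C * norm (f n - x)" for n
    by (simp add: adj_diff[symmetric] norm_adj_le[OF C])
  then show ?thesis by (rule tendsto_if_norm_diff_le[OF assms])
qed

lemma ip2_T_sym: "ip2 (T x) (T y) = scnj (ip2 (T y) (T x))"
  by (rule G.ip_scnj)

lemma eigenspace_iff:
  "x \<in> eigenspace sc1 (adj \<circ> T) \<mu> \<longleftrightarrow> (\<forall>z. ip2 (T z) (T x) = of_real \<mu> * ip1 z x)"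
proof
  assume "x \<in> eigenspace sc1 (adj \<circ> T) \<mu>"
  then have "adj (T x) = sc1 (of_real \<mu>) x" by (simp add: eigenspace_def)
  then show "\<forall>z. ip2 (T z) (T x) = of_real \<mu> * ip1 z x"
    by (metis ip_adj H.ip_scale_right scnj_of_real)
next
  assume "\<forall>z. ip2 (T z) (T x) = of_real \<mu> * ip1 z x"
  then have "ip1 z (adj (T x) - sc1 (of_real \<mu>) x) = 0" for z
    by (simp add: H.ip_diff_right ip_adj H.ip_scale_right scnj_of_real)
  then have "adj (T x) - sc1 (of_real \<mu>) x = 0" using H.eq_zero_if_ip_self by blast
  then show "x \<in> eigenspace sc1 (adj \<circ> T) \<mu>" by (simp add: eigenspace_def)
qed

lemma subspace_eigenspace: "H.subspace (eigenspace sc1 (adj \<circ> T) \<mu>)"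
  by (rule H.subspaceI)
    (auto simp: eigenspace_iff T_zero G.ip_zero_right H.ip_zero_right T_add G.ip_add_right
      H.ip_add_right T_scale G.ip_scale_right H.ip_scale_right algebra_simps)

lemma ip2_T_eigenvector:
  "y \<in> eigenspace sc1 (adj \<circ> T) \<mu> \<Longrightarrow> ip2 (T x) (T y) = of_real \<mu> * ip1 x y"
  by (simp add: eigenspace_iff)

lemma norm_T_eigenvector:
  assumes "x \<in> eigenspace sc1 (adj \<circ> T) \<mu>"
  shows "(norm (T x))\<^sup>2 = \<mu> * (norm x)\<^sup>2"
proof -
  have "of_real ((norm (T x))\<^sup>2) = (of_real (\<mu> * (norm x)\<^sup>2) :: 'k)"
    unfolding of_real_mult H.ip_norm[symmetric] G.ip_norm[symmetric]
    by (rule ip2_T_eigenvector[OF assms])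
  then show ?thesis by (simp only: of_real_eq_iff)
qed

lemma eigenvectors_orthogonal:
  assumes "x \<in> eigenspace sc1 (adj \<circ> T) \<mu>" "y \<in> eigenspace sc1 (adj \<circ> T) \<nu>" "\<mu> \<noteq> \<nu>"
  shows "ip1 x y = 0"
proof -
  have "of_real \<nu> * ip1 x y = ip2 (T x) (T y)"
    using ip2_T_eigenvector[OF assms(2)] by simp
  also have "\<dots> = scnj (of_real \<mu> * ip1 y x)"
    using ip2_T_eigenvector[OF assms(1)] ip2_T_sym by metis
  also have "\<dots> = of_real \<mu> * ip1 x y"
    by (metis scnj_mult scnj_of_real H.ip_scnj)
  finally have "of_real (\<nu> - \<mu>) * ip1 x y = 0" by (simp add: algebra_simps)
  with assms(3) show ?thesis by simp
qed

definition orthogonal_images :: "real \<Rightarrow> 'i set \<Rightarrow> ('i \<Rightarrow> 'a) \<Rightarrow> bool" where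
  "orthogonal_images \<delta> I F \<longleftrightarrow> finite I \<and>
    (\<forall>i\<in>I. norm (F i) \<le> 1 \<and> \<delta> \<le> (norm (T (F i)))\<^sup>2) \<and>
    (\<forall>i\<in>I. \<forall>j\<in>I. i \<noteq> j \<longrightarrow> ip2 (T (F i)) (T (F j)) = 0)"

text \<open>
  Images that are orthogonal and not shorter than \<open>\<surd>\<delta>\<close> have distances of at least \<open>\<surd>\<delta>\<close>, so a
  covering of the image of the unit ball by finitely many balls of radius \<open>\<surd>\<delta>/2\<close> limits
  their number.
\<close>

lemma orthogonal_images_bounded_number:
  assumes "0 < \<delta>"
  shows "\<exists>N. \<forall>I F. orthogonal_images \<delta> I F \<longrightarrow> card I \<le> N"
proof -
  define r where "r = sqrt \<delta> / 2"
  have r: "0 < r" using assms by (simp add: r_def)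
  have "compact (closure (T ` cball 0 1))"
    using compact_T by (simp add: compact_operator_def)
  then obtain K where K: "finite K" "closure (T ` cball 0 1) \<subseteq> (\<Union>x\<in>K. ball x r)"
    using r unfolding compact_eq_totally_bounded by blast
  show ?thesis
  proof (intro exI[of _ "card K"] allI impI)
    fix I F assume "orthogonal_images \<delta> I F"
    then have I: "finite I" and n: "\<And>i. i \<in> I \<Longrightarrow> norm (F i) \<le> 1"
      and d: "\<And>i. i \<in> I \<Longrightarrow> \<delta> \<le> (norm (T (F i)))\<^sup>2"
      and o: "\<And>i j. i \<in> I \<Longrightarrow> j \<in> I \<Longrightarrow> i \<noteq> j \<Longrightarrow> ip2 (T (F i)) (T (F j)) = 0"
      by (auto simp: orthogonal_images_def)
    have "\<exists>c\<in>K. dist c (T (F i)) < r" if "i \<in> I" for i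
    proof -
      have "T (F i) \<in> closure (T ` cball 0 1)"
        using n[OF that] closure_subset[of "T ` cball 0 1"] by auto
      with K(2) have "T (F i) \<in> (\<Union>x\<in>K. ball x r)" by (rule subsetD)
      then show ?thesis by simp
    qed
    then obtain c where c: "\<And>i. i \<in> I \<Longrightarrow> c i \<in> K" "\<And>i. i \<in> I \<Longrightarrow> dist (c i) (T (F i)) < r"
      by metis
    have "inj_on c I"
    proof (rule inj_onI, rule ccontr)
      fix i j assume ij: "i \<in> I" "j \<in> I" "c i = c j" "i \<noteq> j"
      have "ip2 (T (F i)) (sc2 (-1) (T (F j))) = 0"
        using o ij by (simp add: G.ip_scale_right del: G.scale_minus_left)
      from G.pythagoras[OF this]
      have "(norm (T (F i) - T (F j)))\<^sup>2 = (norm (T (F i)))\<^sup>2 + (norm (T (F j)))\<^sup>2"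
        by simp
      then have "\<delta> \<le> (norm (T (F i) - T (F j)))\<^sup>2"
        using d[OF ij(1)] zero_le_power2[of "norm (T (F j))"] by linarith
      then have "2 * r \<le> dist (T (F i)) (T (F j))"
        by (simp add: dist_norm r_def real_le_lsqrt)
      also have "\<dots> \<le> dist (c i) (T (F i)) + dist (c i) (T (F j))"
        by (rule dist_triangle3)
      also have "\<dots> < r + r" using c(2)[OF ij(1)] c(2)[OF ij(2)] ij(3) by simp
      finally show False by simp
    qed
    then show "card I \<le> card K"
      using c(1) K(1) by (intro card_inj_on_le) auto
  qed
qed

text \<open>
  A maximal orthonormal subset of the eigenspace exists by the bound on the number of
  orthogonal images; by maximality it spans the eigenspace.
\<close>

lemma eigenspace_orthonormal_basis:
  assumes "0 < \<mu>"
  shows "\<exists>B. finite B \<and> (\<forall>x\<in>B. \<forall>y\<in>B. ip1 x y = (if x = y then 1 else 0)) \<and>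
    H.span B = eigenspace sc1 (adj \<circ> T) \<mu> \<and> card B = H.dim (eigenspace sc1 (adj \<circ> T) \<mu>)"
proof -
  define E where "E = eigenspace sc1 (adj \<circ> T) \<mu>"
  define on where "on = (\<lambda>B. finite B \<and> B \<subseteq> E \<and> (\<forall>x\<in>B. \<forall>y\<in>B. ip1 x y = (if x = y then 1 else 0)))"
  have sub: "H.subspace E" unfolding E_def by (rule subspace_eigenspace)
  have n1: "norm x = 1" if "ip1 x x = 1" for x
  proof -
    have "of_real ((norm x)\<^sup>2) = (of_real 1 :: 'k)" using that H.ip_norm[of x] by simp
    then have "(norm x)\<^sup>2 = 1" by (simp only: of_real_eq_iff)
    then show ?thesis by (simp add: abs_square_eq_1)
  qed
  obtain N where N: "\<forall>(I :: 'a set) F. orthogonal_images \<mu> I F \<longrightarrow> card I \<le> N"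
    using orthogonal_images_bounded_number[OF assms] ..
  have bound: "card B \<le> N" if B: "on B" for B
  proof -
    have "norm x \<le> 1 \<and> \<mu> \<le> (norm (T x))\<^sup>2" if x: "x \<in> B" for x
    proof -
      have "norm x = 1" "x \<in> E" using B x n1 by (auto simp: on_def)
      then show ?thesis using norm_T_eigenvector[of x \<mu>] by (simp add: E_def)
    qed
    moreover have "ip2 (T x) (T y) = 0" if "x \<in> B" "y \<in> B" "x \<noteq> y" for x y
    proof -
      have "ip2 (T x) (T y) = of_real \<mu> * ip1 x y"
        using B that by (intro ip2_T_eigenvector) (auto simp: on_def E_def)
      then show ?thesis using B that by (auto simp: on_def)
    qed
    ultimately have "orthogonal_images \<mu> B (\<lambda>x. x)"
      using B by (auto simp: orthogonal_images_def on_def)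
    then show ?thesis using N by blast
  qed
  have "on {}" by (simp add: on_def)
  then obtain B where B: "on B" and max: "\<And>B'. on B' \<Longrightarrow> card B' \<le> card B"
    using ex_has_greatest_nat[of on "{}" card "Suc N"] bound le_imp_less_Suc by blast
  have fin: "finite B" and BE: "B \<subseteq> E"
    and o: "\<And>x y. x \<in> B \<Longrightarrow> y \<in> B \<Longrightarrow> ip1 x y = (if x = y then 1 else 0)"
    using B by (auto simp: on_def)
  have "x \<in> H.span B" if x: "x \<in> E" for x
  proof -
    define p where "p = (\<Sum>b\<in>B. sc1 (ip1 x b) b)"
    define r where "r = x - p"
    have p: "p \<in> H.span B"
      unfolding p_def by (intro H.span_sum H.span_scale H.span_base)
    have rE: "r \<in> E"
      unfolding r_def p_def using BE
      by (intro H.subspace_diff[OF sub] x H.subspace_sum[OF sub] H.subspace_scale[OF sub]) auto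
    have rb: "ip1 r b = 0" if b: "b \<in> B" for b
    proof -
      have "ip1 p b = (\<Sum>c\<in>B. if c = b then ip1 x c else 0)"
        unfolding p_def H.ip_sum_left H.ip_scale by (intro sum.cong refl) (simp add: o b)
      then show ?thesis using b fin by (simp add: r_def H.ip_diff_left)
    qed
    have "r = 0"
    proof (rule ccontr)
      assume r0: "r \<noteq> 0"
      define u where "u = sc1 (of_real (1 / norm r)) r"
      have uu: "ip1 u u = 1"
        using r0 by (simp add: H.ip_norm u_def H.norm_sc norm_divide)
      have ub: "ip1 u b = 0" "ip1 b u = 0" if "b \<in> B" for b
        using rb[OF that] H.ip_eq_zero_sym[OF rb[OF that]]
        by (simp_all add: u_def H.ip_scale H.ip_scale_right)
      have "u \<notin> B" using ub uu by force
      moreover have "u \<in> E" unfolding u_def by (rule H.subspace_scale[OF sub rE])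
      ultimately have "on (insert u B)"
        using fin BE uu ub o by (auto simp: on_def)
      then have "card (insert u B) \<le> card B" by (rule max)
      then show False using \<open>u \<notin> B\<close> fin by simp
    qed
    then show ?thesis using p by (simp add: r_def)
  qed
  then have span: "H.span B = E"
    using H.span_minimal[OF BE sub] by blast
  have "H.independent B"
  proof (rule H.independent_if_scalars_zero[OF fin])
    fix f b assume s: "(\<Sum>x\<in>B. sc1 (f x) x) = 0" and b: "b \<in> B"
    have "ip1 (\<Sum>x\<in>B. sc1 (f x) x) b = (\<Sum>x\<in>B. if x = b then f x else 0)"
      unfolding H.ip_sum_left H.ip_scale by (intro sum.cong refl) (simp add: o b)
    then show "f b = 0" using b fin s by (simp add: H.ip_zero_left)
  qed
  moreover have "H.span B = H.span E" using span H.span_span by metis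
  ultimately have "H.dim E = card B" by (intro H.dim_eq_card) auto
  then show ?thesis using fin o span unfolding E_def by metis
qed

text \<open>
  On a closed invariant subspace the norm \<open>c\<close> of the restricted operator is attained: for a
  maximizing sequence \<open>f\<^sub>n\<close> of unit vectors one has
  \<open>\<parallel>W f\<^sub>n - c\<^sup>2 f\<^sub>n\<parallel>\<^sup>2 \<le> 2c\<^sup>4 - 2c\<^sup>2\<parallel>T f\<^sub>n\<parallel>\<^sup>2 \<rightarrow> 0\<close>, and \<open>W f\<^sub>n\<close> converges along a
  subsequence, because \<open>T\<close> is compact. The limit of \<open>f\<^sub>n\<close> is an eigenvector.
\<close>

lemma invariant_subspace_has_eigenvector:
  assumes V: "H.subspace V" "closed V" and inv: "\<And>x. x \<in> V \<Longrightarrow> adj (T x) \<in> V"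
    and x0: "x0 \<in> V" "T x0 \<noteq> 0"
  shows "\<exists>\<nu>>0. \<exists>f\<in>V. f \<noteq> 0 \<and> f \<in> eigenspace sc1 (adj \<circ> T) \<nu>"
proof -
  define D where "D = V \<inter> cball 0 1"
  define c where "c = (SUP f\<in>D. norm (T f))"
  obtain C where C: "0 \<le> C" "\<And>x. norm (T x) \<le> C * norm x"
    using T_bounded by blast
  have "norm (T f) \<le> C" if "f \<in> D" for f
    using C(2)[of f] mult_left_mono[of "norm f" 1 C] that C(1) by (simp add: D_def)
  then have bdd: "bdd_above ((\<lambda>f. norm (T f)) ` D)" by (rule bdd_aboveI2)
  have ne: "D \<noteq> {}" using H.subspace_0[OF V(1)] by (auto simp: D_def)
  have c_le: "norm (T f) \<le> c * norm f" if f: "f \<in> V" for f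
  proof (cases "f = 0")
    case False
    define g where "g = sc1 (of_real (1 / norm f)) f"
    have "g \<in> D" using f False H.subspace_scale[OF V(1)]
      by (simp add: D_def g_def H.norm_sc norm_divide)
    then have "norm (T g) \<le> c" unfolding c_def using bdd by (rule cSUP_upper)
    then show ?thesis using False
      by (simp add: g_def T_scale G.norm_sc norm_divide divide_simps mult.commute)
  qed (simp add: T_zero)
  have "0 < norm (T x0)" using x0 by simp
  from this c_le[OF x0(1)] have "0 < c * norm x0" by (rule less_le_trans)
  then have c0: "0 < c" by (auto simp: zero_less_mult_iff)
  have "\<exists>f\<in>D. c - 1 / Suc n < norm (T f)" for n
    using less_cSUP_iff[OF ne bdd, of "c - 1 / Suc n"] unfolding c_def by simp
  then obtain f where f: "\<And>n. f n \<in> D" "\<And>n. c - 1 / Suc n < norm (T (f n))" by metis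
  have fV: "f n \<in> V" and f1: "norm (f n) \<le> 1" for n using f(1) by (auto simp: D_def)
  have Tf_le: "norm (T (f n)) \<le> c" for n
    unfolding c_def using bdd f(1) by (intro cSUP_upper) auto
  have Tf: "(\<lambda>n. norm (T (f n))) \<longlonglongrightarrow> c"
  proof (rule tendsto_sandwich[where f = "\<lambda>n. c - 1 / Suc n" and h = "\<lambda>n. c"])
    show "(\<lambda>n. c - 1 / real (Suc n)) \<longlonglongrightarrow> c"
      using tendsto_diff[OF tendsto_const LIMSEQ_Suc[OF lim_1_over_n], of c] by simp
    show "\<forall>\<^sub>F n in sequentially. c - 1 / real (Suc n) \<le> norm (T (f n))"
      using f(2) by (intro always_eventually allI less_imp_le)
  qed (simp_all add: Tf_le)
  have "compact (closure (T ` cball 0 1))"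
    using compact_T by (simp add: compact_operator_def)
  moreover have "T (f n) \<in> closure (T ` cball 0 1)" for n
    using f1 closure_subset[of "T ` cball 0 1"] by auto
  ultimately have "\<exists>l\<in>closure (T ` cball 0 1). \<exists>r. strict_mono r \<and> ((\<lambda>n. T (f n)) \<circ> r) \<longlonglongrightarrow> l"
    unfolding compact_def by (elim allE[of _ "\<lambda>n. T (f n)"] mp) blast
  then obtain g r where r: "strict_mono r" and g: "(\<lambda>n. T (f (r n))) \<longlonglongrightarrow> g"
    unfolding comp_def by blast
  define a where "a = (\<lambda>n. adj (T (f (r n))))"
  define b where "b = (\<lambda>n. sc1 (of_real (c\<^sup>2)) (f (r n)))"
  have a_lim: "a \<longlonglongrightarrow> adj g" unfolding a_def by (rule tendsto_adj[OF g])
  have Tfr: "(\<lambda>n. norm (T (f (r n)))) \<longlonglongrightarrow> c"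
    using LIMSEQ_subseq_LIMSEQ[OF Tf r] by (simp add: comp_def)
  have ab: "(norm (a n - b n))\<^sup>2 \<le> 2 * c^4 - 2 * c\<^sup>2 * (norm (T (f (r n))))\<^sup>2" for n
  proof -
    let ?f = "f (r n)"
    have na: "norm (a n) \<le> c\<^sup>2"
    proof (cases "a n = 0")
      case False
      have aV: "a n \<in> V" unfolding a_def by (rule inv[OF fV])
      have "(norm (a n))\<^sup>2 = norm (ip1 (a n) (a n))"
        unfolding H.ip_norm norm_of_real by simp
      also have "\<dots> = norm (ip2 (T (a n)) (T ?f))"
        by (simp add: a_def ip_adj)
      also have "\<dots> \<le> norm (T (a n)) * norm (T ?f)" by (rule G.cauchy_schwarz)
      also have "\<dots> \<le> (c * norm (a n)) * c"
        using c0 by (intro mult_mono c_le[OF aV] Tf_le) auto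
      finally show ?thesis using False by (simp add: power2_eq_square)
    qed simp
    have ipb: "ip1 (b n) (a n) = of_real (c\<^sup>2 * (norm (T ?f))\<^sup>2)"
      unfolding b_def H.ip_scale unfolding a_def ip_adj G.ip_norm by simp
    then have ipa: "ip1 (a n) (b n) = of_real (c\<^sup>2 * (norm (T ?f))\<^sup>2)"
      by (metis H.ip_scnj scnj_of_real)
    have "of_real ((norm (a n - b n))\<^sup>2)
        = (of_real ((norm (a n))\<^sup>2 - c\<^sup>2 * (norm (T ?f))\<^sup>2 - (c\<^sup>2 * (norm (T ?f))\<^sup>2 - (norm (b n))\<^sup>2)) :: 'k)"
      unfolding of_real_diff ipa[symmetric] H.ip_norm[symmetric] H.ip_diff_left H.ip_diff_right
      using ipa ipb by simp
    then have "(norm (a n - b n))\<^sup>2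
        = (norm (a n))\<^sup>2 + (norm (b n))\<^sup>2 - 2 * c\<^sup>2 * (norm (T ?f))\<^sup>2"
      by (simp only: of_real_eq_iff)
    moreover have "(norm (a n))\<^sup>2 \<le> (c\<^sup>2)\<^sup>2" by (intro power_mono na) simp
    moreover have "norm (b n) \<le> c\<^sup>2"
      unfolding b_def H.norm_sc norm_of_real using mult_left_mono[OF f1, of "c\<^sup>2"] by simp
    then have "(norm (b n))\<^sup>2 \<le> (c\<^sup>2)\<^sup>2" by (intro power_mono) simp_all
    ultimately show ?thesis by simp
  qed
  have "(\<lambda>n. (norm (a n - b n))\<^sup>2) \<longlonglongrightarrow> 0"
  proof (rule tendsto_sandwich[where f = "\<lambda>n. 0"])
    show "(\<lambda>n. 2 * c^4 - 2 * c\<^sup>2 * (norm (T (f (r n))))\<^sup>2) \<longlonglongrightarrow> 0"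
      by (rule tendsto_eq_intros Tfr refl)+ (simp add: power2_eq_square power4_eq_xxxx)
  qed (simp_all add: ab)
  then have "(\<lambda>n. sqrt ((norm (a n - b n))\<^sup>2)) \<longlonglongrightarrow> sqrt 0" by (rule tendsto_real_sqrt)
  then have "(\<lambda>n. a n - b n) \<longlonglongrightarrow> 0" by (simp add: tendsto_norm_zero_iff)
  from tendsto_diff[OF a_lim this] have b_lim: "b \<longlonglongrightarrow> adj g" by simp
  define h where "h = sc1 (of_real (1 / c\<^sup>2)) (adj g)"
  have "(\<lambda>n. sc1 (of_real (1 / c\<^sup>2)) (b n)) \<longlonglongrightarrow> h"
    unfolding h_def by (rule H.tendsto_sc[OF b_lim])
  moreover have "sc1 (of_real (1 / c\<^sup>2)) (b n) = f (r n)" for n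
    unfolding b_def H.scale_scale of_real_mult[symmetric] using c0 by simp
  ultimately have h: "(\<lambda>n. f (r n)) \<longlonglongrightarrow> h" by simp
  have hV: "h \<in> V" using V(2) fV h by (meson closed_sequentially)
  have Th: "T h = g" using tendsto_T[OF h] g LIMSEQ_unique by blast
  have "norm (T h) = c"
    using tendsto_norm[OF tendsto_T[OF h]] Tfr LIMSEQ_unique by blast
  then have "h \<noteq> 0" using c0 T_zero by auto
  moreover have "adj (T h) = sc1 (of_real (c\<^sup>2)) h"
    unfolding h_def H.scale_scale of_real_mult[symmetric] Th[unfolded h_def] using c0 by simp
  ultimately show ?thesis using c0 hV
    by (intro exI[of _ "c\<^sup>2"]) (auto simp: eigenspace_def)
qed

text \<open>
  The eigenvectors span, together with the kernel, a dense subspace: otherwise the orthogonal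
  complement of the eigenvectors, which is invariant, would contain a further eigenvector.
\<close>

theorem singular_system:
  assumes lam: "ordered_eigenvalues sc1 (adj \<circ> T) lam"
  defines "J \<equiv> {j. 1 \<le> j \<and> 0 < lam j}"
  obtains e where
    "\<And>i j. i \<in> J \<Longrightarrow> j \<in> J \<Longrightarrow> ip1 (e i) (e j) = (if i = j then 1 else 0)"
    "\<And>x j. j \<in> J \<Longrightarrow> ip2 (T x) (T (e j)) = of_real (lam j) * ip1 x (e j)"
    "closure (H.span (e ` J \<union> {x. T x = 0})) = UNIV"
    "\<And>\<delta>. 0 < \<delta> \<Longrightarrow> finite {j. 1 \<le> j \<and> \<delta> < lam j}"
proof -
  define B where "B = (\<lambda>\<mu>. SOME B. finite B \<and> (\<forall>x\<in>B. \<forall>y\<in>B. ip1 x y = (if x = y then 1 else 0)) \<and>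
    H.span B = eigenspace sc1 (adj \<circ> T) \<mu> \<and> card B = H.dim (eigenspace sc1 (adj \<circ> T) \<mu>))"
  have B: "finite (B \<mu>)" "\<And>x y. x \<in> B \<mu> \<Longrightarrow> y \<in> B \<mu> \<Longrightarrow> ip1 x y = (if x = y then 1 else 0)"
    "H.span (B \<mu>) = eigenspace sc1 (adj \<circ> T) \<mu>"
    "card (B \<mu>) = H.dim (eigenspace sc1 (adj \<circ> T) \<mu>)" if "0 < \<mu>" for \<mu>
    using someI_ex[OF eigenspace_orthonormal_basis[OF that]] unfolding B_def by auto
  define I where "I = (\<lambda>\<mu>. {j. 1 \<le> j \<and> lam j = \<mu>})"
  have I: "finite (I \<mu>)" "card (I \<mu>) = card (B \<mu>)" if "0 < \<mu>" for \<mu>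
    using lam that B(4)[OF that] unfolding ordered_eigenvalues_def I_def by auto
  have "\<exists>g. bij_betw g (I \<mu>) (B \<mu>)" if "0 < \<mu>" for \<mu>
    using finite_same_card_bij[OF I(1) B(1) I(2)] that by blast
  then obtain g where g: "\<And>\<mu>. 0 < \<mu> \<Longrightarrow> bij_betw (g \<mu>) (I \<mu>) (B \<mu>)" by metis
  define e where "e = (\<lambda>j. g (lam j) j)"
  have eB: "e j \<in> B (lam j)" if "j \<in> J" for j
    using that bij_betwE[OF g] by (auto simp: e_def J_def I_def)
  have Be: "B \<mu> = e ` I \<mu>" if "0 < \<mu>" for \<mu>
    using bij_betw_imp_surj_on[OF g[OF that]] by (auto simp: e_def I_def)
  have IJ: "I \<mu> \<subseteq> J" if "0 < \<mu>" for \<mu> using that by (auto simp: I_def J_def)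
  have eE: "e j \<in> eigenspace sc1 (adj \<circ> T) (lam j)" if "j \<in> J" for j
    using eB[OF that] B(3)[of "lam j"] H.span_base that by (auto simp: J_def)
  have on: "ip1 (e i) (e j) = (if i = j then 1 else 0)" if ij: "i \<in> J" "j \<in> J" for i j
  proof (cases "lam i = lam j")
    case True
    have pos: "0 < lam i" using ij by (simp add: J_def)
    have "i \<in> I (lam i)" "j \<in> I (lam i)" using True ij by (auto simp: I_def J_def)
    then have "e i = e j \<longleftrightarrow> i = j"
      using bij_betw_imp_inj_on[OF g[OF pos]] True by (auto simp: e_def inj_on_def)
    moreover have "e i \<in> B (lam i)" "e j \<in> B (lam i)"
      using eB[OF ij(1)] eB[OF ij(2)] True by simp_all
    ultimately show ?thesis using B(2)[OF pos] by simp
  next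
    case False
    then show ?thesis using eigenvectors_orthogonal[OF eE eE] ij by auto
  qed
  have T_e: "ip2 (T x) (T (e j)) = of_real (lam j) * ip1 x (e j)" if "j \<in> J" for x j
    using ip2_T_eigenvector[OF eE[OF that]] .
  define V where "V = {x. \<forall>j\<in>J. ip1 x (e j) = 0}"
  have V0: "T x = 0" if x: "x \<in> V" for x
  proof (rule ccontr)
    assume "T x \<noteq> 0"
    have sub: "H.subspace V"
      by (rule H.subspaceI) (auto simp: V_def H.ip_zero_left H.ip_add H.ip_scale)
    have "closed V"
      unfolding closed_sequential_limits
    proof (intro allI impI, elim conjE)
      fix f l assume f: "\<forall>n. f n \<in> V" "f \<longlonglongrightarrow> l"
      have "ip1 l (e j) = 0" if "j \<in> J" for j
        using H.tendsto_ip_left[OF f(2), of "e j"] f(1) that by (simp add: V_def LIMSEQ_const_iff)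
      then show "l \<in> V" by (simp add: V_def)
    qed
    moreover have "adj (T y) \<in> V" if "y \<in> V" for y
    proof -
      have "ip1 (adj (T y)) (e j) = 0" if j: "j \<in> J" for j
      proof (rule H.ip_eq_zero_sym)
        have "ip2 (T y) (T (e j)) = 0" using T_e[OF j] \<open>y \<in> V\<close> j by (simp add: V_def)
        then show "ip1 (e j) (adj (T y)) = 0" unfolding ip_adj by (rule G.ip_eq_zero_sym)
      qed
      then show ?thesis by (simp add: V_def)
    qed
    ultimately obtain \<nu> f where f: "0 < \<nu>" "f \<in> V" "f \<noteq> 0" "f \<in> eigenspace sc1 (adj \<circ> T) \<nu>"
      using invariant_subspace_has_eigenvector[OF sub _ _ x \<open>T x \<noteq> 0\<close>] by blast
    have "H.subspace {y. ip1 y f = 0}"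
      by (rule H.subspaceI) (auto simp: H.ip_zero_left H.ip_add H.ip_scale)
    moreover have "B \<nu> \<subseteq> {y. ip1 y f = 0}"
      using Be[OF f(1)] IJ[OF f(1)] f(2) by (auto simp: V_def intro: H.ip_eq_zero_sym)
    ultimately have "H.span (B \<nu>) \<subseteq> {y. ip1 y f = 0}" by (rule H.span_minimal[rotated])
    then have "ip1 f f = 0" using f(4) B(3)[OF f(1)] by auto
    then show False using f(3) H.eq_zero_if_ip_self by blast
  qed
  define K where "K = closure (H.span (e ` J))"
  have K: "H.subspace K" "closed K"
    unfolding K_def by (rule H.subspace_closure H.subspace_span closed_closure)+
  define L where "L = closure (H.span (e ` J \<union> {x. T x = 0}))"
  have L: "H.subspace L"
    unfolding L_def by (rule H.subspace_closure H.subspace_span)+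
  have "x \<in> L" for x
  proof -
    obtain p where p: "p \<in> K" "\<And>v. v \<in> K \<Longrightarrow> ip1 (x - p) v = 0"
      using H.orthogonal_projection_exists[OF K] by blast
    have "e j \<in> K" if "j \<in> J" for j
      unfolding K_def using that by (intro subsetD[OF closure_subset] H.span_base) auto
    then have "x - p \<in> V" using p(2) by (simp add: V_def)
    then have "x - p \<in> {x. T x = 0}" using V0 by simp
    then have "x - p \<in> L"
      unfolding L_def by (intro subsetD[OF closure_subset] H.span_base) auto
    moreover have "K \<subseteq> L"
      unfolding K_def L_def by (intro closure_mono H.span_mono) auto
    then have "p \<in> L" using p(1) by auto
    ultimately have "(x - p) + p \<in> L" by (rule H.subspace_add[OF L])
    then show ?thesis by simp
  qed
  then have dense: "closure (H.span (e ` J \<union> {x. T x = 0})) = UNIV" unfolding L_def by auto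
  have fin: "finite {j. 1 \<le> j \<and> \<delta> < lam j}" if \<delta>: "0 < \<delta>" for \<delta>
  proof -
    obtain N where N: "\<forall>(I :: nat set) F. orthogonal_images \<delta> I F \<longrightarrow> card I \<le> N"
      using orthogonal_images_bounded_number[OF \<delta>] ..
    show ?thesis
    proof (rule finite_if_finite_subsets_card_bdd[THEN conjunct1])
      fix A assume A: "A \<subseteq> {j. 1 \<le> j \<and> \<delta> < lam j}" "finite A"
      have AJ: "A \<subseteq> J" using A(1) \<delta> by (auto simp: J_def)
      have "norm (e i) \<le> 1 \<and> \<delta> \<le> (norm (T (e i)))\<^sup>2" if i: "i \<in> A" for i
      proof -
        have "of_real ((norm (e i))\<^sup>2) = (of_real 1 :: 'k)"
          using on[of i i] AJ i H.ip_norm[of "e i"] by auto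
        then have n: "(norm (e i))\<^sup>2 = 1" by (simp only: of_real_eq_iff)
        then have "norm (e i) \<le> 1" by (simp add: abs_square_eq_1)
        moreover have "(norm (T (e i)))\<^sup>2 = lam i"
          using norm_T_eigenvector[OF eE[of i]] AJ i n by auto
        moreover have "\<delta> < lam i" using A(1) i by auto
        ultimately show ?thesis by simp
      qed
      moreover have "ip2 (T (e i)) (T (e j)) = 0" if "i \<in> A" "j \<in> A" "i \<noteq> j" for i j
        using T_e[of j "e i"] on[of i j] that subsetD[OF AJ that(1)] subsetD[OF AJ that(2)] by simp
      ultimately have "orthogonal_images \<delta> A e"
        using A(2) by (auto simp: orthogonal_images_def)
      then show "card A \<le> N" using N by blast
    qed
  qed
  show thesis by (rule that[OF on T_e dense fin])
qed

end

section \<open>Information complexity of diagonalized operators\<close>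

lemma underdetermined_system_solvable:
  fixes a :: "nat \<Rightarrow> 'i \<Rightarrow> 'k::field"
  assumes "finite I" "n < card I"
  shows "\<exists>c. (\<exists>i\<in>I. c i \<noteq> 0) \<and> (\<forall>j<n. (\<Sum>i\<in>I. a j i * c i) = 0)"
  using assms
proof (induction n arbitrary: I a)
  case 0
  then have "\<exists>i. i \<in> I" by (metis card.empty ex_in_conv less_irrefl)
  then show ?case by (intro exI[of _ "\<lambda>_. 1"]) auto
next
  case (Suc n)
  show ?case
  proof (cases "\<forall>i\<in>I. a n i = 0")
    case True
    obtain c where c: "\<exists>i\<in>I. c i \<noteq> 0" "\<forall>j<n. (\<Sum>i\<in>I. a j i * c i) = 0"
      using Suc.IH[OF Suc.prems(1), of a] Suc.prems(2) by auto
    have "(\<Sum>i\<in>I. a j i * c i) = 0" if "j < Suc n" for j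
      using c(2) that True by (cases "j = n") auto
    with c(1) show ?thesis by blast
  next
    case False
    then obtain p where p: "p \<in> I" "a n p \<noteq> 0" by blast
    define a' where "a' = (\<lambda>j i. a j i - a j p * a n i / a n p)"
    have "finite (I - {p})" "n < card (I - {p})" using Suc.prems p by auto
    then obtain c where c: "\<exists>i\<in>I - {p}. c i \<noteq> 0" "\<forall>j<n. (\<Sum>i\<in>I - {p}. a' j i * c i) = 0"
      using Suc.IH by blast
    define s where "s = (\<Sum>i\<in>I - {p}. a n i * c i)"
    define c' where "c' = c(p := - s / a n p)"
    have split: "(\<Sum>i\<in>I. a j i * c' i) = (\<Sum>i\<in>I - {p}. a j i * c i) - a j p * s / a n p" for j
      using p Suc.prems(1) by (subst sum.remove[of _ p]) (auto simp: c'_def intro!: sum.cong)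
    have "(\<Sum>i\<in>I. a j i * c' i) = 0" if "j < Suc n" for j
    proof (cases "j = n")
      case True
      then show ?thesis unfolding split using p by (simp add: s_def)
    next
      case False
      have "(\<Sum>i\<in>I - {p}. a' j i * c i)
          = (\<Sum>i\<in>I - {p}. a j i * c i - a j p / a n p * (a n i * c i))"
        by (intro sum.cong refl) (simp add: a'_def left_diff_distrib)
      then have "(\<Sum>i\<in>I - {p}. a' j i * c i) = (\<Sum>i\<in>I - {p}. a j i * c i) - a j p * s / a n p"
        unfolding sum_subtractf sum_distrib_left[symmetric] s_def[symmetric] by simp
      then show ?thesis unfolding split using c(2) False that by auto
    qed
    moreover have "\<exists>i\<in>I. c' i \<noteq> 0" using c(1) by (auto simp: c'_def)
    ultimately show ?thesis by blast
  qed
qed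

text \<open>
  An operator in diagonal form: up to a part \<open>Z\<close> of the kernel, its domain has the orthonormal
  basis \<open>E\<close>, whose images are orthogonal with squared lengths \<open>\<sigma>\<close>.
\<close>

locale diagonalized_operator =
  X: additive_hilbert_space sc1 ip1 + Y: additive_hilbert_space sc2 ip2
  for sc1 :: "'k::real_or_complex \<Rightarrow> 'a::banach \<Rightarrow> 'a" and ip1
    and sc2 :: "'k \<Rightarrow> 'b::banach \<Rightarrow> 'b" and ip2 +
  fixes X :: "'a set" and T :: "'a \<Rightarrow> 'b" and I :: "'i set" and E :: "'i \<Rightarrow> 'a"
    and \<sigma> :: "'i \<Rightarrow> real" and Z :: "'a set"
  assumes X_eq: "X = closure (X.span (E ` I \<union> Z))"
    and bounded_T: "bounded_linear_on sc1 sc2 X T"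
    and ip_E: "\<And>i j. i \<in> I \<Longrightarrow> j \<in> I \<Longrightarrow> ip1 (E i) (E j) = (if i = j then 1 else 0)"
    and ip_TE: "\<And>i j. i \<in> I \<Longrightarrow> j \<in> I \<Longrightarrow>
      ip2 (T (E i)) (T (E j)) = (if i = j then of_real (\<sigma> i) else 0)"
    and T_Z: "\<And>z. z \<in> Z \<Longrightarrow> T z = 0"
    and ip_Z_E: "\<And>z i. z \<in> Z \<Longrightarrow> i \<in> I \<Longrightarrow> ip1 z (E i) = 0"
begin

lemma subspace_X: "X.subspace X"
  unfolding X_eq by (intro X.subspace_closure X.subspace_span)

lemma span_subset_X: "X.span (E ` I \<union> Z) \<subseteq> X"
  unfolding X_eq by (rule closure_subset)

lemma E_in_X: "i \<in> I \<Longrightarrow> E i \<in> X"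
  by (rule subsetD[OF span_subset_X]) (simp add: X.span_base)

lemma sum_E_in_X: "F \<subseteq> I \<Longrightarrow> (\<Sum>i\<in>F. sc1 (c i) (E i)) \<in> X"
  by (intro X.subspace_sum[OF subspace_X] X.subspace_scale[OF subspace_X] E_in_X) (rule subsetD)

lemma T_add: "x \<in> X \<Longrightarrow> y \<in> X \<Longrightarrow> T (x + y) = T x + T y"
  and T_scale: "x \<in> X \<Longrightarrow> T (sc1 a x) = sc2 a (T x)"
  using bounded_T by (auto simp: bounded_linear_on_def)

lemma T_zero: "T 0 = 0"
  using T_scale[of 0 0] X.subspace_0[OF subspace_X] by simp

lemma T_bounded: "\<exists>C\<ge>0. \<forall>x\<in>X. norm (T x) \<le> C * norm x"
proof -
  obtain C where C: "\<forall>x\<in>X. norm (T x) \<le> C * norm x"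
    using bounded_T by (auto simp: bounded_linear_on_def)
  have "norm (T x) \<le> max 0 C * norm x" if "x \<in> X" for x
    using bspec[OF C that] mult_right_mono[of C "max 0 C" "norm x"] by simp
  then show ?thesis by (intro exI[of _ "max 0 C"]) auto
qed

lemma linear_on_sum_E:
  assumes "bounded_linear_on sc1 sc3 X R" and "module sc3" and "finite F" "F \<subseteq> I"
  shows "R (\<Sum>i\<in>F. sc1 (c i) (E i)) = (\<Sum>i\<in>F. sc3 (c i) (R (E i)))"
  using assms(3,4)
proof (induction F rule: finite_induct)
  case empty
  have "R (sc1 0 0) = sc3 0 (R 0)"
    using assms(1) X.subspace_0[OF subspace_X] unfolding bounded_linear_on_def by blast
  then show ?case using module.scale_zero_left[OF assms(2)] by simp
next
  case (insert i F)
  have R_add: "R (x + y) = R x + R y" if "x \<in> X" "y \<in> X" for x y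
    using assms(1) that unfolding bounded_linear_on_def by blast
  have R_scale: "R (sc1 a x) = sc3 a (R x)" if "x \<in> X" for a x
    using assms(1) that unfolding bounded_linear_on_def by blast
  have "E i \<in> X" using insert.prems E_in_X by simp
  moreover have "sc1 (c i) (E i) \<in> X" by (rule X.subspace_scale[OF subspace_X \<open>E i \<in> X\<close>])
  moreover have "(\<Sum>i\<in>F. sc1 (c i) (E i)) \<in> X" using insert.prems by (intro sum_E_in_X) simp
  ultimately show ?case
    using insert.IH insert.hyps insert.prems by (simp add: R_add R_scale)
qed

lemma T_sum_E: "finite F \<Longrightarrow> F \<subseteq> I \<Longrightarrow> T (\<Sum>i\<in>F. sc1 (c i) (E i)) = (\<Sum>i\<in>F. sc2 (c i) (T (E i)))"
  by (rule linear_on_sum_E[OF bounded_T Y.module_axioms])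

lemma norm_sum_E:
  assumes "finite F" "F \<subseteq> I"
  shows "(norm (\<Sum>i\<in>F. sc1 (c i) (E i)))\<^sup>2 = (\<Sum>i\<in>F. (norm (c i))\<^sup>2)"
proof -
  have "ip1 (E i) (E j) = (if i = j then of_real 1 else 0)" if "i \<in> F" "j \<in> F" for i j
    using ip_E[OF subsetD[OF assms(2) that(1)] subsetD[OF assms(2) that(2)]] by simp
  from X.norm_sum_orthogonal[where \<sigma> = "\<lambda>_. 1", OF assms(1) this] show ?thesis by simp
qed

lemma norm_sum_TE:
  assumes "finite F" "F \<subseteq> I"
  shows "(norm (\<Sum>i\<in>F. sc2 (c i) (T (E i))))\<^sup>2 = (\<Sum>i\<in>F. (norm (c i))\<^sup>2 * \<sigma> i)"
  by (rule Y.norm_sum_orthogonal[OF assms(1)]) (intro ip_TE subsetD[OF assms(2)])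

lemma norm_E: "i \<in> I \<Longrightarrow> norm (E i) = 1"
  using norm_sum_E[of "{i}" "\<lambda>_. 1"] by (simp add: abs_square_eq_1)

lemma norm_TE: "i \<in> I \<Longrightarrow> (norm (T (E i)))\<^sup>2 = \<sigma> i"
  using norm_sum_TE[of "{i}" "\<lambda>_. 1"] by simp

lemma span_decomposition:
  assumes "f \<in> X.span (E ` I \<union> Z)"
  obtains F c z where "finite F" "F \<subseteq> I" "z \<in> X.span Z" "f = (\<Sum>i\<in>F. sc1 (c i) (E i)) + z"
proof -
  obtain x z where xz: "x \<in> X.span (E ` I)" "z \<in> X.span Z" "f = x + z"
    using assms unfolding X.span_Un by blast
  obtain A u where A: "finite A" "A \<subseteq> E ` I" "x = (\<Sum>a\<in>A. sc1 (u a) a)"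
    using xz(1) unfolding X.span_explicit by blast
  obtain F where F: "F \<subseteq> I" "inj_on E F" "A = E ` F"
    using A(2) unfolding subset_image_inj by blast
  have "finite F" using A(1) finite_imageD[of E F] F by simp
  have "x = (\<Sum>i\<in>F. sc1 (u (E i)) (E i))"
    unfolding A(3) F(3) by (simp add: sum.reindex[OF F(2)])
  then show thesis using that[of F z] F(1) \<open>finite F\<close> xz by simp
qed

lemma span_Z: "z \<in> X.span Z \<Longrightarrow> T z = 0 \<and> (\<forall>i\<in>I. ip1 z (E i) = 0)"
proof -
  assume z: "z \<in> X.span Z"
  have "X.subspace {z \<in> X. T z = 0 \<and> (\<forall>i\<in>I. ip1 z (E i) = 0)}"
    using subspace_X by (intro X.subspaceI)
      (auto simp: T_zero T_add T_scale X.ip_zero_left X.ip_add X.ip_scale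
        X.subspace_0 X.subspace_add X.subspace_scale)
  moreover have "Z \<subseteq> {z \<in> X. T z = 0 \<and> (\<forall>i\<in>I. ip1 z (E i) = 0)}"
    using subsetD[OF span_subset_X X.span_base] by (auto simp: T_Z ip_Z_E)
  ultimately have "X.span Z \<subseteq> {z \<in> X. T z = 0 \<and> (\<forall>i\<in>I. ip1 z (E i) = 0)}"
    by (rule X.span_minimal[rotated])
  then show ?thesis using z by auto
qed

text \<open>
  On finite combinations of basis vectors this is Parseval's identity, and both sides are
  continuous.
\<close>

lemma truncation_error:
  assumes J: "finite J" "J \<subseteq> I" and b: "0 \<le> b" "\<And>i. i \<in> I - J \<Longrightarrow> \<sigma> i \<le> b" and f: "f \<in> X"
  shows "norm (T f - (\<Sum>j\<in>J. sc2 (ip1 f (E j)) (T (E j)))) \<le> sqrt b * norm f"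
proof -
  define R where "R = (\<lambda>f. T f - (\<Sum>j\<in>J. sc2 (ip1 f (E j)) (T (E j))))"
  have span: "norm (R f) \<le> sqrt b * norm f" if sp: "f \<in> X.span (E ` I \<union> Z)" for f
  proof -
    obtain F c z where F: "finite F" "F \<subseteq> I" and z: "z \<in> X.span Z"
      and f: "f = (\<Sum>i\<in>F. sc1 (c i) (E i)) + z"
      by (rule span_decomposition[OF sp])
    define c' where "c' = (\<lambda>i. if i \<in> F then c i else 0)"
    define G where "G = F \<union> J"
    have G: "finite G" "G \<subseteq> I" using F J by (auto simp: G_def)
    define g where "g = (\<Sum>i\<in>G. sc1 (c' i) (E i))"
    have "g = (\<Sum>i\<in>F. sc1 (c i) (E i))"
      unfolding g_def using G(1) by (intro sum.mono_neutral_cong_right) (auto simp: c'_def G_def)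
    then have f: "f = g + z" using f by simp
    have gX: "g \<in> X" unfolding g_def by (rule sum_E_in_X[OF G(2)])
    have zX: "z \<in> X"
      using z span_subset_X X.span_mono[of Z "E ` I \<union> Z"] by auto
    have gz: "ip1 g z = 0"
      unfolding g_def X.ip_sum_left X.ip_scale
      using G span_Z[OF z] by (intro sum.neutral) (auto dest!: X.ip_eq_zero_sym)
    have nf: "(norm f)\<^sup>2 = (\<Sum>i\<in>G. (norm (c' i))\<^sup>2) + (norm z)\<^sup>2"
      unfolding f X.pythagoras[OF gz] unfolding g_def norm_sum_E[OF G] ..
    have ipf: "ip1 f (E j) = c' j" if j: "j \<in> J" for j
    proof -
      have "ip1 g (E j) = (\<Sum>i\<in>G. if i = j then c' i else 0)"
        unfolding g_def X.ip_sum_left X.ip_scale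
        using j J G by (intro sum.cong refl) (auto simp: ip_E subset_eq)
      also have "\<dots> = c' j" using j G by (auto simp: G_def)
      finally show ?thesis using span_Z[OF z] j J by (auto simp: f X.ip_add)
    qed
    have "T f = T g" unfolding f T_add[OF gX zX] using span_Z[OF z] by simp
    also have "\<dots> = (\<Sum>i\<in>G. sc2 (c' i) (T (E i)))" unfolding g_def by (rule T_sum_E[OF G])
    also have "\<dots> = (\<Sum>i\<in>G - J. sc2 (c' i) (T (E i))) + (\<Sum>i\<in>J. sc2 (c' i) (T (E i)))"
      by (rule sum.subset_diff) (use G in \<open>auto simp: G_def\<close>)
    finally have "R f = (\<Sum>i\<in>G - J. sc2 (c' i) (T (E i)))"
      unfolding R_def using ipf by simp
    moreover have "(norm (\<Sum>i\<in>G - J. sc2 (c' i) (T (E i))))\<^sup>2 = (\<Sum>i\<in>G - J. (norm (c' i))\<^sup>2 * \<sigma> i)"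
      using G by (intro norm_sum_TE) auto
    moreover have "(\<Sum>i\<in>G - J. (norm (c' i))\<^sup>2 * \<sigma> i) \<le> (\<Sum>i\<in>G - J. (norm (c' i))\<^sup>2 * b)"
      using G b by (intro sum_mono mult_left_mono) auto
    moreover have "(\<Sum>i\<in>G - J. (norm (c' i))\<^sup>2 * b) \<le> (\<Sum>i\<in>G. (norm (c' i))\<^sup>2 * b)"
      using G b(1) by (intro sum_mono2) auto
    moreover have "(\<Sum>i\<in>G. (norm (c' i))\<^sup>2 * b) \<le> b * (norm f)\<^sup>2"
      unfolding nf sum_distrib_right[symmetric] distrib_left using b(1) by (simp add: mult.commute)
    ultimately have "(norm (R f))\<^sup>2 \<le> (sqrt b * norm f)\<^sup>2"
      using b(1) by (simp add: power_mult_distrib)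
    then show ?thesis by (rule power2_le_imp_le) (simp add: b)
  qed
  obtain h where h: "\<And>n. h n \<in> X.span (E ` I \<union> Z)" "h \<longlonglongrightarrow> f"
    using f unfolding X_eq closure_sequential by blast
  have hX: "h n \<in> X" for n using h(1) span_subset_X by blast
  obtain C where C: "0 \<le> C" "\<forall>x\<in>X. norm (T x) \<le> C * norm x" using T_bounded by blast
  have Th: "(\<lambda>n. T (h n)) \<longlonglongrightarrow> T f"
  proof (rule tendsto_if_norm_diff_le[OF h(2)])
    have "T (h n) - T f = T (h n - f)" for n
      using T_add[of "h n - f" f] X.subspace_diff[OF subspace_X hX f] f by simp
    then show "norm (T (h n) - T f) \<le> C * norm (h n - f)" for n
      using C(2) X.subspace_diff[OF subspace_X hX f] by simp
  qed
  have coef: "(\<lambda>n. sc2 (ip1 (h n) (E j)) (T (E j))) \<longlonglongrightarrow> sc2 (ip1 f (E j)) (T (E j))" for j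
  proof (rule tendsto_if_norm_diff_le[OF X.tendsto_ip_left[OF h(2)]])
    show "norm (sc2 (ip1 (h n) (E j)) (T (E j)) - sc2 (ip1 f (E j)) (T (E j)))
        \<le> norm (T (E j)) * norm (ip1 (h n) (E j) - ip1 f (E j))" for n
      by (simp add: Y.scale_left_diff_distrib[symmetric] Y.norm_sc mult.commute)
  qed
  have "(\<lambda>n. norm (R (h n))) \<longlonglongrightarrow> norm (R f)"
    unfolding R_def by (rule tendsto_norm[OF tendsto_diff[OF Th tendsto_sum[OF coef]]])
  moreover have "(\<lambda>n. sqrt b * norm (h n)) \<longlonglongrightarrow> sqrt b * norm f"
    by (rule tendsto_mult[OF tendsto_const tendsto_norm[OF h(2)]])
  ultimately have "norm (R f) \<le> sqrt b * norm f"
    by (rule LIMSEQ_le) (use span[OF h(1)] in simp)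
  then show ?thesis by (simp add: R_def)
qed

lemma operator_norm_le:
  assumes "0 \<le> K" "\<And>f. f \<in> X \<Longrightarrow> norm (R f) \<le> K * norm f"
  shows "operator_norm X R \<le> K"
  unfolding operator_norm_def
proof (rule cSUP_least)
  show "X \<inter> cball 0 1 \<noteq> {}" using X.subspace_0[OF subspace_X] by auto
  fix f assume "f \<in> X \<inter> cball 0 1"
  then show "norm (R f) \<le> K"
    using assms(2)[of f] mult_left_mono[OF _ assms(1), of "norm f" 1] by simp
qed

lemma norm_le_operator_norm:
  assumes "\<And>f. f \<in> X \<Longrightarrow> norm (R f) \<le> K * norm f" and "f \<in> X" "norm f \<le> 1"
  shows "norm (R f) \<le> operator_norm X R"
  unfolding operator_norm_def
proof (rule cSUP_upper)
  show "bdd_above ((\<lambda>f. norm (R f)) ` (X \<inter> cball 0 1))"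
  proof (rule bdd_aboveI2)
    fix f assume f: "f \<in> X \<inter> cball 0 1"
    then have "norm (R f) \<le> \<bar>K\<bar> * norm f"
      using assms(1)[of f] by (meson Int_iff abs_ge_self mult_right_mono norm_ge_zero order_trans)
    then show "norm (R f) \<le> \<bar>K\<bar>"
      using f mult_left_mono[of "norm f" 1 "\<bar>K\<bar>"] by simp
  qed
qed (use assms in auto)

theorem operator_norm_eq:
  assumes "i \<in> I" "\<And>j. j \<in> I \<Longrightarrow> \<sigma> j \<le> \<sigma> i"
  shows "operator_norm X T = sqrt (\<sigma> i)"
proof (rule antisym)
  have "0 \<le> \<sigma> i" using norm_TE[OF assms(1)] by (metis zero_le_power2)
  have bound: "norm (T f) \<le> sqrt (\<sigma> i) * norm f" if "f \<in> X" for f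
    using truncation_error[of "{}" "\<sigma> i" f] assms that \<open>0 \<le> \<sigma> i\<close> by simp
  then show "operator_norm X T \<le> sqrt (\<sigma> i)"
    using \<open>0 \<le> \<sigma> i\<close> by (intro operator_norm_le) auto
  have "sqrt (\<sigma> i) = norm (T (E i))" using norm_TE[OF assms(1)] by (metis norm_ge_zero real_sqrt_unique)
  also have "\<dots> \<le> operator_norm X T"
    using bound E_in_X norm_E assms(1) by (intro norm_le_operator_norm) auto
  finally show "sqrt (\<sigma> i) \<le> operator_norm X T" .
qed

lemma algorithm_error_bounded:
  assumes "A \<in> algorithms sc1 sc2 X Y n"
  shows "\<exists>K. \<forall>f\<in>X. norm (T f - A f) \<le> K * norm f"
proof -
  obtain L g where L: "\<And>i. i < n \<Longrightarrow> bounded_linear_on sc1 (*) X (L i)"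
    and A: "A = (\<lambda>f. \<Sum>i<n. sc2 (L i f) (g i))"
    using assms by (auto simp: algorithms_def)
  have "\<exists>C. \<forall>f\<in>X. norm (L i f) \<le> C * norm f" if "i < n" for i
    using L[OF that] by (auto simp: bounded_linear_on_def)
  then obtain C where C: "\<And>i f. i < n \<Longrightarrow> f \<in> X \<Longrightarrow> norm (L i f) \<le> C i * norm f" by metis
  obtain C' where C': "\<forall>x\<in>X. norm (T x) \<le> C' * norm x" using T_bounded by blast
  have "norm (T f - A f) \<le> (C' + (\<Sum>i<n. C i * norm (g i))) * norm f" if f: "f \<in> X" for f
  proof -
    have "norm (A f) \<le> (\<Sum>i<n. norm (L i f) * norm (g i))"
      unfolding A Y.norm_sc[symmetric] by (rule norm_sum)
    also have "\<dots> \<le> (\<Sum>i<n. (C i * norm f) * norm (g i))"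
      using C f by (intro sum_mono mult_right_mono) auto
    finally have "norm (A f) \<le> (\<Sum>i<n. C i * norm (g i)) * norm f"
      by (simp add: sum_distrib_left sum_distrib_right mult_ac)
    moreover have "norm (T f) \<le> C' * norm f" using C' f by blast
    ultimately show ?thesis using norm_triangle_ineq4[of "T f" "A f"] by (simp add: algebra_simps)
  qed
  then show ?thesis by blast
qed

text \<open>
  Fewer than \<open>card F\<close> functionals vanish simultaneously at some unit vector in the span of the
  \<open>E i\<close> with \<open>i \<in> F\<close>, where the algorithm returns zero.
\<close>

lemma algorithm_error_lower_bound:
  assumes A: "A \<in> algorithms sc1 sc2 X Y n" and F: "finite F" "F \<subseteq> I" "n < card F"
    and b: "\<And>i. i \<in> F \<Longrightarrow> b \<le> \<sigma> i"
  shows "sqrt b \<le> operator_norm X (\<lambda>f. T f - A f)"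
proof -
  obtain L g where L: "\<And>i. i < n \<Longrightarrow> bounded_linear_on sc1 (*) X (L i)"
    and A_eq: "A = (\<lambda>f. \<Sum>i<n. sc2 (L i f) (g i))"
    using A by (auto simp: algorithms_def)
  obtain c where c: "\<exists>i\<in>F. c i \<noteq> 0" "\<And>j. j < n \<Longrightarrow> (\<Sum>i\<in>F. L j (E i) * c i) = 0"
    using underdetermined_system_solvable[OF F(1,3), of "\<lambda>j i. L j (E i)"] by blast
  define q where "q = (\<Sum>i\<in>F. (norm (c i))\<^sup>2)"
  have q: "0 < q"
    unfolding q_def using c(1) F(1) by (metis (mono_tags, lifting) sum_pos2 zero_le_power2 zero_less_norm_iff zero_less_power)
  define c' where "c' = (\<lambda>i. of_real (1 / sqrt q) * c i)"
  define f where "f = (\<Sum>i\<in>F. sc1 (c' i) (E i))"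
  have n2: "(norm (c' i))\<^sup>2 = (norm (c i))\<^sup>2 / q" for i
    unfolding c'_def norm_mult norm_of_real using q by (simp add: power_mult_distrib power_divide)
  have "(norm f)\<^sup>2 = 1"
    unfolding f_def norm_sum_E[OF F(1,2)] n2 sum_divide_distrib[symmetric] q_def[symmetric]
    using q by simp
  then have f1: "norm f \<le> 1" by (simp add: abs_square_eq_1)
  have fX: "f \<in> X" unfolding f_def by (rule sum_E_in_X[OF F(2)])
  have "L j f = 0" if j: "j < n" for j
  proof -
    have "module ((*) :: 'k \<Rightarrow> _)" by unfold_locales (auto simp: algebra_simps)
    then have "L j f = (\<Sum>i\<in>F. c' i * L j (E i))"
      unfolding f_def by (rule linear_on_sum_E[OF L[OF j] _ F(1,2)])
    also have "\<dots> = of_real (1 / sqrt q) * (\<Sum>i\<in>F. L j (E i) * c i)"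
      unfolding c'_def sum_distrib_left by (simp add: mult_ac)
    finally show ?thesis using c(2)[OF j] by simp
  qed
  then have Af: "A f = 0" by (simp add: A_eq)
  have "b = (\<Sum>i\<in>F. (norm (c' i))\<^sup>2 * b)"
    unfolding sum_distrib_right[symmetric] n2 sum_divide_distrib[symmetric] q_def[symmetric]
    using q by simp
  also have "\<dots> \<le> (\<Sum>i\<in>F. (norm (c' i))\<^sup>2 * \<sigma> i)"
    using b by (intro sum_mono mult_left_mono) auto
  also have "\<dots> = (norm (T f))\<^sup>2"
    unfolding f_def T_sum_E[OF F(1,2)] norm_sum_TE[OF F(1,2)] ..
  finally have "sqrt b \<le> norm (T f - A f)"
    unfolding Af by (simp add: real_le_lsqrt)
  moreover obtain K where "\<And>f. f \<in> X \<Longrightarrow> norm (T f - A f) \<le> K * norm f"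
    using algorithm_error_bounded[OF A] by blast
  ultimately show ?thesis
    using norm_le_operator_norm[of "\<lambda>f. T f - A f", OF _ fX f1] by fastforce
qed

text \<open>
  The truncated expansion over all \<open>i\<close> with \<open>\<epsilon>\<^sup>2 < \<sigma> i\<close> has error at most \<open>\<epsilon>\<close>. With fewer
  functionals the errors of all algorithms have a common lower bound that exceeds \<open>\<epsilon>\<close>, namely the
  square root of the least of these finitely many \<open>\<sigma> i\<close>; hence the infimum exceeds \<open>\<epsilon>\<close>, too.
\<close>

theorem n_abs_eq:
  assumes \<epsilon>: "0 < \<epsilon>" and fin: "finite {i \<in> I. \<epsilon>\<^sup>2 < \<sigma> i}" and Y: "\<And>i. i \<in> I \<Longrightarrow> T (E i) \<in> Y"
  shows "n_abs sc1 sc2 X Y \<epsilon> T = card {i \<in> I. \<epsilon>\<^sup>2 < \<sigma> i}"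
proof -
  define F where "F = {i \<in> I. \<epsilon>\<^sup>2 < \<sigma> i}"
  have F: "finite F" "F \<subseteq> I" using fin by (auto simp: F_def)
  define err where "err = (\<lambda>n. INF A\<in>algorithms sc1 sc2 X Y n. operator_norm X (\<lambda>f. T f - A f))"
  have upper: "err (card F) \<le> \<epsilon>"
  proof -
    obtain h where h: "bij_betw h {..<card F} F"
      using ex_bij_betw_nat_finite[OF F(1)] atLeast0LessThan by metis
    define A where "A = (\<lambda>f. \<Sum>i<card F. sc2 (ip1 f (E (h i))) (T (E (h i))))"
    have hI: "h i \<in> I" if "i < card F" for i using h that F(2) by (auto simp: bij_betw_def)
    have "bounded_linear_on sc1 (*) X (\<lambda>f. ip1 f (E (h i)))" if "i < card F" for i
    proof -
      have "norm (ip1 f (E (h i))) \<le> 1 * norm f" for f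
        using X.cauchy_schwarz[of f "E (h i)"] norm_E[OF hI[OF that]] by simp
      then show ?thesis
        unfolding bounded_linear_on_def
        by (intro conjI ballI allI exI[of _ 1]) (simp_all add: X.ip_add X.ip_scale)
    qed
    then have A: "A \<in> algorithms sc1 sc2 X Y (card F)"
      unfolding algorithms_def A_def mem_Collect_eq
      by (intro exI[of _ "\<lambda>i f. ip1 f (E (h i))"] exI[of _ "\<lambda>i. T (E (h i))"] conjI allI impI refl)
        (simp_all add: Y hI)
    have "A f = (\<Sum>j\<in>F. sc2 (ip1 f (E j)) (T (E j)))" for f
      unfolding A_def by (rule sum.reindex_bij_betw[OF h])
    moreover have "\<sigma> i \<le> \<epsilon>\<^sup>2" if "i \<in> I - F" for i using that by (auto simp: F_def)
    ultimately have "norm (T f - A f) \<le> \<epsilon> * norm f" if "f \<in> X" for f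
      using truncation_error[OF F, of "\<epsilon>\<^sup>2" f] \<epsilon> that by simp
    then have "operator_norm X (\<lambda>f. T f - A f) \<le> \<epsilon>"
      using \<epsilon> by (intro operator_norm_le) auto
    moreover have "bdd_below ((\<lambda>A. operator_norm X (\<lambda>f. T f - A f)) ` algorithms sc1 sc2 X Y (card F))"
    proof (rule bdd_belowI2)
      fix A assume A: "A \<in> algorithms sc1 sc2 X Y (card F)"
      obtain K where "\<And>f. f \<in> X \<Longrightarrow> norm (T f - A f) \<le> K * norm f"
        using algorithm_error_bounded[OF A] by blast
      then have "norm (T 0 - A 0) \<le> operator_norm X (\<lambda>f. T f - A f)"
        using norm_le_operator_norm[of "\<lambda>f. T f - A f" K 0] X.subspace_0[OF subspace_X] by simp
      then show "0 \<le> operator_norm X (\<lambda>f. T f - A f)"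
        using norm_ge_zero order_trans by blast
    qed
    ultimately show ?thesis unfolding err_def using A by (intro cINF_lower2) auto
  qed
  have lower: "card F \<le> n" if n: "err n \<le> \<epsilon>" for n
  proof (rule ccontr)
    assume "\<not> card F \<le> n"
    then have nF: "n < card F" by simp
    then have ne: "F \<noteq> {}" by auto
    define b where "b = Min (\<sigma> ` F)"
    have b: "b \<le> \<sigma> i" if "i \<in> F" for i using F(1) that by (auto simp: b_def)
    have "b \<in> \<sigma> ` F" unfolding b_def using F(1) ne by (intro Min_in) auto
    then have "\<epsilon>\<^sup>2 < b" by (auto simp: F_def)
    then have "\<epsilon> < sqrt b" using \<epsilon> by (simp add: real_less_rsqrt)
    also have "sqrt b \<le> err n"
      unfolding err_def
    proof (rule cINF_greatest)
      have "bounded_linear_on sc1 (*) X (\<lambda>f. 0)" by (auto simp: bounded_linear_on_def intro: exI[of _ 0])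
      moreover obtain y where "y \<in> Y" using Y ne F(2) by blast
      ultimately have "(\<lambda>f. \<Sum>i<n. sc2 ((\<lambda>i f. 0) i f) ((\<lambda>i. y) i)) \<in> algorithms sc1 sc2 X Y n"
        unfolding algorithms_def mem_Collect_eq
        by (intro exI[of _ "\<lambda>i f. 0"] exI[of _ "\<lambda>i. y"] conjI allI impI refl)
      then show "algorithms sc1 sc2 X Y n \<noteq> {}" by blast
    qed (rule algorithm_error_lower_bound[OF _ F nF b])
    finally show False using n by simp
  qed
  have "(LEAST n. err n \<le> \<epsilon>) = card F"
    using upper lower by (rule Least_equality)
  then show ?thesis unfolding n_abs_def err_def F_def .
qed

end

section \<open>Tensor powers of a compact operator\<close>

lemma ip_elementary_tensors:
  assumes "elementary_tensors sc ip scP ipP tens" "xs \<noteq> []" "length xs = length ys"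
  shows "ipP (tens xs) (tens ys) = (\<Prod>i<length xs. ip (xs ! i) (ys ! i))"
  using assms unfolding elementary_tensors_def by blast

lemma norm_elementary_tensor:
  assumes "additive_hilbert_space scP ipP" "hilbert_space sc ip"
    and "elementary_tensors sc ip scP ipP tens" "xs \<noteq> []"
  shows "norm (tens xs) = (\<Prod>i<length xs. norm (xs ! i))"
proof -
  interpret P: additive_hilbert_space scP ipP by fact
  interpret A: hilbert_space sc ip by fact
  have "ipP (tens xs) (tens xs) = (\<Prod>i<length xs. ip (xs ! i) (xs ! i))"
    by (rule ip_elementary_tensors[OF assms(3,4) refl])
  then have "of_real ((norm (tens xs))\<^sup>2) = (of_real ((\<Prod>i<length xs. norm (xs ! i))\<^sup>2) :: 'a)"
    unfolding P.ip_norm A.ip_norm of_real_prod[symmetric] prod_power_distrib[symmetric] .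
  then have "(norm (tens xs))\<^sup>2 = (\<Prod>i<length xs. norm (xs ! i))\<^sup>2"
    by (simp only: of_real_eq_iff)
  then show ?thesis by (simp add: power2_eq_iff_nonneg prod_nonneg)
qed

text \<open>
  The factors of an elementary tensor may be restricted to a set \<open>B\<close> with dense span: one
  factor after the other is a limit of linear combinations of elements of \<open>B\<close>, on which the
  tensor depends linearly and continuously.
\<close>

lemma elementary_tensors_dense:
  assumes "additive_hilbert_space scP ipP" "additive_hilbert_space sc ip"
    and tens: "elementary_tensors sc ip scP ipP tens"
    and B: "closure (module.span sc B) = UNIV" and "1 \<le> d"
    and V: "module.subspace scP V" "closed V"
    and base: "\<And>xs. length xs = d \<Longrightarrow> set xs \<subseteq> B \<Longrightarrow> tens xs \<in> V"
    and "length xs = d"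
  shows "tens xs \<in> V"
proof -
  interpret P: additive_hilbert_space scP ipP by fact
  interpret A: additive_hilbert_space sc ip by fact
  have "tens xs \<in> V" if "length xs = d" "\<forall>i. k \<le> i \<and> i < d \<longrightarrow> xs ! i \<in> B" "k \<le> d" for k xs
    using that
  proof (induction k arbitrary: xs)
    case 0
    then show ?case by (intro base) (auto simp: in_set_conv_nth)
  next
    case (Suc k)
    have k: "k < length xs" using Suc.prems by simp
    define h where "h = (\<lambda>x. tens (xs[k := x]))"
    have lin: "h (sc a x + sc b y) = scP a (h x) + scP b (h y)" for a b x y
      using tens k unfolding elementary_tensors_def h_def by blast
    have h_add: "h (x + y) = h x + h y" for x y using lin[of 1 x 1 y] by simp
    have h_scale: "h (sc a x) = scP a (h x)" for a x using lin[of a x 0 x] by simp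
    have h_zero: "h 0 = 0" using h_scale[of 0 0] by simp
    have h_diff: "h (x - y) = h x - h y" for x y using h_add[of "x - y" y] by simp
    define C where "C = (\<Prod>i\<in>{..<length xs} - {k}. norm (xs ! i))"
    have nh: "norm (h x) = C * norm x" for x
    proof -
      have "norm (h x) = (\<Prod>i<length (xs[k := x]). norm (xs[k := x] ! i))"
        unfolding h_def using k
        by (intro norm_elementary_tensor[OF assms(1) A.hilbert_space_axioms tens]) auto
      also have "\<dots> = norm x * (\<Prod>i\<in>{..<length xs} - {k}. norm (xs[k := x] ! i))"
        using k by (subst prod.remove[of _ k]) auto
      also have "(\<Prod>i\<in>{..<length xs} - {k}. norm (xs[k := x] ! i)) = C"
        unfolding C_def by (intro prod.cong) auto
      finally show ?thesis by simp
    qed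
    have "B \<subseteq> {x. h x \<in> V}"
    proof
      fix x assume "x \<in> B"
      then have "tens (xs[k := x]) \<in> V"
        using Suc.prems by (intro Suc.IH) (auto simp: nth_list_update)
      then show "x \<in> {x. h x \<in> V}" by (simp add: h_def)
    qed
    moreover have "A.subspace {x. h x \<in> V}"
      using V(1) by (intro A.subspaceI)
        (auto simp: h_zero h_add h_scale P.subspace_0 P.subspace_add P.subspace_scale)
    ultimately have sp: "A.span B \<subseteq> {x. h x \<in> V}" by (rule A.span_minimal)
    have "closed {x. h x \<in> V}"
      unfolding closed_sequential_limits
    proof (intro allI impI, elim conjE)
      fix f l assume f: "\<forall>n. f n \<in> {x. h x \<in> V}" "f \<longlonglongrightarrow> l"
      have "(\<lambda>n. h (f n)) \<longlonglongrightarrow> h l"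
      proof (rule tendsto_if_norm_diff_le[OF f(2)])
        show "norm (h (f n) - h l) \<le> C * norm (f n - l)" for n
          by (simp add: h_diff[symmetric] nh)
      qed
      then show "l \<in> {x. h x \<in> V}"
        using V(2) f(1) by (auto intro: closed_sequentially)
    qed
    then have "closure (A.span B) \<subseteq> {x. h x \<in> V}" using sp by (rule closure_minimal[rotated])
    then have "h (xs ! k) \<in> V" using B by auto
    then show ?case by (simp add: h_def)
  qed
  moreover have "\<forall>i. d \<le> i \<and> i < d \<longrightarrow> xs ! i \<in> B" by auto
  ultimately show ?thesis using \<open>length xs = d\<close> by blast
qed

lemma prod_nth_eq_prod_list: "length xs = d \<Longrightarrow> (\<Prod>i<d. f (xs ! i)) = prod_list (map f xs)"
  for f :: "_ \<Rightarrow> 'b::comm_monoid_mult"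
  by (simp add: prod.list_conv_set_nth atLeast0LessThan)

context compact_hilbert_operator
begin

text \<open>
  The span of the eigenvectors and the kernel being dense, elementary tensors with such factors
  suffice. Those with a factor in the kernel are mapped to zero and are orthogonal to the tensors of
  eigenvectors, whose inner products factorize.
\<close>

theorem tensor_power_diagonalized:
  assumes P: "additive_hilbert_space scP ipP" and Q: "additive_hilbert_space scQ ipQ"
    and tens1: "elementary_tensors sc1 ip1 scP ipP tens1"
    and tens2: "elementary_tensors sc2 ip2 scQ ipQ tens2"
    and d: "1 \<le> d" and Td: "is_tensor_power_operator scP scQ tens1 tens2 T d Td"
    and on: "\<And>i j. i \<in> J \<Longrightarrow> j \<in> J \<Longrightarrow> ip1 (e i) (e j) = (if i = j then 1 else 0)"
    and T_e: "\<And>x j. j \<in> J \<Longrightarrow> ip2 (T x) (T (e j)) = of_real (lam j) * ip1 x (e j)"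
    and pos: "\<And>j. j \<in> J \<Longrightarrow> 0 < lam j"
    and dense: "closure (H.span (e ` J \<union> {x. T x = 0})) = UNIV"
  shows "diagonalized_operator scP ipP scQ ipQ (tensor_power scP tens1 d) Td
    {js. length js = d \<and> set js \<subseteq> J} (\<lambda>js. tens1 (map e js)) (\<lambda>js. prod_list (map lam js))
    (tens1 ` {xs. length xs = d \<and> (\<exists>x\<in>set xs. T x = 0)})"
proof -
  interpret P: additive_hilbert_space scP ipP by fact
  interpret Q: additive_hilbert_space scQ ipQ by fact
  define I where "I = {js. length js = d \<and> set js \<subseteq> J}"
  define Z where "Z = tens1 ` {xs. length xs = d \<and> (\<exists>x\<in>set xs. T x = 0)}"
  define E where "E = (\<lambda>js. tens1 (map e js))"
  have ip_tens1: "ipP (tens1 xs) (tens1 ys) = (\<Prod>i<d. ip1 (xs ! i) (ys ! i))"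
    if len: "length xs = d" "length ys = d" for xs ys
  proof -
    have "xs \<noteq> []" using len d by auto
    from ip_elementary_tensors[OF tens1 this, of ys] len show ?thesis by simp
  qed
  have ip_tens2: "ipQ (tens2 xs) (tens2 ys) = (\<Prod>i<d. ip2 (xs ! i) (ys ! i))"
    if len: "length xs = d" "length ys = d" for xs ys
  proof -
    have "xs \<noteq> []" using len d by auto
    from ip_elementary_tensors[OF tens2 this, of ys] len show ?thesis by simp
  qed
  have Td_tens: "Td (tens1 xs) = tens2 (map T xs)" if "length xs = d" for xs
    using Td that by (simp add: is_tensor_power_operator_def)
  have nth_neq: "\<exists>i<d. is ! i \<noteq> js ! i" if "is \<in> I" "js \<in> I" "is \<noteq> js" for "is" js
    using that by (auto simp: I_def list_eq_iff_nth_eq)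
  have ker_orth: "ip1 x (e j) = 0" if "T x = 0" "j \<in> J" for x j
    using T_e[OF that(2), of x] that(1) pos[OF that(2)] by (simp add: G.ip_zero_left)
  have "diagonalized_operator scP ipP scQ ipQ (tensor_power scP tens1 d) Td I E
      (\<lambda>js. prod_list (map lam js)) Z"
  proof unfold_locales
    show "tensor_power scP tens1 d = closure (P.span (E ` I \<union> Z))"
    proof
      define V where "V = closure (P.span (E ` I \<union> Z))"
      have V: "P.subspace V" "closed V"
        unfolding V_def by (rule P.subspace_closure P.subspace_span closed_closure)+
      have "tens1 xs \<in> V" if len: "length xs = d" for xs
      proof (rule elementary_tensors_dense[OF P H.additive_hilbert_space_axioms tens1 dense d V _ len])
        fix xs assume xs: "length xs = d" "set xs \<subseteq> e ` J \<union> {x. T x = 0}"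
        have "tens1 xs \<in> E ` I \<union> Z"
        proof (cases "\<exists>x\<in>set xs. T x = 0")
          case True
          then show ?thesis using xs by (auto simp: Z_def)
        next
          case False
          then have "set xs \<subseteq> e ` J" using xs by auto
          then have "xs \<in> lists (e ` J)" by (simp add: lists_eq_set)
          then obtain js where "xs = map e js" "js \<in> lists J"
            unfolding lists_image by (rule imageE)
          then have "xs = map e js" "set js \<subseteq> J" by (auto simp: lists_eq_set)
          then show ?thesis using xs by (auto simp: E_def I_def)
        qed
        then show "tens1 xs \<in> V"
          unfolding V_def by (intro subsetD[OF closure_subset] P.span_base)
      qed
      then have "P.span (tens1 ` {xs. length xs = d}) \<subseteq> V"
        by (intro P.span_minimal V(1)) auto
      then show "tensor_power scP tens1 d \<subseteq> closure (P.span (E ` I \<union> Z))"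
        unfolding tensor_power_def V_def by (rule closure_minimal) simp
      show "closure (P.span (E ` I \<union> Z)) \<subseteq> tensor_power scP tens1 d"
        unfolding tensor_power_def E_def I_def Z_def
        by (intro closure_mono P.span_mono) auto
    qed
    show "bounded_linear_on scP scQ (tensor_power scP tens1 d) Td"
      using Td by (simp add: is_tensor_power_operator_def)
    fix "is" js assume I: "is \<in> I" "js \<in> I"
    have nth: "is ! l \<in> J" "js ! l \<in> J" if "l < d" for l
      using I that by (auto simp: I_def)
    have len: "length is = d" "length js = d" using I by (auto simp: I_def)
    have E_ip: "ipP (E is) (E js) = (\<Prod>l<d. if is ! l = js ! l then 1 else 0)"
      unfolding E_def using len by (subst ip_tens1) (auto simp: on nth intro!: prod.cong)
    show "ipP (E is) (E js) = (if is = js then 1 else 0)"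
    proof (cases "is = js")
      case True
      then show ?thesis unfolding E_ip by simp
    next
      case False
      then show ?thesis unfolding E_ip using nth_neq[OF I] by (auto intro!: prod_zero)
    qed
    have TE_ip: "ipQ (Td (E is)) (Td (E js))
        = (\<Prod>l<d. if is ! l = js ! l then of_real (lam (js ! l)) else 0)"
      unfolding E_def using len by (simp add: Td_tens, subst ip_tens2)
        (auto simp: on nth T_e intro!: prod.cong)
    show "ipQ (Td (E is)) (Td (E js)) = (if is = js then of_real (prod_list (map lam is)) else 0)"
    proof (cases "is = js")
      case True
      then show ?thesis unfolding TE_ip using prod_nth_eq_prod_list[OF len(1), of lam]
        by (simp add: of_real_prod[symmetric] del: of_real_prod)
    next
      case False
      then show ?thesis unfolding TE_ip using nth_neq[OF I] by (auto intro!: prod_zero)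
    qed
  next
    fix z assume "z \<in> Z"
    then obtain xs l where xs: "z = tens1 xs" "length xs = d" "l < d" "T (xs ! l) = 0"
      unfolding Z_def by (auto simp: in_set_conv_nth)
    have "ipQ (tens2 (map T xs)) (tens2 (map T xs)) = 0"
      using xs by (subst ip_tens2) (auto simp: G.ip_zero_left intro!: prod_zero bexI[of _ l])
    then show "Td z = 0" using Q.eq_zero_if_ip_self xs by (simp add: Td_tens)
    fix js assume js: "js \<in> I"
    have "ip1 (xs ! l) (map e js ! l) = 0"
      using js xs by (auto simp: I_def intro!: ker_orth)
    then show "ipP z (E js) = 0"
      unfolding E_def xs(1) using js xs(2,3)
      by (subst ip_tens1) (auto simp: I_def intro!: prod_zero bexI[of _ l])
  qed
  then show ?thesis unfolding I_def Z_def E_def .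
qed

end

section \<open>Counting the large products of a decreasing sequence\<close>

text \<open>
  The index \<open>0\<close> is excluded because eigenvalues are numbered from \<open>1\<close>.
\<close>

definition tuples :: "(nat \<Rightarrow> real) \<Rightarrow> nat \<Rightarrow> real \<Rightarrow> nat list set" where
  "tuples \<mu> d \<eta> = {js. length js = d \<and> 0 \<notin> set js \<and> \<eta> < prod_list (map \<mu> js)}"

text \<open>
  The \<open>l\<close>-th root of \<open>\<eta>\<close> is avoided; for \<open>\<eta> = \<epsilon>\<^sup>2\<close> this is the complexity of the one-dimensional
  problem for the error \<open>\<epsilon>\<close> to the power \<open>1/l\<close>.
\<close>

definition level :: "(nat \<Rightarrow> real) \<Rightarrow> real \<Rightarrow> nat \<Rightarrow> nat" where
  "level \<mu> \<eta> l = card {j. 1 \<le> j \<and> \<eta> < \<mu> j ^ l}"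

definition non_ones :: "nat list \<Rightarrow> nat" where
  "non_ones js = length (filter (\<lambda>j. j \<noteq> 1) js)"

lemma prod_list_map_nonneg: "(\<And>x. x \<in> set xs \<Longrightarrow> 0 \<le> f x) \<Longrightarrow> 0 \<le> prod_list (map f xs)"
  for f :: "'a \<Rightarrow> real"
  by (induction xs) auto

lemma initial_segment_eq_atLeastAtMost:
  assumes "finite A" "\<And>j. j \<in> A \<Longrightarrow> 1 \<le> j" "\<And>i j. 1 \<le> i \<Longrightarrow> i \<le> j \<Longrightarrow> j \<in> A \<Longrightarrow> i \<in> A"
  shows "A = {1..card A}"
proof (cases "A = {}")
  case False
  have "A = {1..Max A}"
  proof
    show "A \<subseteq> {1..Max A}" using assms(1,2) by auto
    show "{1..Max A} \<subseteq> A" using assms(3)[OF _ _ Max_in[OF assms(1) False]] by auto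
  qed
  then show ?thesis by (metis card_atLeastAtMost diff_Suc_1 Suc_eq_plus1)
qed simp

text \<open>
  A multiset of size \<open>d\<close> with an element of multiplicity \<open>c\<close> has at most \<open>d! / c!\<close> arrangements,
  and \<open>d! / (d - K)!\<close> is at most \<open>d ^ K\<close>.
\<close>

lemma card_permutations_of_multiset_le:
  assumes "size A = d" "d - K \<le> count A x" "K \<le> d"
  shows "card (permutations_of_multiset A) \<le> d ^ K"
proof -
  have "fact (count A x) \<le> (\<Prod>y\<in>set_mset A. fact (count A y) :: nat)"
  proof (cases "x \<in># A")
    case True
    then have "fact (count A x) dvd (\<Prod>y\<in>set_mset A. fact (count A y) :: nat)"
      by (intro dvd_prodI) auto
    then show ?thesis by (rule dvd_imp_le) (auto intro!: prod_pos)
  next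
    case False
    then have "count A x = 0" by (simp add: not_in_iff)
    moreover have "1 \<le> (\<Prod>y\<in>set_mset A. fact (count A y) :: nat)"
      by (intro prod_ge_1) (rule fact_ge_1)
    ultimately show ?thesis by (simp only: fact_0)
  qed
  moreover have "fact (d - K) \<le> (fact (count A x) :: nat)" by (rule fact_mono) (rule assms)
  ultimately have "card (permutations_of_multiset A) * fact (d - K) \<le>
      card (permutations_of_multiset A) * (\<Prod>y\<in>set_mset A. fact (count A y))"
    by (intro mult_le_mono2) (rule order_trans)
  also have "\<dots> = fact d"
    using card_permutations_of_multiset_aux[of A] assms(1) by simp
  finally have "card (permutations_of_multiset A) \<le> fact d div fact (d - K)"
    by (simp add: less_eq_div_iff_mult_less_eq)
  also have "\<dots> \<le> d ^ K" by (rule fact_div_fact_le_pow[OF assms(3)])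
  finally show ?thesis .
qed

locale decreasing_sequence =
  fixes \<mu> :: "nat \<Rightarrow> real"
  assumes nonneg: "\<And>j. 1 \<le> j \<Longrightarrow> 0 \<le> \<mu> j"
    and decr: "\<And>i j. 1 \<le> i \<Longrightarrow> i \<le> j \<Longrightarrow> \<mu> j \<le> \<mu> i"
    and finite_above: "\<And>\<delta>. 0 < \<delta> \<Longrightarrow> finite {j. 1 \<le> j \<and> \<delta> < \<mu> j}"
begin

lemma finite_level:
  assumes "0 < \<eta>" "1 \<le> l"
  shows "finite {j. 1 \<le> j \<and> \<eta> < \<mu> j ^ l}"
proof (rule finite_subset)
  define \<delta> where "\<delta> = min \<eta> 1"
  show "finite {j. 1 \<le> j \<and> \<delta> < \<mu> j}" using assms by (intro finite_above) (simp add: \<delta>_def)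
  show "{j. 1 \<le> j \<and> \<eta> < \<mu> j ^ l} \<subseteq> {j. 1 \<le> j \<and> \<delta> < \<mu> j}"
  proof safe
    fix j assume j: "1 \<le> j" "\<eta> < \<mu> j ^ l"
    show "\<delta> < \<mu> j"
    proof (rule ccontr)
      assume "\<not> \<delta> < \<mu> j"
      then have "\<mu> j ^ l \<le> \<delta> ^ l" using nonneg[OF j(1)] by (intro power_mono) auto
      also have "\<dots> \<le> \<delta> ^ 1" using assms by (intro power_decreasing) (auto simp: \<delta>_def)
      finally show False using j(2) by (simp add: \<delta>_def)
    qed
  qed
qed

lemma level_set_eq:
  assumes "0 < \<eta>" "1 \<le> l"
  shows "{j. 1 \<le> j \<and> \<eta> < \<mu> j ^ l} = {1..level \<mu> \<eta> l}"
  unfolding level_def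
proof (rule initial_segment_eq_atLeastAtMost[OF finite_level[OF assms]])
  fix i j assume ij: "1 \<le> i" "i \<le> j" "j \<in> {j. 1 \<le> j \<and> \<eta> < \<mu> j ^ l}"
  have "\<mu> j ^ l \<le> \<mu> i ^ l" using ij decr nonneg by (intro power_mono) auto
  then show "i \<in> {j. 1 \<le> j \<and> \<eta> < \<mu> j ^ l}" using ij by auto
qed auto

text \<open>
  For a tuple in descending order the first \<open>l\<close> factors are the smallest ones, so the \<open>l\<close>-th entry
  \<open>j\<close> satisfies \<open>\<eta> < \<mu>\<^sub>j\<^sup>l\<close>.
\<close>

lemma nth_le_level:
  assumes "\<mu> 1 \<le> 1" "0 < \<eta>" "s \<in> tuples \<mu> d \<eta>" "sorted (rev s)" "l < d"
  shows "s ! l \<in> {1..level \<mu> \<eta> (Suc l)}"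
proof -
  have len: "length s = d" and pos: "0 \<notin> set s" and prod: "\<eta> < prod_list (map \<mu> s)"
    using assms(3) by (auto simp: tuples_def)
  have ge1: "1 \<le> s ! i" if "i < d" for i
    using pos nth_mem[of i s] that len by (metis One_nat_def Suc_leI gr0I)
  have n: "0 \<le> \<mu> (s ! i)" if "i < d" for i using nonneg ge1 that by simp
  have le1: "\<mu> (s ! i) \<le> 1" if "i < d" for i
    using decr[of 1 "s ! i"] ge1[OF that] assms(1) by simp
  have "prod_list (map \<mu> s) = (\<Prod>i<d. \<mu> (s ! i))"
    by (simp add: prod.list_conv_set_nth len atLeast0LessThan)
  also have "\<dots> = (\<Prod>i\<in>{..<d} - {..<Suc l}. \<mu> (s ! i)) * (\<Prod>i<Suc l. \<mu> (s ! i))"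
    using assms(5) by (intro prod.subset_diff) auto
  also have "\<dots> \<le> 1 * (\<Prod>i<Suc l. \<mu> (s ! i))"
    using assms(5) n le1 by (intro mult_right_mono prod_le_1 prod_nonneg) auto
  also have "(\<Prod>i<Suc l. \<mu> (s ! i)) \<le> (\<Prod>i<Suc l. \<mu> (s ! l))"
  proof (rule prod_mono)
    fix i assume i: "i \<in> {..<Suc l}"
    then have "s ! l \<le> s ! i" using assms(4,5) len by (intro sorted_rev_nth_mono) auto
    then show "0 \<le> \<mu> (s ! i) \<and> \<mu> (s ! i) \<le> \<mu> (s ! l)"
      using n decr ge1 i assms(5) by auto
  qed
  finally have "\<eta> < \<mu> (s ! l) ^ Suc l" using prod by simp
  then have "s ! l \<in> {j. 1 \<le> j \<and> \<eta> < \<mu> j ^ Suc l}" using ge1[OF assms(5)] by blast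
  then show ?thesis by (subst (asm) level_set_eq[OF assms(2)]) simp_all
qed

lemma nth_eq_one:
  assumes "0 \<notin> set s" "sorted (rev s)" "non_ones s \<le> l" "l < length s"
  shows "s ! l = 1"
proof (rule ccontr)
  assume "s ! l \<noteq> 1"
  then have "2 \<le> s ! l" using assms(1) nth_mem[OF assms(4)]
    by (metis One_nat_def Suc_1 Suc_leI gr0I le_neq_implies_less)
  then have "{..l} \<subseteq> {i. i < length s \<and> s ! i \<noteq> 1}"
    using sorted_rev_nth_mono[OF assms(2) _ assms(4)] assms(4) by fastforce
  then have "card {..l} \<le> non_ones s"
    unfolding non_ones_def length_filter_conv_card by (intro card_mono) auto
  then show False using assms(3) by simp
qed

text \<open>
  A tuple is determined by its descending rearrangement, whose first \<open>K\<close> entries lie below the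
  levels and whose remaining entries are \<open>1\<close>, and by the order of its entries, for which there
  are at most \<open>d ^ K\<close> possibilities.
\<close>

theorem card_tuples_le:
  assumes "\<mu> 1 \<le> 1" "0 < \<eta>" "K \<le> d" "\<And>js. js \<in> tuples \<mu> d \<eta> \<Longrightarrow> non_ones js \<le> K"
  shows "finite (tuples \<mu> d \<eta>)" "card (tuples \<mu> d \<eta>) \<le> d ^ K * (\<Prod>l=1..K. level \<mu> \<eta> l)"
proof -
  define D where "D = {s \<in> tuples \<mu> d \<eta>. sorted (rev s)}"
  define P where "P = (\<Pi>\<^sub>E l\<in>{..<K}. {1..level \<mu> \<eta> (Suc l)})"
  define r where "r = (\<lambda>s :: nat list. restrict (\<lambda>l. s ! l) {..<K})"
  have D: "length s = d" "0 \<notin> set s" "sorted (rev s)" "non_ones s \<le> K" "s \<in> tuples \<mu> d \<eta>" if "s \<in> D" for s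
    using that assms(4) by (auto simp: D_def tuples_def)
  have one: "s ! l = 1" if "s \<in> D" "K \<le> l" "l < d" for s l
    using D[OF that(1)] that by (intro nth_eq_one) auto
  have inj: "inj_on r D"
  proof (rule inj_onI)
    fix s s' assume s: "s \<in> D" "s' \<in> D" "r s = r s'"
    show "s = s'"
    proof (rule nth_equalityI)
      show "length s = length s'" using D s by simp
      fix l assume "l < length s"
      then have l: "l < d" using D s by simp
      show "s ! l = s' ! l"
      proof (cases "l < K")
        case True
        then show ?thesis using fun_cong[OF s(3), of l] by (simp add: r_def)
      next
        case False
        then show ?thesis using one s l by simp
      qed
    qed
  qed
  have rP: "r ` D \<subseteq> P"
  proof
    fix g assume "g \<in> r ` D"
    then obtain s where s: "s \<in> D" "g = r s" by blast
    have "s ! l \<in> {1..level \<mu> \<eta> (Suc l)}" if "l < K" for l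
      using D[OF s(1)] assms that by (intro nth_le_level[of \<eta> s d]) auto
    then show "g \<in> P" unfolding s(2) r_def P_def by (intro restrict_PiE_iff[THEN iffD2]) simp
  qed
  have finP: "finite P" unfolding P_def by (intro finite_PiE) auto
  have finD: "finite D" by (rule finite_imageD[OF finite_subset[OF rP finP] inj])
  have "card D \<le> card P" by (rule card_inj_on_le[OF inj rP finP])
  moreover have "card P = (\<Prod>l<K. level \<mu> \<eta> (Suc l))" unfolding P_def by (simp add: card_PiE)
  moreover have "(\<Prod>l<K. level \<mu> \<eta> (Suc l)) = (\<Prod>l=1..K. level \<mu> \<eta> l)"
    by (simp add: prod.atLeast1_atMost_eq)
  ultimately have cardD: "card D \<le> (\<Prod>l=1..K. level \<mu> \<eta> l)" by simp
  have sub: "tuples \<mu> d \<eta> \<subseteq> (\<Union>s\<in>D. permutations_of_multiset (mset s))"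
  proof
    fix js assume js: "js \<in> tuples \<mu> d \<eta>"
    have "mset (map \<mu> (rev (sort js))) = mset (map \<mu> js)" by simp
    then have "prod_list (map \<mu> (rev (sort js))) = prod_list (map \<mu> js)"
      by (metis prod_mset_prod_list)
    then have "rev (sort js) \<in> D" using js by (simp add: D_def tuples_def)
    moreover have "js \<in> permutations_of_multiset (mset (rev (sort js)))"
      by (simp add: permutations_of_multiset_def)
    ultimately show "js \<in> (\<Union>s\<in>D. permutations_of_multiset (mset s))" by blast
  qed
  then show "finite (tuples \<mu> d \<eta>)" by (rule finite_subset) (use finD in auto)
  have fiber: "card (permutations_of_multiset (mset s)) \<le> d ^ K" if s: "s \<in> D" for s
  proof (rule card_permutations_of_multiset_le[where x = 1])
    show "size (mset s) = d" using D[OF s] by simp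
    have "length (filter (\<lambda>j. j = 1) s) + non_ones s = d"
      unfolding non_ones_def using sum_length_filter_compl[of "\<lambda>j. j = 1" s] D[OF s] by simp
    moreover have "count (mset s) 1 = length (filter (\<lambda>j. j = 1) s)" by (induction s) auto
    ultimately show "d - K \<le> count (mset s) 1"
      using D(4)[OF s] by simp
  qed (rule assms)
  have "card (tuples \<mu> d \<eta>) \<le> card (\<Union>s\<in>D. permutations_of_multiset (mset s))"
    using sub finD by (intro card_mono) auto
  also have "\<dots> \<le> (\<Sum>s\<in>D. card (permutations_of_multiset (mset s)))"
    by (rule card_UN_le[OF finD])
  also have "\<dots> \<le> (\<Sum>s\<in>D. d ^ K)" by (intro sum_mono fiber)
  also have "\<dots> \<le> d ^ K * (\<Prod>l=1..K. level \<mu> \<eta> l)" using cardD by simp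
  finally show "card (tuples \<mu> d \<eta>) \<le> d ^ K * (\<Prod>l=1..K. level \<mu> \<eta> l)" .
qed

lemma non_ones_le_length: "js \<in> tuples \<mu> d \<eta> \<Longrightarrow> non_ones js \<le> d"
  unfolding tuples_def non_ones_def using length_filter_le by blast

corollary ln_card_tuples_le:
  assumes "\<mu> 1 \<le> 1" "0 < \<eta>" "K \<le> d" "\<And>js. js \<in> tuples \<mu> d \<eta> \<Longrightarrow> non_ones js \<le> K"
  shows "ln (real (card (tuples \<mu> d \<eta>))) \<le> real K * ln (real d) + (\<Sum>l=1..K. ln (real (level \<mu> \<eta> l)))"
proof (cases "card (tuples \<mu> d \<eta>) = 0 \<or> d = 0")
  case True
  have ln0: "0 \<le> ln (real n)" for n :: nat by (cases "n = 0") auto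
  from True show ?thesis
  proof
    assume "card (tuples \<mu> d \<eta>) = 0"
    then show ?thesis using ln0 by (simp add: sum_nonneg)
  next
    assume "d = 0"
    then have "card (tuples \<mu> d \<eta>) \<le> 1" "K = 0"
      using card_tuples_le(2)[of \<eta> K d] assms by auto
    then show ?thesis by (cases "card (tuples \<mu> d \<eta>)") auto
  qed
next
  case False
  note le = card_tuples_le(2)[OF assms]
  have pos: "0 < card (tuples \<mu> d \<eta>)" "0 < d ^ K * (\<Prod>l=1..K. level \<mu> \<eta> l)"
    using le False by linarith+
  then have ne: "level \<mu> \<eta> l \<noteq> 0" if "l \<in> {1..K}" for l using that by auto
  have "ln (real (card (tuples \<mu> d \<eta>))) \<le> ln (real (d ^ K * (\<Prod>l=1..K. level \<mu> \<eta> l)))"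
    using le pos by (subst ln_le_cancel_iff) (simp_all only: of_nat_0_less_iff of_nat_le_iff)
  also have "\<dots> = ln (real d ^ K * (\<Prod>l=1..K. real (level \<mu> \<eta> l)))" by simp
  also have "\<dots> = ln (real d ^ K) + ln (\<Prod>l=1..K. real (level \<mu> \<eta> l))"
    using False ne by (intro ln_mult_pos) (auto intro!: prod_pos)
  also have "\<dots> = real K * ln (real d) + (\<Sum>l=1..K. ln (real (level \<mu> \<eta> l)))"
    using False ne by (subst ln_prod) (auto simp: ln_realpow)
  finally show ?thesis .
qed

text \<open>
  Conversely, \<open>l\<close> coordinates range freely below the level, if the others are \<open>1\<close>.
\<close>

lemma level_power_le_card_tuples:
  assumes one: "\<mu> 1 = 1" and "0 < \<eta>" "1 \<le> l" "l \<le> d"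
  shows "level \<mu> \<eta> l ^ l \<le> card (tuples \<mu> d \<eta>)"
proof (cases "level \<mu> \<eta> l = 0")
  case False
  define n where "n = level \<mu> \<eta> l"
  define A where "A = {xs. set xs \<subseteq> {1..n} \<and> length xs = l}"
  have n: "1 \<le> n" using False by (simp add: n_def)
  then have "n \<in> {1..level \<mu> \<eta> l}" by (simp add: n_def)
  then have "n \<in> {j. 1 \<le> j \<and> \<eta> < \<mu> j ^ l}" by (subst level_set_eq[OF assms(2,3)])
  then have \<mu>n: "\<eta> < \<mu> n ^ l" by blast
  have prod_ge: "\<mu> n ^ length xs \<le> prod_list (map \<mu> xs)" if "set xs \<subseteq> {1..n}" for xs
    using that
  proof (induction xs)
    case (Cons x xs)
    then have "\<mu> n * \<mu> n ^ length xs \<le> \<mu> x * prod_list (map \<mu> xs)"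
      using decr nonneg n by (intro mult_mono) auto
    then show ?case by simp
  qed simp
  have prod_one: "prod_list (map \<mu> (replicate k 1)) = 1" for k
    using one by simp
  have "(\<lambda>xs. xs @ replicate (d - l) 1) ` A \<subseteq> tuples \<mu> d \<eta>"
  proof
    fix ys assume "ys \<in> (\<lambda>xs. xs @ replicate (d - l) 1) ` A"
    then obtain xs where xs: "xs \<in> A" "ys = xs @ replicate (d - l) 1" by blast
    have "prod_list (map \<mu> ys) = prod_list (map \<mu> xs)"
      unfolding xs(2) map_append prod_list.append prod_one by simp
    moreover have "\<mu> n ^ l \<le> prod_list (map \<mu> xs)" using prod_ge[of xs] xs(1) by (simp add: A_def)
    ultimately show "ys \<in> tuples \<mu> d \<eta>"
      using \<mu>n xs assms(4) by (auto simp: tuples_def A_def)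
  qed
  moreover have "inj_on (\<lambda>xs. xs @ replicate (d - l) 1) A" by (auto intro: inj_onI)
  moreover have "finite (tuples \<mu> d \<eta>)"
    using one assms(2) by (intro card_tuples_le(1)[of \<eta> d d] non_ones_le_length) auto
  ultimately have "card A \<le> card (tuples \<mu> d \<eta>)" by (metis card_inj_on_le)
  then show ?thesis by (simp add: A_def card_lists_length_eq n_def)
qed (use assms(3) in \<open>simp add: power_0_left\<close>)

text \<open>
  Concatenating \<open>k\<close> blocks, chosen freely among two of length \<open>b\<close>, gives exponentially many tuples.
\<close>

lemma power_two_le_card_tuples:
  assumes fin: "finite (tuples \<mu> (k * b) \<eta>)" and "\<eta> < 1"
    and A: "length A = b" "0 \<notin> set A" "1 \<le> prod_list (map \<mu> A)"
    and B: "length B = b" "0 \<notin> set B" "1 \<le> prod_list (map \<mu> B)" and "A \<noteq> B"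
  shows "2 ^ k \<le> card (tuples \<mu> (k * b) \<eta>)"
proof -
  define g where "g = (\<lambda>c. if c then A else B)"
  define h where "h = (\<lambda>cs. concat (map g cs))"
  have g: "length (g c) = b" "0 \<notin> set (g c)" "1 \<le> prod_list (map \<mu> (g c))" for c
    using A B by (auto simp: g_def)
  have "length (h cs) = length cs * b \<and> 0 \<notin> set (h cs) \<and> 1 \<le> prod_list (map \<mu> (h cs))" for cs
  proof (induction cs)
    case (Cons c cs)
    have "h (c # cs) = g c @ h cs" by (simp add: h_def)
    moreover have "1 * 1 \<le> prod_list (map \<mu> (g c)) * prod_list (map \<mu> (h cs))"
      using Cons g by (intro mult_mono') auto
    ultimately show ?case using Cons g by auto
  qed (simp add: h_def)
  then have "h ` {cs. set cs \<subseteq> UNIV \<and> length cs = k} \<subseteq> tuples \<mu> (k * b) \<eta>"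
    using assms(2) by (fastforce simp: tuples_def)
  moreover have "inj_on h {cs. set cs \<subseteq> UNIV \<and> length cs = k}"
  proof (rule inj_onI)
    fix cs cs' assume cs: "cs \<in> {cs. set cs \<subseteq> UNIV \<and> length cs = k}"
      "cs' \<in> {cs. set cs \<subseteq> UNIV \<and> length cs = k}" "h cs = h cs'"
    have "map g cs = map g cs'"
    proof (rule concat_injective)
      show "concat (map g cs) = concat (map g cs')" using cs(3) by (simp add: h_def)
      show "\<forall>(x, y)\<in>set (zip (map g cs) (map g cs')). length x = length y"
        using g(1) by (auto simp: zip_map_map)
    qed (use cs in simp)
    moreover have "inj g" using \<open>A \<noteq> B\<close> by (auto simp: g_def inj_def)
    ultimately show "cs = cs'" by (simp add: inj_map_eq_map)
  qed
  ultimately have "card {cs :: bool list. set cs \<subseteq> UNIV \<and> length cs = k} \<le> card (tuples \<mu> (k * b) \<eta>)"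
    using fin by (metis card_inj_on_le)
  then show ?thesis by (subst (asm) card_lists_length_eq) auto
qed

end

section \<open>Uniform forms of the limit\<close>

definition admissible :: "(nat \<Rightarrow> real) \<Rightarrow> real \<Rightarrow> nat \<Rightarrow> bool" where
  "admissible init \<epsilon> d \<longleftrightarrow> 0 < \<epsilon> \<and> \<epsilon> \<le> 1 \<and> 1 \<le> d \<and> \<epsilon> < init d"

definition uniformly_small :: "real \<Rightarrow> real \<Rightarrow> (nat \<Rightarrow> real) \<Rightarrow> (real \<Rightarrow> nat \<Rightarrow> real) \<Rightarrow> bool" where
  "uniformly_small s t init f \<longleftrightarrow> (\<forall>\<gamma>>0. \<exists>R. \<forall>\<epsilon> d. admissible init \<epsilon> d \<and> R \<le> 1 / \<epsilon> + real d \<longrightarrow>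
     f \<epsilon> d \<le> \<gamma> * (\<epsilon> powr (- s) + real d powr t))"

text \<open>
  A constant is absorbed by the denominator, which tends to infinity. Admitting it removes the
  lower bound for \<open>1/\<epsilon> + d\<close>, so that functions of \<open>\<epsilon>\<close> and functions of \<open>d\<close> can be estimated
  separately, each by its own part of the denominator.
\<close>

definition negligible_up_to_constant ::
  "real \<Rightarrow> real \<Rightarrow> (nat \<Rightarrow> real) \<Rightarrow> (real \<Rightarrow> nat \<Rightarrow> real) \<Rightarrow> bool" where
  "negligible_up_to_constant s t init f \<longleftrightarrow> (\<forall>\<gamma>>0. \<exists>C. \<forall>\<epsilon> d. admissible init \<epsilon> d \<longrightarrow>
     f \<epsilon> d \<le> C + \<gamma> * (\<epsilon> powr (- s) + real d powr t))"

lemma vanishes_in_limit_iff: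
  assumes init: "\<And>d. 1 \<le> d \<Longrightarrow> init d = init' d"
    and nonneg: "\<And>\<epsilon> d. admissible init' \<epsilon> d \<Longrightarrow> 0 \<le> f \<epsilon> d"
  shows "vanishes_in_limit init (\<lambda>\<epsilon> d. f \<epsilon> d / (\<epsilon> powr (- s) + real d powr t)) \<longleftrightarrow>
    uniformly_small s t init' f" (is "?L \<longleftrightarrow> ?R")
proof
  have D: "0 < \<epsilon> powr (- s) + real d powr t" if "admissible init' \<epsilon> d" for \<epsilon> d
    using that by (auto simp: admissible_def intro: add_pos_nonneg)
  {
    assume L: ?L
    show ?R
    proof (rule ccontr)
      assume "\<not> ?R"
      then obtain \<gamma> where \<gamma>: "0 < \<gamma>" and "\<forall>R. \<exists>\<epsilon> d. (admissible init' \<epsilon> d \<and> R \<le> 1 / \<epsilon> + real d) \<and>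
          \<not> f \<epsilon> d \<le> \<gamma> * (\<epsilon> powr (- s) + real d powr t)"
        unfolding uniformly_small_def by blast
      then have "\<forall>k :: nat. \<exists>\<epsilon> d. (admissible init' \<epsilon> d \<and> real k \<le> 1 / \<epsilon> + real d) \<and>
          \<not> f \<epsilon> d \<le> \<gamma> * (\<epsilon> powr (- s) + real d powr t)" by blast
      then obtain e d where ed: "\<And>k. admissible init' (e k) (d k)" "\<And>k. real k \<le> 1 / e k + real (d k)"
        "\<And>k. \<not> f (e k) (d k) \<le> \<gamma> * (e k powr (- s) + real (d k) powr t)"
        by metis
      have "filterlim (\<lambda>k. 1 / e k + real (d k)) at_top sequentially"
        by (rule filterlim_at_top_mono[OF filterlim_real_sequentially]) (use ed(2) in simp)
      moreover have "\<forall>k. 0 < e k \<and> e k \<le> 1 \<and> 1 \<le> d k \<and> e k < init (d k)"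
        using ed(1) init by (auto simp: admissible_def)
      ultimately have "(\<lambda>k. f (e k) (d k) / (e k powr (- s) + real (d k) powr t)) \<longlonglongrightarrow> 0"
        using L unfolding vanishes_in_limit_def by blast
      then have "\<forall>\<^sub>F k in sequentially. f (e k) (d k) / (e k powr (- s) + real (d k) powr t) < \<gamma>"
        using \<gamma> by (rule order_tendstoD)
      then obtain k where "f (e k) (d k) / (e k powr (- s) + real (d k) powr t) < \<gamma>"
        by (meson eventually_happens trivial_limit_sequentially)
      then show False using ed(3)[of k] D[OF ed(1)[of k]] by (simp add: divide_less_eq)
    qed
  next
    assume R: ?R
    show ?L
      unfolding vanishes_in_limit_def
    proof (intro allI impI, elim conjE)
      fix e :: "nat \<Rightarrow> real" and d :: "nat \<Rightarrow> nat"
      assume ed: "\<forall>k. 0 < e k \<and> e k \<le> 1 \<and> 1 \<le> d k \<and> e k < init (d k)"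
        and lim: "filterlim (\<lambda>k. 1 / e k + real (d k)) at_top sequentially"
      have adm: "admissible init' (e k) (d k)" for k
        using spec[OF ed, of k] init[of "d k"] by (simp add: admissible_def)
      show "(\<lambda>k. f (e k) (d k) / (e k powr (- s) + real (d k) powr t)) \<longlonglongrightarrow> 0"
      proof (rule order_tendstoI)
        fix a :: real assume "a < 0"
        then show "\<forall>\<^sub>F k in sequentially. a < f (e k) (d k) / (e k powr (- s) + real (d k) powr t)"
          using nonneg[OF adm] D[OF adm]
          by (intro always_eventually allI less_le_trans[OF _ divide_nonneg_pos]) auto
      next
        fix a :: real assume a: "0 < a"
        then obtain R where R': "\<And>\<epsilon> d. admissible init' \<epsilon> d \<Longrightarrow> R \<le> 1 / \<epsilon> + real d \<Longrightarrow>
            f \<epsilon> d \<le> a / 2 * (\<epsilon> powr (- s) + real d powr t)"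
          using R unfolding uniformly_small_def by (meson half_gt_zero)
        have "\<forall>\<^sub>F k in sequentially. R \<le> 1 / e k + real (d k)"
          using lim by (simp add: filterlim_at_top)
        then show "\<forall>\<^sub>F k in sequentially. f (e k) (d k) / (e k powr (- s) + real (d k) powr t) < a"
        proof eventually_elim
          case (elim k)
          have "f (e k) (d k) \<le> a / 2 * (e k powr (- s) + real (d k) powr t)"
            using R'[OF adm elim] .
          also have "\<dots> < a * (e k powr (- s) + real (d k) powr t)"
            using a D[OF adm] by (intro mult_strict_right_mono) auto
          finally show ?case using D[OF adm] by (simp add: divide_less_eq)
        qed
      qed
    qed
  }
qed

lemma uniformly_smallD:
  assumes "uniformly_small s t init f" "0 < \<gamma>"
  shows "\<exists>R. \<forall>\<epsilon> d. admissible init \<epsilon> d \<and> R \<le> 1 / \<epsilon> + real d \<longrightarrow>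
    f \<epsilon> d \<le> \<gamma> * (\<epsilon> powr (- s) + real d powr t)"
  using assms unfolding uniformly_small_def by blast

lemma uniformly_small_mono:
  assumes "uniformly_small s t init g" "\<And>\<epsilon> d. admissible init \<epsilon> d \<Longrightarrow> f \<epsilon> d \<le> g \<epsilon> d"
  shows "uniformly_small s t init f"
  using assms unfolding uniformly_small_def by (meson order_trans)

lemma negligibleD:
  assumes "negligible_up_to_constant s t init f" "0 < \<gamma>"
  shows "\<exists>C. \<forall>\<epsilon> d. admissible init \<epsilon> d \<longrightarrow> f \<epsilon> d \<le> C + \<gamma> * (\<epsilon> powr (- s) + real d powr t)"
  using assms unfolding negligible_up_to_constant_def by blast

lemma negligible_mono:
  assumes "negligible_up_to_constant s t init g" "\<And>\<epsilon> d. admissible init \<epsilon> d \<Longrightarrow> f \<epsilon> d \<le> g \<epsilon> d"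
  shows "negligible_up_to_constant s t init f"
  using assms unfolding negligible_up_to_constant_def by (meson order_trans)

lemma negligible_add:
  assumes "negligible_up_to_constant s t init f" "negligible_up_to_constant s t init g"
  shows "negligible_up_to_constant s t init (\<lambda>\<epsilon> d. f \<epsilon> d + g \<epsilon> d)"
  unfolding negligible_up_to_constant_def
proof (intro allI impI)
  fix \<gamma> :: real assume "0 < \<gamma>"
  then have "0 < \<gamma> / 2" by simp
  obtain C where C: "\<And>\<epsilon> d. admissible init \<epsilon> d \<Longrightarrow> f \<epsilon> d \<le> C + \<gamma> / 2 * (\<epsilon> powr (- s) + real d powr t)"
    using negligibleD[OF assms(1) \<open>0 < \<gamma> / 2\<close>] by blast
  obtain C' where C': "\<And>\<epsilon> d. admissible init \<epsilon> d \<Longrightarrow> g \<epsilon> d \<le> C' + \<gamma> / 2 * (\<epsilon> powr (- s) + real d powr t)"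
    using negligibleD[OF assms(2) \<open>0 < \<gamma> / 2\<close>] by blast
  show "\<exists>C. \<forall>\<epsilon> d. admissible init \<epsilon> d \<longrightarrow>
      f \<epsilon> d + g \<epsilon> d \<le> C + \<gamma> * (\<epsilon> powr (- s) + real d powr t)"
  proof (intro exI[of _ "C + C'"] allI impI)
    fix \<epsilon> d assume a: "admissible init \<epsilon> d"
    show "f \<epsilon> d + g \<epsilon> d \<le> C + C' + \<gamma> * (\<epsilon> powr (- s) + real d powr t)"
      using C[OF a] C'[OF a] by (simp add: field_simps)
  qed
qed

lemma negligible_cmult:
  assumes "negligible_up_to_constant s t init f" "0 \<le> c"
  shows "negligible_up_to_constant s t init (\<lambda>\<epsilon> d. c * f \<epsilon> d)"
proof (cases "c = 0")
  case True
  then show ?thesis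
    unfolding negligible_up_to_constant_def by (auto intro!: exI[of _ 0])
next
  case False
  then have c: "0 < c" using assms by simp
  show ?thesis
    unfolding negligible_up_to_constant_def
  proof (intro allI impI)
    fix \<gamma> :: real assume "0 < \<gamma>"
    then have "0 < \<gamma> / c" using c by simp
    obtain C where C: "\<And>\<epsilon> d. admissible init \<epsilon> d \<Longrightarrow> f \<epsilon> d \<le> C + \<gamma> / c * (\<epsilon> powr (- s) + real d powr t)"
      using negligibleD[OF assms(1) \<open>0 < \<gamma> / c\<close>] by blast
    show "\<exists>C. \<forall>\<epsilon> d. admissible init \<epsilon> d \<longrightarrow>
        c * f \<epsilon> d \<le> C + \<gamma> * (\<epsilon> powr (- s) + real d powr t)"
    proof (intro exI[of _ "c * C"] allI impI)
      fix \<epsilon> d assume a: "admissible init \<epsilon> d"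
      have "c * f \<epsilon> d \<le> c * (C + \<gamma> / c * (\<epsilon> powr (- s) + real d powr t))"
        using c by (intro mult_left_mono C a) auto
      then show "c * f \<epsilon> d \<le> c * C + \<gamma> * (\<epsilon> powr (- s) + real d powr t)"
        using c by (simp add: distrib_left)
    qed
  qed
qed

lemma negligible_imp_uniformly_small:
  assumes s: "0 < s" and t: "0 < t" and f: "negligible_up_to_constant s t init f"
  shows "uniformly_small s t init f"
  unfolding uniformly_small_def
proof (intro allI impI)
  fix \<gamma> :: real assume \<gamma>: "0 < \<gamma>"
  then have "0 < \<gamma> / 2" by simp
  obtain C where C: "\<And>\<epsilon> d. admissible init \<epsilon> d \<Longrightarrow> f \<epsilon> d \<le> C + \<gamma> / 2 * (\<epsilon> powr (- s) + real d powr t)"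
    using negligibleD[OF f \<open>0 < \<gamma> / 2\<close>] by blast
  define q where "q = 2 * \<bar>C\<bar> / \<gamma> + 1"
  have q: "0 < q" using \<gamma> by (simp add: q_def add_nonneg_pos)
  define x where "x = max (q powr (1 / s)) (q powr (1 / t))"
  show "\<exists>R. \<forall>\<epsilon> d. admissible init \<epsilon> d \<and> R \<le> 1 / \<epsilon> + real d \<longrightarrow>
      f \<epsilon> d \<le> \<gamma> * (\<epsilon> powr (- s) + real d powr t)"
  proof (intro exI[of _ "2 * x"] allI impI, elim conjE)
    fix \<epsilon> d assume a: "admissible init \<epsilon> d" and R: "2 * x \<le> 1 / \<epsilon> + real d"
    then have \<epsilon>: "0 < \<epsilon>" by (simp add: admissible_def)
    have "x \<le> 1 / \<epsilon> \<or> x \<le> real d" using R by linarith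
    then have "q \<le> \<epsilon> powr (- s) + real d powr t"
    proof
      assume "x \<le> 1 / \<epsilon>"
      then have "q powr (1 / s) \<le> 1 / \<epsilon>" by (simp add: x_def)
      then have "(q powr (1 / s)) powr s \<le> (1 / \<epsilon>) powr s" using s by (intro powr_mono2) auto
      then have "q \<le> \<epsilon> powr (- s)" using q s \<epsilon> by (simp add: powr_powr powr_minus_divide powr_divide)
      then show ?thesis by (simp add: add_increasing2)
    next
      assume "x \<le> real d"
      then have "q powr (1 / t) \<le> real d" by (simp add: x_def)
      then have "(q powr (1 / t)) powr t \<le> real d powr t" using t by (intro powr_mono2) auto
      then have "q \<le> real d powr t" using q t by (simp add: powr_powr)
      then show ?thesis by (simp add: add_increasing)
    qed
    then have "2 * \<bar>C\<bar> / \<gamma> \<le> \<epsilon> powr (- s) + real d powr t" by (simp add: q_def)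
    then have "C \<le> \<gamma> / 2 * (\<epsilon> powr (- s) + real d powr t)"
      using \<gamma> by (simp add: field_simps)
    then show "f \<epsilon> d \<le> \<gamma> * (\<epsilon> powr (- s) + real d powr t)"
      using C[OF a] by (simp add: field_simps)
  qed
qed

lemma bound_from_eventual_bound:
  fixes f g :: "real \<Rightarrow> real"
  assumes "\<forall>\<^sub>F x in at_top. f x \<le> \<gamma> * g x" "0 < \<gamma>" "\<And>x. 1 \<le> x \<Longrightarrow> 0 \<le> g x"
    and mono: "\<And>x y. 1 \<le> x \<Longrightarrow> x \<le> y \<Longrightarrow> f x \<le> f y"
  shows "\<exists>C. \<forall>x\<ge>1. f x \<le> C + \<gamma> * g x"
proof -
  obtain x0 where x0: "\<And>x. x0 \<le> x \<Longrightarrow> f x \<le> \<gamma> * g x"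
    using assms(1) unfolding eventually_at_top_linorder by blast
  have "f x \<le> \<bar>f (max 1 x0)\<bar> + \<gamma> * g x" if x: "1 \<le> x" for x
  proof (cases "x0 \<le> x")
    case True
    then show ?thesis using x0[OF True] by linarith
  next
    case False
    then have "f x \<le> f (max 1 x0)" using x by (intro mono) auto
    moreover have "0 \<le> \<gamma> * g x" using assms(2) assms(3)[OF x] by simp
    ultimately show ?thesis by linarith
  qed
  then show ?thesis by blast
qed

lemma negligible_inverse_\<epsilon>:
  assumes "\<And>\<gamma>. 0 < \<gamma> \<Longrightarrow> \<exists>C. \<forall>x\<ge>1. f x \<le> C + \<gamma> * x powr s"
  shows "negligible_up_to_constant s t init (\<lambda>\<epsilon> d. f (1 / \<epsilon>))"
  unfolding negligible_up_to_constant_def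
proof (intro allI impI)
  fix \<gamma> :: real assume \<gamma>: "0 < \<gamma>"
  obtain C where C: "\<And>x. 1 \<le> x \<Longrightarrow> f x \<le> C + \<gamma> * x powr s" using assms[OF \<gamma>] by blast
  show "\<exists>C. \<forall>\<epsilon> d. admissible init \<epsilon> d \<longrightarrow> f (1 / \<epsilon>) \<le> C + \<gamma> * (\<epsilon> powr (- s) + real d powr t)"
  proof (intro exI[of _ C] allI impI)
    fix \<epsilon> d assume a: "admissible init \<epsilon> d"
    then have \<epsilon>: "0 < \<epsilon>" "\<epsilon> \<le> 1" by (simp_all add: admissible_def)
    then have "f (1 / \<epsilon>) \<le> C + \<gamma> * (1 / \<epsilon>) powr s" by (intro C) simp
    also have "(1 / \<epsilon>) powr s = \<epsilon> powr (- s)" using \<epsilon> by (simp add: powr_divide powr_minus_divide)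
    finally have "f (1 / \<epsilon>) \<le> C + \<gamma> * \<epsilon> powr (- s)" .
    moreover have "0 \<le> \<gamma> * real d powr t" using \<gamma> by simp
    ultimately show "f (1 / \<epsilon>) \<le> C + \<gamma> * (\<epsilon> powr (- s) + real d powr t)"
      unfolding distrib_left by linarith
  qed
qed

lemma negligible_dimension:
  assumes "\<And>\<gamma>. 0 < \<gamma> \<Longrightarrow> \<exists>C. \<forall>x\<ge>1. f x \<le> C + \<gamma> * x powr t"
  shows "negligible_up_to_constant s t init (\<lambda>\<epsilon> d. f (real d))"
  unfolding negligible_up_to_constant_def
proof (intro allI impI)
  fix \<gamma> :: real assume \<gamma>: "0 < \<gamma>"
  obtain C where C: "\<And>x. 1 \<le> x \<Longrightarrow> f x \<le> C + \<gamma> * x powr t" using assms[OF \<gamma>] by blast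
  show "\<exists>C. \<forall>\<epsilon> d. admissible init \<epsilon> d \<longrightarrow> f (real d) \<le> C + \<gamma> * (\<epsilon> powr (- s) + real d powr t)"
  proof (intro exI[of _ C] allI impI)
    fix \<epsilon> d assume a: "admissible init \<epsilon> d"
    then have "f (real d) \<le> C + \<gamma> * real d powr t" by (intro C) (simp add: admissible_def)
    moreover have "0 \<le> \<gamma> * \<epsilon> powr (- s)" using \<gamma> by simp
    ultimately show "f (real d) \<le> C + \<gamma> * (\<epsilon> powr (- s) + real d powr t)"
      unfolding distrib_left by linarith
  qed
qed

lemma ln_squared_bound:
  assumes "0 < r" "0 < \<gamma>"
  shows "\<exists>C. \<forall>x::real\<ge>1. (ln x)\<^sup>2 \<le> C + \<gamma> * x powr r"
proof (rule bound_from_eventual_bound)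
  show "\<forall>\<^sub>F x::real in at_top. (ln x)\<^sup>2 \<le> \<gamma> * x powr r" using assms by real_asymp
qed (use assms in \<open>auto intro!: power_mono\<close>)

lemma negligible_ln_squared_inverse_\<epsilon>:
  "0 < s \<Longrightarrow> negligible_up_to_constant s t init (\<lambda>\<epsilon> d. (ln (1 / \<epsilon>))\<^sup>2)"
  by (rule negligible_inverse_\<epsilon>) (rule ln_squared_bound)

lemma negligible_ln_squared_dimension:
  "0 < t \<Longrightarrow> negligible_up_to_constant s t init (\<lambda>\<epsilon> d. (ln (real d))\<^sup>2)"
  by (rule negligible_dimension) (rule ln_squared_bound)

lemma negligible_constant: "negligible_up_to_constant s t init (\<lambda>\<epsilon> d. c)"
  unfolding negligible_up_to_constant_def by (intro allI impI exI[of _ c]) simp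

lemma negligible_ln_inverse_\<epsilon>:
  assumes "0 < s"
  shows "negligible_up_to_constant s t init (\<lambda>\<epsilon> d. ln (1 / \<epsilon>))"
proof (rule negligible_mono[OF negligible_add[OF negligible_constant[of _ _ _ 1]
        negligible_ln_squared_inverse_\<epsilon>[OF assms]]])
  have "x \<le> 1 + x\<^sup>2" for x :: real
    using zero_le_power2[of "x - 1/2"] by (simp add: power2_eq_square algebra_simps)
  then show "ln (1 / \<epsilon>) \<le> 1 + (ln (1 / \<epsilon>))\<^sup>2" for \<epsilon> :: real .
qed

lemma negligible_ln_inverse_\<epsilon>_ln_dimension:
  assumes "0 < s" "0 < t"
  shows "negligible_up_to_constant s t init (\<lambda>\<epsilon> d. ln (1 / \<epsilon>) * ln (real d))"
proof (rule negligible_mono[OF negligible_add[OF negligible_ln_squared_inverse_\<epsilon>[OF assms(1)]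
        negligible_ln_squared_dimension[OF assms(2)]]])
  have "x * y \<le> x\<^sup>2 + y\<^sup>2" for x y :: real
    using zero_le_power2[of "x - y"] zero_le_power2[of "x + y"]
    by (simp add: power2_eq_square algebra_simps)
  then show "ln (1 / \<epsilon>) * ln (real d) \<le> (ln (1 / \<epsilon>))\<^sup>2 + (ln (real d))\<^sup>2" for \<epsilon> d .
qed

lemma negligible_dimension_ln_dimension:
  assumes "1 < t"
  shows "negligible_up_to_constant s t init (\<lambda>\<epsilon> d. real d * ln (real d))"
proof (rule negligible_dimension[where f = "\<lambda>x. x * ln x"], rule bound_from_eventual_bound)
  fix \<gamma> :: real assume "0 < \<gamma>"
  then show "\<forall>\<^sub>F x in at_top. x * ln x \<le> \<gamma> * x powr t" using assms by real_asymp
qed (auto intro!: mult_mono)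

lemma negligible_dimension_if_t_gt_1:
  assumes "1 < t"
  shows "negligible_up_to_constant s t init (\<lambda>\<epsilon> d. real d)"
proof (rule negligible_dimension[where f = "\<lambda>x. x"], rule bound_from_eventual_bound)
  fix \<gamma> :: real assume "0 < \<gamma>"
  then show "\<forall>\<^sub>F x in at_top. x \<le> \<gamma> * x powr t" using assms by real_asymp
qed auto

section \<open>Tractability in terms of the eigenvalues\<close>

lemma power_less_iff_root_less:
  fixes x \<epsilon> :: real
  assumes "0 \<le> x" "0 < \<epsilon>" "1 \<le> l"
  shows "\<epsilon>\<^sup>2 < x ^ l \<longleftrightarrow> (\<epsilon> powr (1 / real l))\<^sup>2 < x"
proof -
  define y where "y = (\<epsilon> powr (1 / real l))\<^sup>2"
  have "y ^ l = (\<epsilon> powr (1 / real l)) ^ (l * 2)"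
    unfolding y_def power_mult[symmetric] by (simp add: mult.commute)
  also have "\<dots> = ((\<epsilon> powr (1 / real l)) ^ l)\<^sup>2" by (rule power_mult)
  also have "(\<epsilon> powr (1 / real l)) ^ l = \<epsilon>"
    using assms by (simp add: powr_power)
  finally have "y ^ l = \<epsilon>\<^sup>2" .
  moreover have "y ^ l < x ^ l \<longleftrightarrow> y < x"
  proof
    assume "y < x"
    then show "y ^ l < x ^ l" using assms(3) by (intro power_strict_mono) (simp_all add: y_def)
  qed (rule power_less_imp_less_base[OF _ assms(1)])
  ultimately show ?thesis by (simp add: y_def)
qed

lemma ln_of_nat_nonneg: "0 \<le> ln (real n)"
  by (cases "n = 0") auto

text \<open>
  With \<open>u = ln (1/\<epsilon>)\<close> the \<open>l\<close>-th term is \<open>exp (s u / l)\<close>. The first one is the main term, the at most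
  \<open>u\<close> terms with \<open>2 \<le> l < u\<close> are at most its square root, and the terms with \<open>l \<ge> u\<close> are at
  most \<open>exp s\<close>. Estimating the latter separately matters for \<open>K = d\<close> and \<open>1 < t < 2\<close>, where \<open>d\<close>
  times the square root of the main term would be too large.
\<close>

lemma sum_powr_inverse_le:
  assumes "0 < \<epsilon>" "\<epsilon> \<le> 1" "0 < s"
  shows "(\<Sum>l=1..K. (\<epsilon> powr (1 / real l)) powr (- s)) \<le> (1 + 2 / s) * \<epsilon> powr (- s) + real K * exp s"
proof -
  define u where "u = ln (1 / \<epsilon>)"
  have u: "0 \<le> u" using assms by (simp add: u_def)
  have e: "(\<epsilon> powr (1 / real l)) powr (- s) = exp (s * u / real l)" for l
    using assms(1) by (simp add: powr_powr powr_def u_def ln_div)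
  have E: "\<epsilon> powr (- s) = exp (s * u)"
    using assms(1) by (simp add: powr_def u_def ln_div)
  have term_le: "exp (s * u / real l) \<le>
      (if l = 1 then exp (s * u) else 0) + (if real l < u then exp (s * u / 2) else 0) + exp s"
    if l: "1 \<le> l" for l
  proof -
    consider "l = 1" | "2 \<le> l" "real l < u" | "2 \<le> l" "u \<le> real l" using l by linarith
    then show ?thesis
    proof cases
      case 2
      have "s * u / real l \<le> s * u / 2" using 2 assms u by (intro divide_left_mono) auto
      then have "exp (s * u / real l) \<le> exp (s * u / 2)" by simp
      then show ?thesis using 2 by (simp add: add_increasing2)
    next
      case 3
      have "s * u / real l \<le> s" using 3 assms u by (simp add: divide_le_eq mult_left_mono)
      then have "exp (s * u / real l) \<le> exp s" by simp
      then show ?thesis using 3 by (simp add: add_increasing)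
    qed simp
  qed
  have "(\<Sum>l=1..K. (\<epsilon> powr (1 / real l)) powr (- s)) \<le> (\<Sum>l=1..K.
      (if l = 1 then exp (s * u) else 0) + (if real l < u then exp (s * u / 2) else 0) + exp s)"
    unfolding e by (intro sum_mono term_le) simp
  also have "\<dots> = (\<Sum>l=1..K. if l = 1 then exp (s * u) else 0)
      + (\<Sum>l=1..K. if real l < u then exp (s * u / 2) else 0) + real K * exp s"
    by (simp add: sum.distrib)
  also have "(\<Sum>l=1..K. if l = 1 then exp (s * u) else 0) \<le> exp (s * u)"
    by (simp add: sum.delta)
  also have "(\<Sum>l=1..K. if real l < u then exp (s * u / 2) else 0) \<le> 2 / s * exp (s * u)"
  proof -
    have "{l \<in> {1..K}. real l < u} \<subseteq> {1..nat \<lfloor>u\<rfloor>}" using u by (auto simp: le_nat_floor)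
    then have "card {l \<in> {1..K}. real l < u} \<le> nat \<lfloor>u\<rfloor>"
      using card_mono[of "{1..nat \<lfloor>u\<rfloor>}"] by fastforce
    then have c: "real (card {l \<in> {1..K}. real l < u}) \<le> u" using u by linarith
    have "(\<Sum>l=1..K. if real l < u then exp (s * u / 2) else 0)
        = real (card {l \<in> {1..K}. real l < u}) * exp (s * u / 2)"
      by (subst sum.inter_filter[symmetric]) auto
    also have "\<dots> \<le> u * exp (s * u / 2)" using c by (intro mult_right_mono) auto
    also have "u * exp (s * u / 2) \<le> 2 / s * exp (s * u / 2) * exp (s * u / 2)"
    proof (rule mult_right_mono)
      have "s * u / 2 \<le> exp (s * u / 2)" using exp_ge_add_one_self[of "s * u / 2"] by linarith
      then show "u \<le> 2 / s * exp (s * u / 2)" using assms(3) by (simp add: field_simps)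
    qed simp
    also have "\<dots> = 2 / s * exp (s * u)" by (simp add: exp_add[symmetric])
    finally show ?thesis .
  qed
  finally show ?thesis unfolding E by (simp add: algebra_simps)
qed

lemma sum_inverse_le_ln: "1 \<le> d \<Longrightarrow> (\<Sum>l=1..d. 1 / real l) \<le> 1 + ln (real d)"
proof (induction d rule: nat_induct_at_least)
  case (Suc d)
  have "ln (real d / real (Suc d)) \<le> real d / real (Suc d) - 1"
    using Suc by (intro ln_le_minus_one) simp
  also have "\<dots> = - (1 / real (Suc d))" by (simp add: field_simps)
  finally have "1 / real (Suc d) \<le> ln (real (Suc d)) - ln (real d)"
    using Suc by (simp add: ln_div)
  then show ?case using Suc by simp
qed simp

lemma tuples_scale:
  assumes "0 < c"
  shows "tuples (\<lambda>j. \<mu> j / c) d (\<eta> / c ^ d) = tuples \<mu> d \<eta>"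
proof -
  have "prod_list (map (\<lambda>j. \<mu> j / c) js) = prod_list (map \<mu> js) / c ^ length js" for js
    by (induction js) auto
  then show ?thesis using assms by (auto simp: tuples_def divide_less_cancel)
qed

context decreasing_sequence
begin

definition log_count :: "real \<Rightarrow> nat \<Rightarrow> real" where
  "log_count \<epsilon> d = ln (real (card (tuples \<mu> d (\<epsilon>\<^sup>2))))"

lemma log_count_nonneg: "0 \<le> log_count \<epsilon> d"
  unfolding log_count_def by (rule ln_of_nat_nonneg)

lemma level_root: "0 < \<epsilon> \<Longrightarrow> 1 \<le> l \<Longrightarrow> level \<mu> (\<epsilon>\<^sup>2) l = level \<mu> ((\<epsilon> powr (1 / real l))\<^sup>2) 1"
  unfolding level_def
  by (rule arg_cong[where f = card]) (auto simp: power_less_iff_root_less nonneg)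

lemma card_tuples_1: "card (tuples \<mu> 1 \<eta>) = level \<mu> \<eta> 1"
proof -
  have "tuples \<mu> 1 \<eta> = (\<lambda>j. [j]) ` {j. 1 \<le> j \<and> \<eta> < \<mu> j ^ 1}"
    by (auto simp: tuples_def length_Suc_conv)
  then show ?thesis unfolding level_def by (simp add: card_image inj_on_def)
qed

lemma normalized: "0 < \<mu> 1 \<Longrightarrow> decreasing_sequence (\<lambda>j. \<mu> j / \<mu> 1)"
proof (unfold_locales, goal_cases)
  case (3 \<delta>)
  then have "finite {j. 1 \<le> j \<and> \<delta> * \<mu> 1 < \<mu> j}" by (intro finite_above) simp
  then show ?case using 3 by (simp add: less_divide_eq)
qed (simp_all add: nonneg decr divide_right_mono)

lemma finite_tuples:
  assumes "0 < \<mu> 1" "0 < \<eta>"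
  shows "finite (tuples \<mu> d \<eta>)"
proof -
  interpret N: decreasing_sequence "\<lambda>j. \<mu> j / \<mu> 1" by (rule normalized) fact
  have "finite (tuples (\<lambda>j. \<mu> j / \<mu> 1) d (\<eta> / \<mu> 1 ^ d))"
    using assms by (intro N.card_tuples_le(1)[of _ d d] N.non_ones_le_length) auto
  then show ?thesis unfolding tuples_scale[OF assms(1)] .
qed

text \<open>
  The decay of the eigenvalues is a bound of the counting function: solve \<open>\<epsilon>\<^sup>2 < \<mu>\<^sub>n\<close> for \<open>n\<close>.
\<close>

lemma ln_level_le_if_decay:
  assumes s: "0 < s" and decay: "(\<lambda>n. \<mu> n / ln (real n) powr (- 2 / s)) \<longlonglongrightarrow> 0" and \<gamma>: "0 < \<gamma>"
  shows "\<exists>C\<ge>0. \<forall>\<epsilon>>0. ln (real (level \<mu> (\<epsilon>\<^sup>2) 1)) \<le> C + \<gamma> * \<epsilon> powr (- s)"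
proof -
  define \<delta> where "\<delta> = \<gamma> powr (2 / s)"
  have "0 < \<delta>" using \<gamma> by (simp add: \<delta>_def)
  then have "\<forall>\<^sub>F n in sequentially. \<mu> n / ln (real n) powr (- 2 / s) < \<delta>"
    using decay by (rule order_tendstoD(2)[rotated])
  then obtain n0 where n0: "\<And>n. n0 \<le> n \<Longrightarrow> \<mu> n / ln (real n) powr (- 2 / s) < \<delta>"
    unfolding eventually_sequentially by blast
  define N where "N = max n0 3"
  have "ln (real (level \<mu> (\<epsilon>\<^sup>2) 1)) \<le> ln (real N) + \<gamma> * \<epsilon> powr (- s)" if \<epsilon>: "0 < \<epsilon>" for \<epsilon>
  proof (cases "level \<mu> (\<epsilon>\<^sup>2) 1 < N")
    case True
    have "ln (real (level \<mu> (\<epsilon>\<^sup>2) 1)) \<le> ln (real N)"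
      using True by (cases "level \<mu> (\<epsilon>\<^sup>2) 1 = 0") (auto simp: N_def)
    then show ?thesis using \<gamma> by (simp add: add_increasing2)
  next
    case False
    define n where "n = level \<mu> (\<epsilon>\<^sup>2) 1"
    have n: "N \<le> n" "n0 \<le> n" "3 \<le> n" using False by (auto simp: n_def N_def)
    define x where "x = ln (real n)"
    have x: "0 < x" using n by (simp add: x_def)
    have "n \<in> {1..level \<mu> (\<epsilon>\<^sup>2) 1}" using n by (simp add: n_def)
    then have "n \<in> {j. 1 \<le> j \<and> \<epsilon>\<^sup>2 < \<mu> j ^ 1}" by (subst level_set_eq) (use \<epsilon> in auto)
    then have "\<epsilon>\<^sup>2 < \<mu> n" by simp
    also have "\<mu> n < \<delta> * x powr (- 2 / s)"
      using n0[OF n(2)] x by (simp add: x_def divide_less_eq)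
    finally have "x powr (2 / s) \<le> \<delta> / \<epsilon>\<^sup>2"
      using x \<epsilon> by (simp add: powr_minus_divide field_simps)
    then have "(x powr (2 / s)) powr (s / 2) \<le> (\<delta> / \<epsilon>\<^sup>2) powr (s / 2)"
      using s by (intro powr_mono2) auto
    moreover have "(x powr (2 / s)) powr (s / 2) = x" using s x by (simp add: powr_powr)
    moreover have "(\<delta> / \<epsilon>\<^sup>2) powr (s / 2) = \<gamma> * \<epsilon> powr (- s)"
    proof -
      have "\<epsilon>\<^sup>2 = \<epsilon> powr 2" using \<epsilon> by simp
      then show ?thesis
        using s \<gamma> \<epsilon> by (simp add: \<delta>_def powr_divide powr_powr powr_minus_divide del: powr_numeral)
    qed
    ultimately have "x \<le> \<gamma> * \<epsilon> powr (- s)" by simp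
    moreover have "0 \<le> ln (real N)" by (rule ln_of_nat_nonneg)
    ultimately show ?thesis by (simp add: x_def n_def)
  qed
  then show ?thesis using ln_of_nat_nonneg by blast
qed

lemma eventually_less: assumes "0 < \<delta>" shows "\<forall>\<^sub>F n in sequentially. \<mu> n < \<delta>"
proof -
  obtain N where N: "\<forall>j\<in>{j. 1 \<le> j \<and> \<delta> / 2 < \<mu> j}. j < N"
    using finite_above[of "\<delta> / 2"] assms unfolding finite_nat_set_iff_bounded by auto
  have "\<mu> n < \<delta>" if n: "max 1 N \<le> n" for n
  proof (rule ccontr)
    assume "\<not> \<mu> n < \<delta>"
    then have "\<delta> / 2 < \<mu> n" using assms by simp
    then show False using N n by auto
  qed
  then show ?thesis unfolding eventually_sequentially by blast
qed

lemma decay_if_ln_level_le: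
  assumes s: "0 < s"
    and bound: "\<And>\<gamma>. 0 < \<gamma> \<Longrightarrow> \<exists>\<epsilon>0>0. \<forall>\<epsilon>. 0 < \<epsilon> \<and> \<epsilon> < \<epsilon>0 \<longrightarrow> ln (real (level \<mu> (\<epsilon>\<^sup>2) 1)) \<le> \<gamma> * \<epsilon> powr (- s)"
  shows "(\<lambda>n. \<mu> n / ln (real n) powr (- 2 / s)) \<longlonglongrightarrow> 0"
proof (rule order_tendstoI)
  fix a :: real assume a: "a < 0"
  have "a < \<mu> n / ln (real n) powr (- 2 / s)" if "1 \<le> n" for n
    using nonneg[OF that] by (intro less_le_trans[OF a] divide_nonneg_nonneg) auto
  then show "\<forall>\<^sub>F n in sequentially. a < \<mu> n / ln (real n) powr (- 2 / s)"
    unfolding eventually_sequentially by blast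
next
  fix r :: real assume r: "0 < r"
  define \<gamma> where "\<gamma> = (r / 4) powr (s / 2)"
  have "0 < \<gamma>" using r by (simp add: \<gamma>_def)
  then obtain \<epsilon>0 where \<epsilon>0: "0 < \<epsilon>0"
    "\<And>\<epsilon>. 0 < \<epsilon> \<Longrightarrow> \<epsilon> < \<epsilon>0 \<Longrightarrow> ln (real (level \<mu> (\<epsilon>\<^sup>2) 1)) \<le> \<gamma> * \<epsilon> powr (- s)"
    using bound by blast
  have "\<forall>\<^sub>F n in sequentially. \<mu> n < \<epsilon>0\<^sup>2" using \<epsilon>0(1) by (intro eventually_less) simp
  moreover have "\<forall>\<^sub>F n in sequentially. 3 \<le> n" by (rule eventually_ge_at_top)
  ultimately show "\<forall>\<^sub>F n in sequentially. \<mu> n / ln (real n) powr (- 2 / s) < r"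
  proof eventually_elim
    case (elim n)
    define x where "x = ln (real n)"
    have x: "0 < x" using elim by (simp add: x_def)
    show ?case
    proof (cases "\<mu> n = 0")
      case False
      then have \<mu>n: "0 < \<mu> n" using nonneg[of n] elim by linarith
      define \<epsilon> where "\<epsilon> = sqrt (\<mu> n / 2)"
      have \<epsilon>: "0 < \<epsilon>" "\<epsilon>\<^sup>2 = \<mu> n / 2" using \<mu>n by (simp_all add: \<epsilon>_def)
      have "\<epsilon>\<^sup>2 < \<epsilon>0\<^sup>2" using \<epsilon>(2) \<mu>n elim by linarith
      then have "\<epsilon> < \<epsilon>0" using \<epsilon>0(1) by (simp add: power_less_imp_less_base)
      have "n \<in> {j. 1 \<le> j \<and> \<epsilon>\<^sup>2 < \<mu> j ^ 1}" using \<epsilon>(2) \<mu>n elim by simp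
      then have "n \<in> {1..level \<mu> (\<epsilon>\<^sup>2) 1}" by (subst (asm) level_set_eq) (use \<epsilon>(1) in simp_all)
      then have "x \<le> ln (real (level \<mu> (\<epsilon>\<^sup>2) 1))" using elim by (simp add: x_def)
      also have "\<dots> \<le> \<gamma> * \<epsilon> powr (- s)" by (rule \<epsilon>0(2)) fact+
      finally have "x powr (2 / s) \<le> (\<gamma> * \<epsilon> powr (- s)) powr (2 / s)"
        using x s by (intro powr_mono2) auto
      also have "\<dots> = \<gamma> powr (2 / s) * \<epsilon> powr (- 2)"
        using s by (simp add: powr_mult powr_powr \<gamma>_def)
      also have "\<gamma> powr (2 / s) = r / 4" using s r by (simp add: \<gamma>_def powr_powr)
      also have "\<epsilon> powr (- 2) = 2 / \<mu> n"
      proof -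
        have "\<mu> n = 2 * \<epsilon>\<^sup>2" using \<epsilon>(2) by simp
        then show ?thesis using \<epsilon>(1) by (simp add: powr_minus_divide)
      qed
      finally have "\<mu> n * x powr (2 / s) \<le> r / 2" using \<mu>n by (simp add: field_simps)
      moreover have "\<mu> n / x powr (- 2 / s) = \<mu> n * x powr (2 / s)"
        using x by (simp add: powr_minus_divide)
      ultimately show ?thesis using r by (simp add: x_def)
    qed (use r in simp)
  qed
qed

theorem decay_necessary:
  assumes s: "0 < s" and init: "0 < init 1" and small: "uniformly_small s t init log_count"
  shows "(\<lambda>n. \<mu> n / ln (real n) powr (- 2 / s)) \<longlonglongrightarrow> 0"
proof (rule decay_if_ln_level_le[OF s])
  fix \<gamma> :: real assume \<gamma>: "0 < \<gamma>"
  then have "0 < \<gamma> / 2" by simp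
  obtain R where R: "\<And>\<epsilon> d. admissible init \<epsilon> d \<Longrightarrow> R \<le> 1 / \<epsilon> + real d \<Longrightarrow>
      log_count \<epsilon> d \<le> \<gamma> / 2 * (\<epsilon> powr (- s) + real d powr t)"
    using uniformly_smallD[OF small \<open>0 < \<gamma> / 2\<close>] by blast
  define \<epsilon>0 where "\<epsilon>0 = min (init 1) (1 / (\<bar>R\<bar> + 1))"
  have "ln (real (level \<mu> (\<epsilon>\<^sup>2) 1)) \<le> \<gamma> * \<epsilon> powr (- s)" if \<epsilon>: "0 < \<epsilon>" "\<epsilon> < \<epsilon>0" for \<epsilon>
  proof -
    have "\<bar>R\<bar> + 1 \<le> 1 / \<epsilon>" using \<epsilon> by (simp add: \<epsilon>0_def field_simps)
    then have "R \<le> 1 / \<epsilon> + real 1" "1 \<le> 1 / \<epsilon>" by linarith+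
    moreover have "\<epsilon> \<le> 1" using \<open>1 \<le> 1 / \<epsilon>\<close> \<epsilon> by (simp add: field_simps)
    moreover have "admissible init \<epsilon> 1" using \<epsilon> \<open>\<epsilon> \<le> 1\<close> by (simp add: admissible_def \<epsilon>0_def)
    ultimately have "log_count \<epsilon> 1 \<le> \<gamma> / 2 * (\<epsilon> powr (- s) + 1)" using R[of \<epsilon> 1] by simp
    moreover have "1 \<le> \<epsilon> powr (- s)"
      using \<epsilon> \<open>\<epsilon> \<le> 1\<close> s powr_mono2'[of "- s" \<epsilon> 1] by simp
    then have "\<gamma> / 2 * (\<epsilon> powr (- s) + 1) \<le> \<gamma> / 2 * (2 * \<epsilon> powr (- s))"
      using \<gamma> by (intro mult_left_mono) auto
    ultimately show ?thesis unfolding log_count_def card_tuples_1 by simp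
  qed
  moreover have "0 < \<epsilon>0" using init by (simp add: \<epsilon>0_def)
  ultimately show "\<exists>\<epsilon>0>0. \<forall>\<epsilon>. 0 < \<epsilon> \<and> \<epsilon> < \<epsilon>0 \<longrightarrow> ln (real (level \<mu> (\<epsilon>\<^sup>2) 1)) \<le> \<gamma> * \<epsilon> powr (- s)"
    by blast
qed

text \<open>
  Two blocks of length \<open>b\<close> with products at least \<open>1\<close> make the complexity for \<open>\<epsilon> = 1/2\<close> grow
  exponentially in \<open>d\<close>, which is compatible with tractability only for \<open>t > 1\<close>.
\<close>

theorem t_gt_1_necessary:
  assumes "0 < \<mu> 1" and init: "\<And>d. 1 \<le> d \<Longrightarrow> 1/2 < init d"
    and small: "uniformly_small s t init log_count" and b: "1 \<le> b"
    and A: "length A = b" "0 \<notin> set A" "1 \<le> prod_list (map \<mu> A)"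
    and B: "length B = b" "0 \<notin> set B" "1 \<le> prod_list (map \<mu> B)" and "A \<noteq> B"
  shows "1 < t"
proof (rule ccontr)
  assume "\<not> 1 < t"
  \<comment> \<open>For \<open>t \<le> 1\<close> and \<open>d = k b\<close> with large \<open>k\<close> this makes the bound at most half of \<open>k ln 2\<close>.\<close>
  define \<gamma> where "\<gamma> = ln 2 / (4 * real b)"
  have \<gamma>: "0 < \<gamma>" using b by (simp add: \<gamma>_def)
  obtain R where R: "\<And>\<epsilon> d. admissible init \<epsilon> d \<Longrightarrow> R \<le> 1 / \<epsilon> + real d \<Longrightarrow>
      log_count \<epsilon> d \<le> \<gamma> * (\<epsilon> powr (- s) + real d powr t)"
    using uniformly_smallD[OF small \<gamma>] by blast
  define k where "k = nat \<lceil>max (max R 1) (2 * (1/2) powr (- s))\<rceil>"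
  have k: "R \<le> real k" "1 \<le> real k" "2 * (1/2) powr (- s) \<le> real k"
  proof -
    have "max (max R 1) (2 * (1/2) powr (- s)) \<le> real k"
      unfolding k_def by (rule real_nat_ceiling_ge)
    then show "R \<le> real k" "1 \<le> real k" "2 * (1/2) powr (- s) \<le> real k" by simp_all
  qed
  have kb: "real k \<le> real (k * b)" "1 \<le> k * b" using k(2) b by auto
  have "real k * ln 2 \<le> log_count (1/2) (k * b)"
  proof -
    have "2 ^ k \<le> card (tuples \<mu> (k * b) ((1/2)\<^sup>2))"
      using assms by (intro power_two_le_card_tuples[where A = A and B = B] finite_tuples)
        (auto simp: power2_eq_square)
    then have "ln (2 ^ k) \<le> ln (real (card (tuples \<mu> (k * b) ((1/2)\<^sup>2))))"
      by (metis ln_mono of_nat_le_iff of_nat_numeral of_nat_power zero_less_numeral zero_less_power)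
    then show ?thesis by (simp add: log_count_def ln_realpow)
  qed
  also have "\<dots> \<le> \<gamma> * ((1/2) powr (- s) + real (k * b) powr t)"
  proof (rule R)
    show "admissible init (1/2) (k * b)" using kb(2) init by (simp add: admissible_def)
    have "R \<le> real (k * b)" using k(1) kb(1) by (rule order_trans)
    then show "R \<le> 1 / (1/2) + real (k * b)" by simp
  qed
  also have "\<dots> \<le> \<gamma> * (real k / 2 + real (k * b))"
  proof -
    have kb1: "1 \<le> real (k * b)" using k(2) kb(1) by (rule order_trans)
    have "real (k * b) powr t \<le> real (k * b) powr 1"
      using \<open>\<not> 1 < t\<close> kb1 by (intro powr_mono) simp
    also have "\<dots> = real (k * b)" by simp
    finally show ?thesis using k(3) \<gamma> by (intro mult_left_mono add_mono) auto
  qed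
  also have "\<dots> \<le> \<gamma> * (2 * real (k * b))"
  proof (rule mult_left_mono)
    show "real k / 2 + real (k * b) \<le> 2 * real (k * b)" using kb(1) by linarith
  qed (use \<gamma> in simp)
  also have "\<dots> = real k * ln 2 / 2" using b by (simp add: \<gamma>_def)
  finally have "real k * ln 2 \<le> 0" by simp
  then show False using k(2) by (simp add: mult_le_0_iff)
qed

text \<open>
  If all weights are at most \<open>1\<close> and at most \<open>K\<close> entries of a tuple differ from \<open>1\<close>, then the
  complexity is at most \<open>d ^ K\<close> times the product of the first \<open>K\<close> levels, and the \<open>l\<close>-th level is
  the one-dimensional complexity for \<open>\<epsilon>\<close> to the power \<open>1/l\<close>.
\<close>

lemma negligible_log_count:
  assumes s: "0 < s" and \<mu>1: "\<mu> 1 \<le> 1"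
    and decay: "(\<lambda>n. \<mu> n / ln (real n) powr (- 2 / s)) \<longlonglongrightarrow> 0"
    and K: "\<And>\<epsilon> d. admissible init \<epsilon> d \<Longrightarrow> K \<epsilon> d \<le> d"
      "\<And>\<epsilon> d js. admissible init \<epsilon> d \<Longrightarrow> js \<in> tuples \<mu> d (\<epsilon>\<^sup>2) \<Longrightarrow> non_ones js \<le> K \<epsilon> d"
    and K_ln: "negligible_up_to_constant s t init (\<lambda>\<epsilon> d. real (K \<epsilon> d) * ln (real d))"
    and K_n: "negligible_up_to_constant s t init (\<lambda>\<epsilon> d. real (K \<epsilon> d))"
  shows "negligible_up_to_constant s t init log_count"
  unfolding negligible_up_to_constant_def
proof (intro allI impI)
  fix \<gamma> :: real assume \<gamma>: "0 < \<gamma>"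
  \<comment> \<open>In the sum over the levels \<open>\<epsilon> powr (- s)\<close> has the factor \<open>\<gamma>' q\<close>, which is to be \<open>\<gamma>/2\<close>.\<close>
  define q where "q = 1 + 2 / s"
  define \<gamma>' where "\<gamma>' = \<gamma> / (2 * q)"
  have "0 < q" using s by (simp add: q_def add_pos_pos)
  then have \<gamma>': "0 < \<gamma>'" "\<gamma>' * q = \<gamma> / 2" using \<gamma> by (simp_all add: \<gamma>'_def)
  obtain C where C: "0 \<le> C" "\<And>\<epsilon>. 0 < \<epsilon> \<Longrightarrow> ln (real (level \<mu> (\<epsilon>\<^sup>2) 1)) \<le> C + \<gamma>' * \<epsilon> powr (- s)"
    using ln_level_le_if_decay[OF s decay \<gamma>'(1)] by blast
  define B where "B = C + \<gamma>' * exp s"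
  have "0 \<le> B" using C(1) \<gamma>'(1) by (simp add: B_def)
  then have "negligible_up_to_constant s t init
      (\<lambda>\<epsilon> d. real (K \<epsilon> d) * ln (real d) + B * real (K \<epsilon> d))"
    by (intro negligible_add negligible_cmult K_ln K_n)
  moreover have "0 < \<gamma> / 2" using \<gamma> by simp
  ultimately obtain C' where C': "\<And>\<epsilon> d. admissible init \<epsilon> d \<Longrightarrow>
      real (K \<epsilon> d) * ln (real d) + B * real (K \<epsilon> d) \<le> C' + \<gamma> / 2 * (\<epsilon> powr (- s) + real d powr t)"
    using negligibleD by blast
  show "\<exists>C. \<forall>\<epsilon> d. admissible init \<epsilon> d \<longrightarrow> log_count \<epsilon> d \<le> C + \<gamma> * (\<epsilon> powr (- s) + real d powr t)"
  proof (intro exI[of _ C'] allI impI)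
    fix \<epsilon> d assume a: "admissible init \<epsilon> d"
    then have \<epsilon>: "0 < \<epsilon>" "\<epsilon> \<le> 1" by (auto simp: admissible_def)
    let ?K = "K \<epsilon> d"
    have "log_count \<epsilon> d \<le> real ?K * ln (real d) + (\<Sum>l=1..?K. ln (real (level \<mu> (\<epsilon>\<^sup>2) l)))"
      unfolding log_count_def using \<epsilon> K a by (intro ln_card_tuples_le \<mu>1) auto
    also have "(\<Sum>l=1..?K. ln (real (level \<mu> (\<epsilon>\<^sup>2) l))) \<le> (\<Sum>l=1..?K. C + \<gamma>' * (\<epsilon> powr (1 / real l)) powr (- s))"
    proof (rule sum_mono)
      fix l assume "l \<in> {1..?K}"
      then have "level \<mu> (\<epsilon>\<^sup>2) l = level \<mu> ((\<epsilon> powr (1 / real l))\<^sup>2) 1" using \<epsilon> by (intro level_root) auto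
      then show "ln (real (level \<mu> (\<epsilon>\<^sup>2) l)) \<le> C + \<gamma>' * (\<epsilon> powr (1 / real l)) powr (- s)"
        using C(2)[of "\<epsilon> powr (1 / real l)"] \<epsilon> by simp
    qed
    also have "\<dots> = real ?K * C + \<gamma>' * (\<Sum>l=1..?K. (\<epsilon> powr (1 / real l)) powr (- s))"
      by (simp add: sum.distrib sum_distrib_left)
    also have "\<gamma>' * (\<Sum>l=1..?K. (\<epsilon> powr (1 / real l)) powr (- s))
        \<le> \<gamma>' * (q * \<epsilon> powr (- s) + real ?K * exp s)"
      unfolding q_def using \<gamma>'(1) by (intro mult_left_mono sum_powr_inverse_le \<epsilon> s) simp
    also have "\<dots> = \<gamma> / 2 * \<epsilon> powr (- s) + \<gamma>' * exp s * real ?K"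
      unfolding distrib_left mult.assoc[symmetric] \<gamma>'(2) by (simp add: mult_ac)
    finally have "log_count \<epsilon> d \<le> (real ?K * ln (real d) + B * real ?K) + \<gamma> / 2 * \<epsilon> powr (- s)"
      by (simp add: B_def algebra_simps)
    also have "\<dots> \<le> C' + \<gamma> / 2 * (\<epsilon> powr (- s) + real d powr t) + \<gamma> / 2 * \<epsilon> powr (- s)"
      by (intro add_right_mono C' a)
    also have "\<dots> \<le> C' + \<gamma> * (\<epsilon> powr (- s) + real d powr t)"
      using \<gamma> by (simp add: field_simps)
    finally show "log_count \<epsilon> d \<le> C' + \<gamma> * (\<epsilon> powr (- s) + real d powr t)" .
  qed
qed

text \<open>
  The product of \<open>ln (1/\<epsilon>)\<close> and \<open>ln d\<close> is at most the sum of the squares, and either square is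
  negligible against its part of the denominator, whatever \<open>t > 0\<close> is.
\<close>

lemma small_if_non_ones_logarithmic:
  assumes s: "0 < s" and t: "0 < t" and \<mu>1: "\<mu> 1 \<le> 1"
    and decay: "(\<lambda>n. \<mu> n / ln (real n) powr (- 2 / s)) \<longlonglongrightarrow> 0" and "0 \<le> c"
    and bound: "\<And>\<epsilon> d js. admissible init \<epsilon> d \<Longrightarrow> js \<in> tuples \<mu> d (\<epsilon>\<^sup>2) \<Longrightarrow>
      real (non_ones js) \<le> c * ln (1 / \<epsilon>)"
  shows "uniformly_small s t init log_count"
proof (rule negligible_imp_uniformly_small[OF s t])
  define K where "K = (\<lambda>\<epsilon> d. min d (nat \<lfloor>c * ln (1 / \<epsilon>)\<rfloor>))"
  have u: "0 \<le> ln (1 / \<epsilon>)" if "admissible init \<epsilon> d" for \<epsilon> d using that by (simp add: admissible_def)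
  have K: "real (K \<epsilon> d) \<le> c * ln (1 / \<epsilon>)" if "admissible init \<epsilon> d" for \<epsilon> d
  proof -
    have "0 \<le> c * ln (1 / \<epsilon>)" using u[OF that] \<open>0 \<le> c\<close> by simp
    then show ?thesis unfolding K_def by linarith
  qed
  show "negligible_up_to_constant s t init log_count"
  proof (rule negligible_log_count[OF s \<mu>1 decay, where K = K])
    show "K \<epsilon> d \<le> d" for \<epsilon> d by (simp add: K_def)
    show "non_ones js \<le> K \<epsilon> d" if "admissible init \<epsilon> d" "js \<in> tuples \<mu> d (\<epsilon>\<^sup>2)" for \<epsilon> d js
      using bound[OF that] non_ones_le_length[OF that(2)] by (simp add: K_def le_nat_floor)
    show "negligible_up_to_constant s t init (\<lambda>\<epsilon> d. real (K \<epsilon> d) * ln (real d))"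
    proof (rule negligible_mono[OF negligible_cmult[OF negligible_ln_inverse_\<epsilon>_ln_dimension[OF s t] \<open>0 \<le> c\<close>]])
      fix \<epsilon> d assume "admissible init \<epsilon> d"
      then have "real (K \<epsilon> d) * ln (real d) \<le> c * ln (1 / \<epsilon>) * ln (real d)"
        by (intro mult_right_mono K ln_of_nat_nonneg)
      then show "real (K \<epsilon> d) * ln (real d) \<le> c * (ln (1 / \<epsilon>) * ln (real d))" by simp
    qed
    show "negligible_up_to_constant s t init (\<lambda>\<epsilon> d. real (K \<epsilon> d))"
      by (rule negligible_mono[OF negligible_cmult[OF negligible_ln_inverse_\<epsilon>[OF s] \<open>0 \<le> c\<close>] K])
  qed
qed

text \<open>
  As \<open>\<epsilon>\<close> is smaller than the initial error, which decays exponentially, the dimension is at most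
  logarithmic in \<open>1/\<epsilon>\<close>.
\<close>

theorem sufficient_if_lt_1:
  assumes s: "0 < s" and t: "0 < t" and \<mu>1: "0 < \<mu> 1" "\<mu> 1 < 1"
    and decay: "(\<lambda>n. \<mu> n / ln (real n) powr (- 2 / s)) \<longlonglongrightarrow> 0"
  shows "uniformly_small s t (\<lambda>d. \<mu> 1 powr (real d / 2)) log_count"
proof (rule small_if_non_ones_logarithmic[OF s t _ decay])
  have l: "0 < - ln (\<mu> 1)" using \<mu>1 by simp
  then show "0 \<le> 2 / - ln (\<mu> 1)" by simp
  fix \<epsilon> d js assume a: "admissible (\<lambda>d. \<mu> 1 powr (real d / 2)) \<epsilon> d" and js: "js \<in> tuples \<mu> d (\<epsilon>\<^sup>2)"
  then have "0 < \<epsilon>" "\<epsilon> < \<mu> 1 powr (real d / 2)" by (simp_all add: admissible_def)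
  then have "ln \<epsilon> < real d / 2 * ln (\<mu> 1)"
    using \<mu>1 by (subst (asm) ln_less_cancel_iff[symmetric]) (auto simp: ln_powr)
  then have "real d \<le> 2 / - ln (\<mu> 1) * ln (1 / \<epsilon>)"
    using l \<open>0 < \<epsilon>\<close> by (simp add: ln_div field_simps)
  then show "real (non_ones js) \<le> 2 / - ln (\<mu> 1) * ln (1 / \<epsilon>)"
    using non_ones_le_length[OF js] by linarith
qed (use \<mu>1 in simp)

text \<open>
  Every entry different from \<open>1\<close> contributes a factor of at most \<open>\<mu> 2 < 1\<close>, so the number of these
  entries is at most logarithmic in \<open>1/\<epsilon>\<close>, in every dimension.
\<close>

theorem sufficient_if_eq_1_simple:
  assumes s: "0 < s" and t: "0 < t" and \<mu>: "\<mu> 1 = 1" "0 < \<mu> 2" "\<mu> 2 < 1"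
    and decay: "(\<lambda>n. \<mu> n / ln (real n) powr (- 2 / s)) \<longlonglongrightarrow> 0"
  shows "uniformly_small s t init log_count"
proof (rule small_if_non_ones_logarithmic[OF s t _ decay])
  have l: "0 < - ln (\<mu> 2)" using \<mu> by simp
  then show "0 \<le> 2 / - ln (\<mu> 2)" by simp
  fix \<epsilon> d js assume a: "admissible init \<epsilon> d" and js: "js \<in> tuples \<mu> d (\<epsilon>\<^sup>2)"
  have "0 < \<epsilon>" using a by (simp add: admissible_def)
  have "prod_list (map \<mu> js) \<le> \<mu> 2 ^ non_ones js" if "0 \<notin> set js" for js
    using that
  proof (induction js)
    case (Cons j js)
    have IH: "prod_list (map \<mu> js) \<le> \<mu> 2 ^ non_ones js" using Cons by simp
    show ?case
    proof (cases "j = 1")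
      case True
      then show ?thesis using IH \<mu>(1) by (simp add: non_ones_def)
    next
      case False
      then have j: "2 \<le> j" using Cons.prems by auto
      have "\<mu> j * prod_list (map \<mu> js) \<le> \<mu> 2 * \<mu> 2 ^ non_ones js"
      proof (rule mult_mono[OF _ IH])
        show "\<mu> j \<le> \<mu> 2" using j by (intro decr) auto
        show "0 \<le> prod_list (map \<mu> js)"
        proof (rule prod_list_map_nonneg)
          fix x assume "x \<in> set js"
          then have "x \<noteq> 0" using Cons.prems by (metis list.set_intros(2))
          then show "0 \<le> \<mu> x" by (intro nonneg) simp
        qed
      qed (use \<mu> in simp)
      then show ?thesis using False by (simp add: non_ones_def)
    qed
  qed (simp add: non_ones_def)
  then have "\<epsilon>\<^sup>2 < \<mu> 2 ^ non_ones js" using js by (force simp: tuples_def)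
  then have "ln (\<epsilon>\<^sup>2) < ln (\<mu> 2 ^ non_ones js)" using \<open>0 < \<epsilon>\<close> \<mu> by (subst ln_less_cancel_iff) auto
  then have "2 * ln \<epsilon> < real (non_ones js) * ln (\<mu> 2)" using \<open>0 < \<epsilon>\<close> \<mu> by (simp add: ln_realpow)
  then show "real (non_ones js) \<le> 2 / - ln (\<mu> 2) * ln (1 / \<epsilon>)"
    using l \<open>0 < \<epsilon>\<close> by (simp add: ln_div field_simps)
qed (use \<mu> in simp)

text \<open>
  For \<open>t > 1\<close> even the number \<open>d ^ d\<close> of arrangements is harmless, because \<open>d ln d\<close> is negligible.
\<close>

theorem sufficient_if_le_1_and_t_gt_1:
  assumes s: "0 < s" and t: "1 < t" and \<mu>: "\<mu> 1 \<le> 1"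
    and decay: "(\<lambda>n. \<mu> n / ln (real n) powr (- 2 / s)) \<longlonglongrightarrow> 0"
  shows "uniformly_small s t init log_count"
proof (rule negligible_imp_uniformly_small[OF s])
  show "negligible_up_to_constant s t init log_count"
    by (rule negligible_log_count[OF s \<mu> decay, where K = "\<lambda>\<epsilon> d. d"])
      (use t in \<open>auto intro: non_ones_le_length negligible_dimension_ln_dimension
        negligible_dimension_if_t_gt_1\<close>)
qed (use t in simp)

text \<open>
  This is the maximum in the criterion for \<open>\<lambda>\<^sub>1 > 1\<close>, expressed by the eigenvalues.
\<close>

definition level_max :: "real \<Rightarrow> nat \<Rightarrow> real" where
  "level_max \<epsilon> d = Max ((\<lambda>l. real l * ln (real (level (\<lambda>j. \<mu> j / \<mu> 1) (\<epsilon>\<^sup>2 / \<mu> 1 ^ d) l))) ` {1..d})"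

lemma level_max_ge:
  "1 \<le> l \<Longrightarrow> l \<le> d \<Longrightarrow>
    real l * ln (real (level (\<lambda>j. \<mu> j / \<mu> 1) (\<epsilon>\<^sup>2 / \<mu> 1 ^ d) l)) \<le> level_max \<epsilon> d"
  unfolding level_max_def by (intro Max_ge) auto

lemma level_max_nonneg:
  assumes "1 \<le> d"
  shows "0 \<le> level_max \<epsilon> d"
proof -
  have "0 \<le> real 1 * ln (real (level (\<lambda>j. \<mu> j / \<mu> 1) (\<epsilon>\<^sup>2 / \<mu> 1 ^ d) 1))"
    by (intro mult_nonneg_nonneg ln_of_nat_nonneg) simp
  also have "\<dots> \<le> level_max \<epsilon> d" by (rule level_max_ge[OF order_refl assms])
  finally show ?thesis .
qed

lemma level_max_le_log_count:
  assumes "0 < \<mu> 1" "0 < \<epsilon>" "1 \<le> d"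
  shows "level_max \<epsilon> d \<le> log_count \<epsilon> d"
proof -
  interpret N: decreasing_sequence "\<lambda>j. \<mu> j / \<mu> 1" by (rule normalized) fact
  have "real l * ln (real (level (\<lambda>j. \<mu> j / \<mu> 1) (\<epsilon>\<^sup>2 / \<mu> 1 ^ d) l)) \<le> log_count \<epsilon> d"
    if l: "1 \<le> l" "l \<le> d" for l
  proof (cases "level (\<lambda>j. \<mu> j / \<mu> 1) (\<epsilon>\<^sup>2 / \<mu> 1 ^ d) l = 0")
    case False
    define n where "n = level (\<lambda>j. \<mu> j / \<mu> 1) (\<epsilon>\<^sup>2 / \<mu> 1 ^ d) l"
    have n: "0 < n" using False by (simp add: n_def)
    have "n ^ l \<le> card (tuples (\<lambda>j. \<mu> j / \<mu> 1) d (\<epsilon>\<^sup>2 / \<mu> 1 ^ d))"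
      unfolding n_def using assms l by (intro N.level_power_le_card_tuples) auto
    then have "n ^ l \<le> card (tuples \<mu> d (\<epsilon>\<^sup>2))" unfolding tuples_scale[OF assms(1)] .
    then have "real n ^ l \<le> real (card (tuples \<mu> d (\<epsilon>\<^sup>2)))" by (metis of_nat_le_iff of_nat_power)
    then have "ln (real n ^ l) \<le> log_count \<epsilon> d" unfolding log_count_def using n by (intro ln_mono) auto
    then show ?thesis using n by (simp add: ln_realpow n_def)
  qed (simp add: log_count_nonneg)
  then show ?thesis unfolding level_max_def using assms(3) by (subst Max_le_iff) auto
qed

text \<open>
  The \<open>l\<close>-th level contributes at most the \<open>l\<close>-th part of the maximum, and the harmonic sum
  produces the factor \<open>ln d\<close> that separates the necessary from the sufficient condition.
\<close>

lemma log_count_le_level_max: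
  assumes "0 < \<mu> 1" "0 < \<epsilon>" "1 \<le> d"
  shows "log_count \<epsilon> d \<le> real d * ln (real d) + (1 + ln (real d)) * level_max \<epsilon> d"
proof -
  interpret N: decreasing_sequence "\<lambda>j. \<mu> j / \<mu> 1" by (rule normalized) fact
  have "log_count \<epsilon> d = ln (real (card (tuples (\<lambda>j. \<mu> j / \<mu> 1) d (\<epsilon>\<^sup>2 / \<mu> 1 ^ d))))"
    unfolding log_count_def tuples_scale[OF assms(1)] ..
  also have "\<dots> \<le> real d * ln (real d)
      + (\<Sum>l=1..d. ln (real (level (\<lambda>j. \<mu> j / \<mu> 1) (\<epsilon>\<^sup>2 / \<mu> 1 ^ d) l)))"
    using assms by (intro N.ln_card_tuples_le N.non_ones_le_length) auto
  also have "(\<Sum>l=1..d. ln (real (level (\<lambda>j. \<mu> j / \<mu> 1) (\<epsilon>\<^sup>2 / \<mu> 1 ^ d) l)))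
      \<le> (\<Sum>l=1..d. 1 / real l * level_max \<epsilon> d)"
  proof (rule sum_mono)
    fix l assume "l \<in> {1..d}"
    then show "ln (real (level (\<lambda>j. \<mu> j / \<mu> 1) (\<epsilon>\<^sup>2 / \<mu> 1 ^ d) l)) \<le> 1 / real l * level_max \<epsilon> d"
      using level_max_ge[of l d \<epsilon>] by (simp add: field_simps)
  qed
  also have "\<dots> = (\<Sum>l=1..d. 1 / real l) * level_max \<epsilon> d" by (simp add: sum_distrib_right)
  also have "\<dots> \<le> (1 + ln (real d)) * level_max \<epsilon> d"
    using assms(3) by (intro mult_right_mono sum_inverse_le_ln level_max_nonneg)
  finally show ?thesis by simp
qed

lemma log_count_1_le_level_max_2:
  assumes "1 < \<mu> 1" "0 < \<epsilon>"
  shows "log_count \<epsilon> 1 \<le> level_max \<epsilon> 2"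
proof -
  interpret N: decreasing_sequence "\<lambda>j. \<mu> j / \<mu> 1" by (rule normalized) (use assms in simp)
  let ?\<nu> = "\<lambda>j. \<mu> j / \<mu> 1"
  have "card (tuples \<mu> 1 (\<epsilon>\<^sup>2)) = level ?\<nu> (\<epsilon>\<^sup>2 / \<mu> 1 ^ 1) 1"
    unfolding N.card_tuples_1[symmetric] using assms by (subst tuples_scale) auto
  also have "\<dots> \<le> level ?\<nu> (\<epsilon>\<^sup>2 / \<mu> 1 ^ 2) 1"
    unfolding level_def
  proof (rule card_mono)
    show "finite {j. 1 \<le> j \<and> \<epsilon>\<^sup>2 / \<mu> 1 ^ 2 < ?\<nu> j ^ 1}"
      using assms by (intro N.finite_level) auto
    have "\<epsilon>\<^sup>2 / \<mu> 1 ^ 2 \<le> \<epsilon>\<^sup>2 / \<mu> 1 ^ 1"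
      using assms by (intro divide_left_mono) (auto simp: power2_eq_square)
    then show "{j. 1 \<le> j \<and> \<epsilon>\<^sup>2 / \<mu> 1 ^ 1 < ?\<nu> j ^ 1} \<subseteq> {j. 1 \<le> j \<and> \<epsilon>\<^sup>2 / \<mu> 1 ^ 2 < ?\<nu> j ^ 1}"
      by auto
  qed
  finally have le: "card (tuples \<mu> 1 (\<epsilon>\<^sup>2)) \<le> level ?\<nu> (\<epsilon>\<^sup>2 / \<mu> 1 ^ 2) 1" .
  have "log_count \<epsilon> 1 \<le> ln (real (level ?\<nu> (\<epsilon>\<^sup>2 / \<mu> 1 ^ 2) 1))"
  proof (cases "card (tuples \<mu> 1 (\<epsilon>\<^sup>2)) = 0")
    case True
    then show ?thesis by (simp add: log_count_def ln_of_nat_nonneg)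
  next
    case False
    then show ?thesis unfolding log_count_def using le by (intro ln_mono) auto
  qed
  also have "\<dots> \<le> level_max \<epsilon> 2" using level_max_ge[of 1 2 \<epsilon>] by simp
  finally show ?thesis .
qed

text \<open>
  In dimension one the condition says nothing, because of the factor \<open>ln d\<close>; there the bound for
  dimension two is used.
\<close>

theorem sufficient_if_gt_1:
  assumes s: "0 < s" and t: "1 < t" and \<mu>1: "1 < \<mu> 1"
    and init: "\<And>d. 1 \<le> d \<Longrightarrow> 1 < init d"
    and small: "uniformly_small s t init (\<lambda>\<epsilon> d. ln (real d) * level_max \<epsilon> d)"
  shows "uniformly_small s t init log_count"
  unfolding uniformly_small_def
proof (intro allI impI)
  fix \<gamma> :: real assume \<gamma>: "0 < \<gamma>"
  \<comment> \<open>The factor \<open>2 powr t\<close> pays for replacing \<open>d = 2\<close> by \<open>d = 1\<close> in the denominator.\<close>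
  define \<gamma>' where "\<gamma>' = \<gamma> / (6 * 2 powr t)"
  have t2: "1 \<le> (2::real) powr t" using t by (simp add: ge_one_powr_ge_zero)
  have \<gamma>': "0 < \<gamma>'" "6 * (\<gamma>' * 2 powr t) = \<gamma>" using \<gamma> by (simp_all add: \<gamma>'_def)
  have "6 * (\<gamma>' * 1) \<le> 6 * (\<gamma>' * 2 powr t)" using \<gamma>'(1) by (intro mult_left_mono t2) auto
  then have \<gamma>'_le: "6 * \<gamma>' \<le> \<gamma>" unfolding \<gamma>'(2) by simp
  obtain R where R: "\<And>\<epsilon> d. admissible init \<epsilon> d \<Longrightarrow> R \<le> 1 / \<epsilon> + real d \<Longrightarrow>
      ln (real d) * level_max \<epsilon> d \<le> \<gamma>' * (\<epsilon> powr (- s) + real d powr t)"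
    using uniformly_smallD[OF small \<gamma>'(1)] by blast
  have "uniformly_small s t init (\<lambda>\<epsilon> d. real d * ln (real d))"
    using t by (intro negligible_imp_uniformly_small s negligible_dimension_ln_dimension) auto
  moreover have "0 < \<gamma> / 2" using \<gamma> by simp
  ultimately obtain R' where R': "\<And>\<epsilon> d. admissible init \<epsilon> d \<Longrightarrow> R' \<le> 1 / \<epsilon> + real d \<Longrightarrow>
      real d * ln (real d) \<le> \<gamma> / 2 * (\<epsilon> powr (- s) + real d powr t)"
    using uniformly_smallD by blast
  show "\<exists>R. \<forall>\<epsilon> d. admissible init \<epsilon> d \<and> R \<le> 1 / \<epsilon> + real d \<longrightarrow>
      log_count \<epsilon> d \<le> \<gamma> * (\<epsilon> powr (- s) + real d powr t)"
  proof (intro exI[of _ "max R R'"] allI impI, elim conjE)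
    fix \<epsilon> d assume a: "admissible init \<epsilon> d" and le: "max R R' \<le> 1 / \<epsilon> + real d"
    then have \<epsilon>: "0 < \<epsilon>" "\<epsilon> \<le> 1" "1 \<le> d" by (auto simp: admissible_def)
    have ln2: "1 / 2 \<le> ln (2::real)" using ln2_ge_two_thirds by simp
    show "log_count \<epsilon> d \<le> \<gamma> * (\<epsilon> powr (- s) + real d powr t)"
    proof (cases "d = 1")
      case True
      have a2: "admissible init \<epsilon> 2" using \<epsilon> init[of 2] by (simp add: admissible_def)
      have "1 / 2 * level_max \<epsilon> 2 \<le> ln (real 2) * level_max \<epsilon> 2"
        using ln2 by (intro mult_right_mono level_max_nonneg) auto
      also have "\<dots> \<le> \<gamma>' * (\<epsilon> powr (- s) + real 2 powr t)"
        using le True by (intro R a2) auto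
      also have "\<dots> \<le> \<gamma>' * (2 powr t * \<epsilon> powr (- s) + 2 powr t)"
        using \<gamma>'(1) t2 by (intro mult_left_mono add_mono) (auto simp: mult_le_cancel_right1)
      also have "\<dots> = \<gamma> / 6 * (\<epsilon> powr (- s) + 1)"
        unfolding \<gamma>'(2)[symmetric] by (simp add: algebra_simps)
      finally have "level_max \<epsilon> 2 \<le> \<gamma> / 3 * (\<epsilon> powr (- s) + 1)" by simp
      also have "\<dots> \<le> \<gamma> * (\<epsilon> powr (- s) + 1)"
        using \<gamma> by (intro mult_right_mono) auto
      finally show ?thesis
        using log_count_1_le_level_max_2[OF \<mu>1 \<epsilon>(1)] True by simp
    next
      case False
      then have d: "2 \<le> d" using \<epsilon> by simp
      have "ln 2 \<le> ln (real d)" using d by simp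
      then have "1 + ln (real d) \<le> 3 * ln (real d)" using ln2 by simp
      then have "(1 + ln (real d)) * level_max \<epsilon> d \<le> 3 * ln (real d) * level_max \<epsilon> d"
        using \<epsilon> by (intro mult_right_mono level_max_nonneg)
      also have "\<dots> \<le> 3 * (\<gamma>' * (\<epsilon> powr (- s) + real d powr t))"
        using R[OF a] le by simp
      also have "\<dots> \<le> \<gamma> / 2 * (\<epsilon> powr (- s) + real d powr t)"
        unfolding mult.assoc[symmetric] using \<gamma>'_le by (intro mult_right_mono) auto
      finally have "(1 + ln (real d)) * level_max \<epsilon> d \<le> \<gamma> / 2 * (\<epsilon> powr (- s) + real d powr t)" .
      moreover have "real d * ln (real d) \<le> \<gamma> / 2 * (\<epsilon> powr (- s) + real d powr t)"
        using R'[OF a] le by simp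
      moreover have "log_count \<epsilon> d \<le> real d * ln (real d) + (1 + ln (real d)) * level_max \<epsilon> d"
        using \<mu>1 \<epsilon> by (intro log_count_le_level_max) auto
      ultimately show ?thesis by simp
    qed
  qed
qed

end

section \<open>The complexity of the tensor product problem\<close>

lemma uniformly_small_cong:
  assumes "\<And>\<epsilon> d. admissible init \<epsilon> d \<Longrightarrow> f \<epsilon> d = g \<epsilon> d"
  shows "uniformly_small s t init f \<longleftrightarrow> uniformly_small s t init g"
  using uniformly_small_mono[of s t init f g] uniformly_small_mono[of s t init g f] assms by auto

context decreasing_sequence
begin

lemma tuples_eq_positive:
  assumes "0 \<le> \<eta>"
  shows "{js \<in> {js. length js = d \<and> set js \<subseteq> {j. 1 \<le> j \<and> 0 < \<mu> j}}. \<eta> < prod_list (map \<mu> js)}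
    = tuples \<mu> d \<eta>"
proof (intro set_eqI iffI)
  fix js assume "js \<in> {js \<in> {js. length js = d \<and> set js \<subseteq> {j. 1 \<le> j \<and> 0 < \<mu> j}}. \<eta> < prod_list (map \<mu> js)}"
  then show "js \<in> tuples \<mu> d \<eta>" unfolding tuples_def by fastforce
next
  fix js assume js: "js \<in> tuples \<mu> d \<eta>"
  have "1 \<le> j \<and> 0 < \<mu> j" if j: "j \<in> set js" for j
  proof -
    have j1: "1 \<le> j" using js j by (cases j) (auto simp: tuples_def)
    have "prod_list (map \<mu> js) \<noteq> 0" using js assms by (auto simp: tuples_def)
    then have "\<mu> j \<noteq> 0" using j by (force simp: prod_list_zero_iff)
    then show ?thesis using j1 nonneg[OF j1] by simp
  qed
  then show "js \<in> {js \<in> {js. length js = d \<and> set js \<subseteq> {j. 1 \<le> j \<and> 0 < \<mu> j}}. \<eta> < prod_list (map \<mu> js)}"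
    using js by (auto simp: tuples_def)
qed

lemma prod_list_le_power: "0 \<notin> set js \<Longrightarrow> prod_list (map \<mu> js) \<le> \<mu> 1 ^ length js"
proof (induction js)
  case (Cons j js)
  have "\<mu> j * prod_list (map \<mu> js) \<le> \<mu> 1 * \<mu> 1 ^ length js"
  proof (rule mult_mono)
    show "\<mu> j \<le> \<mu> 1" using Cons.prems by (intro decr) auto
    show "prod_list (map \<mu> js) \<le> \<mu> 1 ^ length js" using Cons by simp
    show "0 \<le> \<mu> 1" by (rule nonneg) simp
    show "0 \<le> prod_list (map \<mu> js)"
    proof (rule prod_list_map_nonneg)
      fix x assume "x \<in> set js"
      then have "x \<noteq> 0" using Cons.prems by (metis list.set_intros(2))
      then show "0 \<le> \<mu> x" by (intro nonneg) simp
    qed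
  qed
  then show ?case by simp
qed simp

end

context compact_hilbert_operator
begin

lemma diagonalized_scaled:
  assumes on: "\<And>i j. i \<in> J \<Longrightarrow> j \<in> J \<Longrightarrow> ip1 (e i) (e j) = (if i = j then 1 else 0)"
    and T_e: "\<And>x j. j \<in> J \<Longrightarrow> ip2 (T x) (T (e j)) = of_real (lam j) * ip1 x (e j)"
    and pos: "\<And>j. j \<in> J \<Longrightarrow> 0 < lam j"
    and dense: "closure (H.span (e ` J \<union> {x. T x = 0})) = UNIV"
  shows "diagonalized_operator sc1 ip1 sc2 ip2 UNIV (\<lambda>x. c *\<^sub>R T x) J e (\<lambda>j. c\<^sup>2 * lam j) {x. T x = 0}"
proof unfold_locales
  show "UNIV = closure (H.span (e ` J \<union> {x. T x = 0}))" using dense ..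
  obtain C where C: "0 \<le> C" "\<And>x. norm (T x) \<le> C * norm x" using T_bounded by blast
  have "norm (c *\<^sub>R T x) \<le> \<bar>c\<bar> * C * norm x" for x
    using mult_left_mono[OF C(2), of "\<bar>c\<bar>" x] by (simp add: mult.assoc)
  moreover have "c *\<^sub>R sc2 a y = sc2 a (c *\<^sub>R y)" for a y
    unfolding G.scale_of_real[symmetric] G.scale_scale by (simp add: mult.commute)
  ultimately show "bounded_linear_on sc1 sc2 UNIV (\<lambda>x. c *\<^sub>R T x)"
    unfolding bounded_linear_on_def by (auto simp: T_add T_scale scaleR_add_right)
  fix i j assume ij: "i \<in> J" "j \<in> J"
  show "ip1 (e i) (e j) = (if i = j then 1 else 0)" by (rule on[OF ij])
  have "ip2 (c *\<^sub>R T (e i)) (c *\<^sub>R T (e j)) = of_real c * (of_real c * ip2 (T (e i)) (T (e j)))"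
    unfolding G.scale_of_real[symmetric] G.ip_scale G.ip_scale_right scnj_of_real ..
  then show "ip2 (c *\<^sub>R T (e i)) (c *\<^sub>R T (e j)) = (if i = j then of_real (c\<^sup>2 * lam i) else 0)"
    using ij by (simp add: T_e on power2_eq_square)
next
  fix z assume z: "z \<in> {x. T x = 0}"
  then show "c *\<^sub>R T z = 0" by simp
  fix j assume j: "j \<in> J"
  show "ip1 z (e j) = 0" using T_e[OF j, of z] pos[OF j] z by (simp add: G.ip_zero_left)
qed

end

theorem theorem3p10:
  fixes scH :: "'k::real_or_complex \<Rightarrow> 'h::banach \<Rightarrow> 'h" and ipH :: "'h \<Rightarrow> 'h \<Rightarrow> 'k"
    and scG :: "'k \<Rightarrow> 'g::banach \<Rightarrow> 'g" and ipG :: "'g \<Rightarrow> 'g \<Rightarrow> 'k"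
    and scP :: "'k \<Rightarrow> 'p::banach \<Rightarrow> 'p" and ipP :: "'p \<Rightarrow> 'p \<Rightarrow> 'k"
    and scQ :: "'k \<Rightarrow> 'q::banach \<Rightarrow> 'q" and ipQ :: "'q \<Rightarrow> 'q \<Rightarrow> 'k"
    and tensH :: "'h list \<Rightarrow> 'p" and tensG :: "'g list \<Rightarrow> 'q"
    and S1 :: "'h \<Rightarrow> 'g" and S :: "nat \<Rightarrow> 'p \<Rightarrow> 'q"
    and lam :: "nat \<Rightarrow> real" and m :: nat and s t :: real
  defines "H \<equiv> tensor_power scP tensH" and "G \<equiv> tensor_power scQ tensG"
    and "S1' \<equiv> (\<lambda>f. (1 / sqrt (lam 1)) *\<^sub>R S1 f)"
  defines "init \<equiv> (\<lambda>d. operator_norm (H d) (S d))"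
    and "M \<equiv> (\<lambda>\<epsilon> d. Max ((\<lambda>l. real l *
           ln (real (n_abs scH scG UNIV UNIV
                      ((\<epsilon> / lam 1 powr (real d / 2)) powr (1 / real l)) S1'))) ` {1..d}))"
  assumes "s > 0" and "t > 0"
    and "hilbert_space scH ipH" and "hilbert_space scG ipG"
    and "hilbert_space scP ipP" and "hilbert_space scQ ipQ"
    and "separable_space (euclidean :: 'h topology)"
    and "\<nexists>B. finite B \<and> module.span scH B = (UNIV :: 'h set)"
    and "elementary_tensors scH ipH scP ipP tensH"
    and "elementary_tensors scG ipG scQ ipQ tensG"
    and "compact_operator scH scG S1"
    and "\<And>d. d \<ge> 1 \<Longrightarrow> is_tensor_power_operator scP scQ tensH tensG S1 d (S d)"
    and "ordered_eigenvalues scH (hilbert_adjoint ipH ipG S1 \<circ> S1) lam"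
    and "lam 2 > 0"
    and "m \<ge> 1" and "\<forall>j\<in>{1..m}. lam j = lam 1" and "lam (m + 1) < lam 1"
  shows "(lam 1 < 1 \<longrightarrow>
            (weakly_tractable s t scP scQ H G S \<longleftrightarrow>
               (\<lambda>n. lam n / ln (real n) powr (- 2 / s)) \<longlonglongrightarrow> 0)) \<and>
         (lam 1 = 1 \<longrightarrow>
            (m = 1 \<longrightarrow>
              (weakly_tractable s t scP scQ H G S \<longleftrightarrow>
                 (\<lambda>n. lam n / ln (real n) powr (- 2 / s)) \<longlonglongrightarrow> 0)) \<and>
            (m > 1 \<longrightarrow>
              (weakly_tractable s t scP scQ H G S \<longleftrightarrow>
                 t > 1 \<and> (\<lambda>n. lam n / ln (real n) powr (- 2 / s)) \<longlonglongrightarrow> 0))) \<and>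
         (lam 1 > 1 \<longrightarrow>
            (weakly_tractable s t scP scQ H G S \<longrightarrow>
               t > 1 \<and>
               vanishes_in_limit init (\<lambda>\<epsilon> d. M \<epsilon> d / (\<epsilon> powr (- s) + real d powr t))) \<and>
            (t > 1 \<and>
             vanishes_in_limit init
               (\<lambda>\<epsilon> d. ln (real d) * M \<epsilon> d / (\<epsilon> powr (- s) + real d powr t)) \<longrightarrow>
               weakly_tractable s t scP scQ H G S))"
proof -
  note hilbert = \<open>hilbert_space scH ipH\<close> \<open>hilbert_space scG ipG\<close>
    \<open>hilbert_space scP ipP\<close> \<open>hilbert_space scQ ipQ\<close>
  have add: "scnj (a + b) = scnj a + scnj b" for a b :: 'k
    by (rule hilbert_space.scnj_add_if_infinite_dimensional[OF hilbert(1)]) fact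
  have addH: "additive_hilbert_space scH ipH" and addG: "additive_hilbert_space scG ipG"
    and addP: "additive_hilbert_space scP ipP" and addQ: "additive_hilbert_space scQ ipQ"
    using hilbert add by (simp_all add: additive_hilbert_space_def additive_hilbert_space_axioms_def)
  interpret Q: additive_hilbert_space scQ ipQ by (rule addQ)
  interpret Op: compact_hilbert_operator scH ipH scG ipG S1
    using addH addG \<open>compact_operator scH scG S1\<close>
    by (simp add: compact_hilbert_operator_def compact_hilbert_operator_axioms_def)
  have eig: "ordered_eigenvalues scH (Op.adj \<circ> S1) lam"
    unfolding Op.adj_def by fact
  define J where "J = {j. 1 \<le> j \<and> 0 < lam j}"
  obtain e where on: "\<And>i j. i \<in> J \<Longrightarrow> j \<in> J \<Longrightarrow> ipH (e i) (e j) = (if i = j then 1 else 0)"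
    and S1_e: "\<And>x j. j \<in> J \<Longrightarrow> ipG (S1 x) (S1 (e j)) = of_real (lam j) * ipH x (e j)"
    and dense: "closure (Op.H.span (e ` J \<union> {x. S1 x = 0})) = UNIV"
    and fin: "\<And>\<delta>. 0 < \<delta> \<Longrightarrow> finite {j. 1 \<le> j \<and> \<delta> < lam j}"
    using Op.singular_system[OF eig] unfolding J_def by blast
  have pos: "0 < lam j" if "j \<in> J" for j using that by (simp add: J_def)
  interpret L: decreasing_sequence lam
    using eig fin by unfold_locales (auto simp: ordered_eigenvalues_def)
  have lam1: "0 < lam 1" using L.decr[of 1 2] \<open>lam 2 > 0\<close> by simp
  interpret N: decreasing_sequence "\<lambda>j. lam j / lam 1" by (rule L.normalized[OF lam1])

  have n_abs_S: "n_abs scP scQ (H d) (G d) \<epsilon> (S d) = card (tuples lam d (\<epsilon>\<^sup>2))"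
    and norm_S: "operator_norm (H d) (S d) = lam 1 powr (real d / 2)" if d: "1 \<le> d" and \<epsilon>: "0 < \<epsilon>" for d \<epsilon>
  proof -
    interpret D: diagonalized_operator scP ipP scQ ipQ "H d" "S d"
      "{js. length js = d \<and> set js \<subseteq> J}" "\<lambda>js. tensH (map e js)" "\<lambda>js. prod_list (map lam js)"
      "tensH ` {xs. length xs = d \<and> (\<exists>x\<in>set xs. S1 x = 0)}"
      unfolding H_def
      by (rule Op.tensor_power_diagonalized[OF addP addQ \<open>elementary_tensors scH ipH scP ipP tensH\<close>
            \<open>elementary_tensors scG ipG scQ ipQ tensG\<close> d _ on S1_e pos dense])
        (rule \<open>\<And>d. d \<ge> 1 \<Longrightarrow> is_tensor_power_operator scP scQ tensH tensG S1 d (S d)\<close>[OF d])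
    have tuples: "{js \<in> {js. length js = d \<and> set js \<subseteq> J}. \<epsilon>\<^sup>2 < prod_list (map lam js)} = tuples lam d (\<epsilon>\<^sup>2)"
      unfolding J_def by (rule L.tuples_eq_positive) simp
    have "S d (tensH (map e js)) \<in> G d" if js: "js \<in> {js. length js = d \<and> set js \<subseteq> J}" for js
    proof -
      have "S d (tensH (map e js)) = tensG (map S1 (map e js))"
        using \<open>\<And>d. d \<ge> 1 \<Longrightarrow> is_tensor_power_operator scP scQ tensH tensG S1 d (S d)\<close>[OF d] js
        by (simp add: is_tensor_power_operator_def)
      also have "\<dots> \<in> G d"
        unfolding G_def tensor_power_def using js
        by (intro subsetD[OF closure_subset] Q.span_base imageI) simp
      finally show ?thesis .
    qed
    then show "n_abs scP scQ (H d) (G d) \<epsilon> (S d) = card (tuples lam d (\<epsilon>\<^sup>2))"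
      using D.n_abs_eq[OF \<epsilon>, of "G d"] L.finite_tuples[OF lam1, of "\<epsilon>\<^sup>2" d] \<epsilon> unfolding tuples by simp
    have "operator_norm (H d) (S d) = sqrt (prod_list (map lam (replicate d 1)))"
    proof (rule D.operator_norm_eq)
      show "replicate d 1 \<in> {js. length js = d \<and> set js \<subseteq> J}" using lam1 by (auto simp: J_def)
      fix js assume "js \<in> {js. length js = d \<and> set js \<subseteq> J}"
      then show "prod_list (map lam js) \<le> prod_list (map lam (replicate d 1))"
        using L.prod_list_le_power[of js] by (auto simp: J_def)
    qed
    also have "\<dots> = sqrt (lam 1 powr real d)" using lam1 by (simp add: powr_realpow)
    also have "\<dots> = lam 1 powr (real d / 2)" using lam1 by (simp add: powr_half_sqrt[symmetric] powr_powr)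
    finally show "operator_norm (H d) (S d) = lam 1 powr (real d / 2)" .
  qed
  define init' where "init' = (\<lambda>d. lam 1 powr (real d / 2))"
  have init: "init d = init' d" if "1 \<le> d" for d
    unfolding init_def init'_def using norm_S[OF that zero_less_one] .

  have wt: "weakly_tractable s t scP scQ H G S \<longleftrightarrow> uniformly_small s t init' L.log_count"
  proof -
    have "weakly_tractable s t scP scQ H G S \<longleftrightarrow>
        uniformly_small s t init' (\<lambda>\<epsilon> d. ln (real (n_abs scP scQ (H d) (G d) \<epsilon> (S d))))"
      unfolding weakly_tractable_def init_def[symmetric]
      by (rule vanishes_in_limit_iff) (simp_all only: init ln_of_nat_nonneg)
    also have "\<dots> \<longleftrightarrow> uniformly_small s t init' L.log_count"
      by (rule uniformly_small_cong) (simp add: admissible_def n_abs_S L.log_count_def)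
    finally show ?thesis .
  qed

  have n_abs_S1': "n_abs scH scG UNIV UNIV \<delta> S1' = level (\<lambda>j. lam j / lam 1) (\<delta>\<^sup>2) 1" if \<delta>: "0 < \<delta>" for \<delta>
  proof -
    have S1': "S1' = (\<lambda>x. (1 / sqrt (lam 1)) *\<^sub>R S1 x)" by (simp add: S1'_def)
    have sq: "(1 / sqrt (lam 1))\<^sup>2 * lam j = lam j / lam 1" for j
      using lam1 by (simp add: power_divide)
    interpret D: diagonalized_operator scH ipH scG ipG UNIV S1' J e "\<lambda>j. lam j / lam 1" "{x. S1 x = 0}"
      using Op.diagonalized_scaled[OF on S1_e pos dense, of "1 / sqrt (lam 1)"] unfolding sq S1' .
    have eq: "{j \<in> J. \<delta>\<^sup>2 < lam j / lam 1} = {j. 1 \<le> j \<and> \<delta>\<^sup>2 < (lam j / lam 1) ^ 1}"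
    proof -
      have "0 < lam j" if "\<delta>\<^sup>2 < lam j / lam 1" for j
      proof -
        have "0 < lam j / lam 1" using that \<delta> by (meson le_less_trans zero_le_power2)
        then show ?thesis using lam1 by (simp add: zero_less_divide_iff)
      qed
      then show ?thesis by (auto simp: J_def)
    qed
    have "finite {j. 1 \<le> j \<and> \<delta>\<^sup>2 < (lam j / lam 1) ^ 1}" using \<delta> by (intro N.finite_level) auto
    then show ?thesis using D.n_abs_eq[OF \<delta>, of UNIV] unfolding eq level_def by simp
  qed
  have M: "M \<epsilon> d = L.level_max \<epsilon> d" if \<epsilon>: "0 < \<epsilon>" for \<epsilon> d
    unfolding M_def L.level_max_def
  proof (rule arg_cong[where f = Max], rule image_cong[OF refl])
    fix l assume l: "l \<in> {1..d}"
    define x where "x = \<epsilon> / lam 1 powr (real d / 2)"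
    have x: "0 < x" using \<epsilon> lam1 by (simp add: x_def)
    have "(lam 1 powr (real d / 2))\<^sup>2 = lam 1 ^ d"
      using lam1 by (simp add: powr_realpow[symmetric] powr_powr power2_eq_square powr_add[symmetric])
    then have x2: "x\<^sup>2 = \<epsilon>\<^sup>2 / lam 1 ^ d" by (simp add: x_def power_divide)
    have "n_abs scH scG UNIV UNIV (x powr (1 / real l)) S1'
        = level (\<lambda>j. lam j / lam 1) ((x powr (1 / real l))\<^sup>2) 1"
      using x by (intro n_abs_S1') simp
    also have "\<dots> = level (\<lambda>j. lam j / lam 1) (\<epsilon>\<^sup>2 / lam 1 ^ d) l"
      unfolding x2[symmetric] using x l by (intro N.level_root[symmetric]) auto
    finally show "real l * ln (real (n_abs scH scG UNIV UNIV ((\<epsilon> / lam 1 powr (real d / 2)) powr (1 / real l)) S1'))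
        = real l * ln (real (level (\<lambda>j. lam j / lam 1) (\<epsilon>\<^sup>2 / lam 1 ^ d) l))"
      unfolding x_def by simp
  qed
  have vanishes_M: "vanishes_in_limit init (\<lambda>\<epsilon> d. M \<epsilon> d / (\<epsilon> powr (- s) + real d powr t))
      \<longleftrightarrow> uniformly_small s t init' L.level_max"
  proof -
    have "vanishes_in_limit init (\<lambda>\<epsilon> d. M \<epsilon> d / (\<epsilon> powr (- s) + real d powr t))
        \<longleftrightarrow> uniformly_small s t init' M"
      by (rule vanishes_in_limit_iff) (auto simp: init admissible_def M L.level_max_nonneg)
    also have "\<dots> \<longleftrightarrow> uniformly_small s t init' L.level_max"
      by (rule uniformly_small_cong) (simp add: admissible_def M)
    finally show ?thesis .
  qed
  have vanishes_ln_M: "vanishes_in_limit init (\<lambda>\<epsilon> d. ln (real d) * M \<epsilon> d / (\<epsilon> powr (- s) + real d powr t))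
      \<longleftrightarrow> uniformly_small s t init' (\<lambda>\<epsilon> d. ln (real d) * L.level_max \<epsilon> d)"
  proof -
    have "vanishes_in_limit init (\<lambda>\<epsilon> d. ln (real d) * M \<epsilon> d / (\<epsilon> powr (- s) + real d powr t))
        \<longleftrightarrow> uniformly_small s t init' (\<lambda>\<epsilon> d. ln (real d) * M \<epsilon> d)"
      by (rule vanishes_in_limit_iff)
        (auto simp: init admissible_def M intro!: mult_nonneg_nonneg L.level_max_nonneg ln_of_nat_nonneg)
    also have "\<dots> \<longleftrightarrow> uniformly_small s t init' (\<lambda>\<epsilon> d. ln (real d) * L.level_max \<epsilon> d)"
      by (rule uniformly_small_cong) (simp add: admissible_def M)
    finally show ?thesis .
  qed

  have s: "0 < s" and t: "0 < t" by fact+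
  have init1: "0 < init' 1" using lam1 by (simp add: init'_def)
  let ?decay = "(\<lambda>n. lam n / ln (real n) powr (- 2 / s)) \<longlonglongrightarrow> 0"
  have decay: "weakly_tractable s t scP scQ H G S \<Longrightarrow> ?decay"
    unfolding wt by (rule L.decay_necessary[where init = init', OF s init1])

  show ?thesis
  proof (intro conjI impI iffI)
    assume lt: "lam 1 < 1"
    show ?decay if "weakly_tractable s t scP scQ H G S" using decay[OF that] .
    show "weakly_tractable s t scP scQ H G S" if ?decay
      unfolding wt init'_def by (rule L.sufficient_if_lt_1[OF s t lam1 lt that])
  next
    assume one: "lam 1 = 1"
    show ?decay if "weakly_tractable s t scP scQ H G S" using decay[OF that] .
    show "weakly_tractable s t scP scQ H G S" if ?decay and m: "m = 1"
    proof -
      have "lam 2 < 1" using \<open>lam (m + 1) < lam 1\<close> one m by (simp add: numeral_2_eq_2)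
      then show ?thesis
        unfolding wt by (rule L.sufficient_if_eq_1_simple[OF s t one \<open>lam 2 > 0\<close> _ that(1)])
    qed
  next
    assume one: "lam 1 = 1" and m: "1 < m"
    show ?decay if "weakly_tractable s t scP scQ H G S" using decay[OF that] .
    show "1 < t" if "weakly_tractable s t scP scQ H G S"
    proof (rule L.t_gt_1_necessary[where b = 1 and A = "[1]" and B = "[2]"])
      show "uniformly_small s t init' L.log_count" using that unfolding wt .
      show "1 / 2 < init' d" for d unfolding init'_def one by simp
      have "lam 2 = lam 1" by (rule bspec[OF \<open>\<forall>j\<in>{1..m}. lam j = lam 1\<close>]) (use m in simp)
      then show "1 \<le> prod_list (map lam [2])" using one by simp
      show "1 \<le> prod_list (map lam [1])" using one by simp
    qed (use lam1 in simp_all)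
    show "weakly_tractable s t scP scQ H G S" if "1 < t \<and> ?decay"
      unfolding wt using that one by (intro L.sufficient_if_le_1_and_t_gt_1[OF s]) auto
  next
    assume gt: "1 < lam 1"
    have init_gt: "1 < init' d" if "1 \<le> d" for d
      using gt that unfolding init'_def by (intro gr_one_powr) auto
    show "1 < t" if "weakly_tractable s t scP scQ H G S"
    proof -
      \<comment> \<open>Enough factors \<open>\<lambda>\<^sub>1 > 1\<close> compensate for one factor \<open>\<lambda>\<^sub>2\<close>.\<close>
      obtain n where n: "1 / lam 2 < lam 1 ^ n" using real_arch_pow[OF gt] by blast
      show ?thesis
      proof (rule L.t_gt_1_necessary[where b = "Suc n" and A = "1 # replicate n 1" and B = "2 # replicate n 1"])
        show "uniformly_small s t init' L.log_count" using that unfolding wt .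
        show "1 / 2 < init' d" if "1 \<le> d" for d using init_gt[OF that] by simp
        show "1 \<le> prod_list (map lam (1 # replicate n 1))" 
          using one_le_power[of "lam 1" "Suc n"] gt by simp
        show "1 \<le> prod_list (map lam (2 # replicate n 1))"
          using n \<open>lam 2 > 0\<close> by (simp add: field_simps)
      qed (use lam1 in auto)
    qed
    show "vanishes_in_limit init (\<lambda>\<epsilon> d. M \<epsilon> d / (\<epsilon> powr (- s) + real d powr t))"
      if "weakly_tractable s t scP scQ H G S"
      unfolding vanishes_M
    proof (rule uniformly_small_mono)
      show "uniformly_small s t init' L.log_count" using that unfolding wt .
    qed (use lam1 in \<open>auto simp: admissible_def intro: L.level_max_le_log_count\<close>)
    show "weakly_tractable s t scP scQ H G S"
      if "1 < t \<and> vanishes_in_limit init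
        (\<lambda>\<epsilon> d. ln (real d) * M \<epsilon> d / (\<epsilon> powr (- s) + real d powr t))"
      unfolding wt using that unfolding vanishes_ln_M
      by (intro L.sufficient_if_gt_1[OF s _ gt init_gt]) auto
  qed
qed

end
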